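(* Let $\mathbb{F}$ be a field and let $F \colon [0,\infty]^2 \to \mathsf{Vec}_{\mathbb{F}}$ be a pointwise finite-dimensional functor. The following are equivalent. (i) $F$ is middle-exact. (ii) $F$ is the direct sum of a degree $1$ functor and a codegree $1$ functor. (iii) There exists a homotopy degree $1$ functor $\widehat F \colon [0,\infty]^2 \to \mathrm{Ch}_{\mathbb{F}}$ such that $F \cong H_0 \circ \widehat F$.
   Context: $\mathsf{Vec}_{\mathbb{F}}$ is the category of $\mathbb{F}$-vector spaces; $\mathrm{Ch}_{\mathbb{F}}$ is the category of unbounded chain complexes of $\mathbb{F}$-vector spaces with its canonical (projective) model structure, whose weak equivalences are the quasi-isomorphisms; $H_0$ is degree-$0$ homology. $[0,\infty]$ is the totally ordered set of nonnegative reals with a maximal element $\infty$ added, and $P=[0,\infty]^2$ carries the product partial order (a distributive lattice); posets are regarded as categories. Pointwise finite-dimensional means $F(x)$ is finite-dimensional for all $x$. A functor $F \colon P \to \mathsf{Vec}_{\mathbb{F}}$ is middle-exact if for all $x,y\in P$ the sequence $F(x\wedge y)\to F(x)\oplus F(y)\to F(x\vee y)$ is exact in the middle, where the first map has as components the two structure maps and the second is the difference of the two structure maps. A functor from a distributive lattice is codegree $1$ (resp. degree $1$) if it sends every bicartesian square of the lattice (a square that is both a pushout and a pullback in $P$, i.e. one with corners $x\wedge y,x,y,x\vee y$ for some $x,y$) to a pushout (resp. pullback) square. A functor $\widehat F\colon P\to\mathrm{Ch}_{\mathbb{F}}$ is homotopy degree $1$ if it sends every such square to a homotopy cartesian square,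 i.e. the canonical map $\widehat F(x\wedge y)\to\operatorname{holim}\big(\widehat F(x)\to\widehat F(x\vee y)\leftarrow\widehat F(y)\big)$ is a weak equivalence. *)

theory Defs
  imports
    "HOL-Library.Product_Order"
    "HOL-Library.Extended_Nonnegative_Real"
    "HOL-Algebra.AbelCoset"
    "Jordan_Normal_Form.Missing_VectorSpace"
begin

text \<open>
  Vector spaces over a field \<open>K\<close> are module records \<open>V\<close> with \<open>vectorspace K V\<close>; maps are HOL
  functions that matter only on carriers, so all equations between maps are stated on carriers.

  A proposition cannot quantify over carrier types, so "there is a functor to vector spaces (chain
  complexes)" has to name one. For a functor with carrier type \<open>'v\<close>, direct summands fit in \<open>'v\<close>
  itself. A complex can be built at \<open>x = (x1, x2)\<close> from the direct sums of the spaces \<open>G (x1, \<infinity>)\<close>,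
  \<open>G (\<infinity>, x2)\<close>, \<open>G (\<infinity>, \<infinity>)\<close> for a degree 1 functor \<open>G\<close> and \<open>H (0, 0)\<close>, \<open>H (x1, 0)\<close>,
  \<open>H (0, x2)\<close> for a codegree 1 functor \<open>H\<close>, so \<open>nat \<Rightarrow> 'v\<close> is large enough for it. Implications
  from such an existence statement are meant for witnesses with any carrier type.
\<close>

lemma linear_map_iff:
  "linear_map K V W T \<longleftrightarrow> vectorspace K V \<and> vectorspace K W \<and> T \<in> module_hom K V W"
  by (auto simp: linear_map_def mod_hom_def mod_hom_axioms_def vectorspace_def)

section \<open>Quotient spaces\<close>

text \<open>
  The scalar action on a coset is \<open>c (v + N) = c v + N\<close>. Adding \<open>N\<close> is needed for \<open>c = 0\<close>, where
  the elementwise image of a coset is only \<open>{0}\<close>. The ring multiplication and unit of the record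
  are dummies, as in \<^const>\<open>direct_sum\<close>.
\<close>

definition quotient_space ::
    "('k, 'v, 'm) module_scheme \<Rightarrow> 'v set \<Rightarrow> ('k, 'v set) module" where
  "quotient_space M N =
    \<lparr>carrier = a_rcosets\<^bsub>M\<^esub> N, mult = (\<lambda>_ _. N), one = N, zero = N, add = set_add M,
     smult = (\<lambda>c X. N <+>\<^bsub>M\<^esub> ((\<lambda>v. c \<odot>\<^bsub>M\<^esub> v) ` X))\<rparr>"

lemma submodule_abelian_subgroup:
  assumes "submodule R N M"
  shows "abelian_subgroup N M"
proof -
  interpret module R M using assms by (simp add: submodule_def)
  have inv: "\<ominus>\<^bsub>M\<^esub> v \<in> N" if "v \<in> N" for v
  proof -
    have "v \<in> carrier M" using assms that by (auto simp: submodule_def)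
    then have "\<ominus>\<^bsub>M\<^esub> v = (\<ominus>\<^bsub>R\<^esub> \<one>\<^bsub>R\<^esub>) \<odot>\<^bsub>M\<^esub> v" by (simp add: smult_minus_1)
    also have "\<dots> \<in> N" using assms that unfolding submodule_def by simp
    finally show ?thesis .
  qed
  have "subgroup N (add_monoid M)"
    using assms inv by (intro add.subgroupI) (auto simp: submodule_def)
  then show ?thesis
    by (intro abelian_subgroupI3 additive_subgroup.intro abelian_group_axioms)
qed

lemma coset_eq_iff:
  assumes "submodule R N M" "a \<in> carrier M" "b \<in> carrier M"
  shows "N +>\<^bsub>M\<^esub> a = N +>\<^bsub>M\<^esub> b \<longleftrightarrow> a \<ominus>\<^bsub>M\<^esub> b \<in> N"
proof -
  interpret abelian_subgroup N M using assms(1) by (rule submodule_abelian_subgroup)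
  have "N +>\<^bsub>M\<^esub> a = N +>\<^bsub>M\<^esub> b \<longleftrightarrow> a \<in> N +>\<^bsub>M\<^esub> b"
    using assms(2,3) a_repr_independence' a_rcos_self by metis
  then show ?thesis
    using assms(2,3) a_rcos_module[of b a] by (simp add: a_minus_def)
qed

lemma coset_image:
  assumes "submodule R N M" "submodule R N' M'"
    and "f \<in> module_hom R M M'" "f ` N \<subseteq> N'" "a \<in> carrier M"
  shows "N' <+>\<^bsub>M'\<^esub> (f ` (N +>\<^bsub>M\<^esub> a)) = N' +>\<^bsub>M'\<^esub> f a"
proof -
  interpret M: abelian_subgroup N M using assms(1) by (rule submodule_abelian_subgroup)
  interpret M': abelian_subgroup N' M' using assms(2) by (rule submodule_abelian_subgroup)
  have fa: "f a \<in> carrier M'" using assms(3,5) by (auto simp: module_hom_def)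
  have f_add: "f (n \<oplus>\<^bsub>M\<^esub> a) = f n \<oplus>\<^bsub>M'\<^esub> f a" if "n \<in> N" for n
    using assms(3,5) that by (simp add: module_hom_def)
  have assoc: "x \<oplus>\<^bsub>M'\<^esub> (f n \<oplus>\<^bsub>M'\<^esub> f a) = (x \<oplus>\<^bsub>M'\<^esub> f n) \<oplus>\<^bsub>M'\<^esub> f a \<and> x \<oplus>\<^bsub>M'\<^esub> f n \<in> N'"
    if "x \<in> N'" "n \<in> N" for x n
  proof -
    have "f n \<in> N'" using that(2) assms(4) by auto
    then show ?thesis using that fa by (simp add: M'.a_assoc)
  qed
  have "N' <+>\<^bsub>M'\<^esub> (f ` (N +>\<^bsub>M\<^esub> a)) \<subseteq> N' +>\<^bsub>M'\<^esub> f a"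
    by (force simp: set_add_def' a_r_coset_def' f_add assoc)
  moreover have "N' +>\<^bsub>M'\<^esub> f a \<subseteq> N' <+>\<^bsub>M'\<^esub> (f ` (N +>\<^bsub>M\<^esub> a))"
    using M.a_rcos_self[OF assms(5)] unfolding set_add_def' a_r_coset_def'[of M'] by fast
  ultimately show ?thesis by simp
qed

lemma carrier_quotient_space:
  "carrier (quotient_space M N) = (\<lambda>a. N +>\<^bsub>M\<^esub> a) ` carrier M"
  by (auto simp: quotient_space_def A_RCOSETS_def RCOSETS_def a_r_coset_def)

lemma zero_quotient_space [simp]: "\<zero>\<^bsub>quotient_space M N\<^esub> = N"
  by (simp add: quotient_space_def)

lemma add_quotient_space:
  assumes "submodule R N M" "a \<in> carrier M" "b \<in> carrier M"
  shows "(N +>\<^bsub>M\<^esub> a) \<oplus>\<^bsub>quotient_space M N\<^esub> (N +>\<^bsub>M\<^esub> b) = N +>\<^bsub>M\<^esub> (a \<oplus>\<^bsub>M\<^esub> b)"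
proof -
  interpret abelian_subgroup N M using assms(1) by (rule submodule_abelian_subgroup)
  show ?thesis using assms by (simp add: quotient_space_def a_rcos_sum)
qed

lemma smult_quotient_space:
  assumes "submodule R N M" "c \<in> carrier R" "a \<in> carrier M"
  shows "c \<odot>\<^bsub>quotient_space M N\<^esub> (N +>\<^bsub>M\<^esub> a) = N +>\<^bsub>M\<^esub> (c \<odot>\<^bsub>M\<^esub> a)"
proof -
  interpret module R M using assms(1) by (simp add: submodule_def)
  have "(\<lambda>v. c \<odot>\<^bsub>M\<^esub> v) \<in> module_hom R M M"
    using assms(2) by (auto simp: module_hom_def smult_r_distr smult_assoc1[symmetric] R.m_comm)
  moreover have "(\<lambda>v. c \<odot>\<^bsub>M\<^esub> v) ` N \<subseteq> N"
    using assms(1,2) by (auto simp: submodule_def)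
  ultimately show ?thesis
    using coset_image[OF assms(1,1)] assms(3) by (simp add: quotient_space_def)
qed

lemma coset_zero:
  assumes "submodule R N M" shows "N = N +>\<^bsub>M\<^esub> \<zero>\<^bsub>M\<^esub>"
proof -
  interpret abelian_subgroup N M using assms(1) by (rule submodule_abelian_subgroup)
  show ?thesis by (simp add: a_rcos_const)
qed

lemma vectorspace_quotient_space:
  assumes "vectorspace K M" "submodule K N M"
  shows "vectorspace K (quotient_space M N)"
proof -
  interpret vectorspace K M by fact
  note [simp] = add_quotient_space[OF assms(2)] smult_quotient_space[OF assms(2)]
  have z: "\<zero>\<^bsub>quotient_space M N\<^esub> = N +>\<^bsub>M\<^esub> \<zero>\<^bsub>M\<^esub>"
    using coset_zero[OF assms(2)] by simp
  have neg: "\<exists>w\<in>carrier (quotient_space M N). v \<oplus>\<^bsub>quotient_space M N\<^esub> w = \<zero>\<^bsub>quotient_space M N\<^esub>"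
    if v: "v \<in> carrier (quotient_space M N)" for v
  proof -
    from v obtain a where a: "a \<in> carrier M" "v = N +>\<^bsub>M\<^esub> a" by (auto simp: carrier_quotient_space)
    then show ?thesis
      by (intro bexI[of _ "N +>\<^bsub>M\<^esub> (\<ominus>\<^bsub>M\<^esub> a)"])
        (auto simp: z M.r_neg carrier_quotient_space simp del: zero_quotient_space)
  qed
  show ?thesis
    using neg
    by (intro vs_criteria field_axioms)
      (auto simp: z carrier_quotient_space M.a_ac smult_l_distr smult_r_distr smult_assoc1
        simp del: zero_quotient_space)
qed

section \<open>Pullback and pushout squares of vector spaces\<close>

text \<open>
  The squares are
    \<open>f : A \<rightarrow> B\<close>, \<open>g : A \<rightarrow> C\<close>, \<open>h : B \<rightarrow> D\<close>, \<open>k : C \<rightarrow> D\<close>.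
  Such a square is a pullback (pushout) if it commutes and the canonical map from \<open>A\<close> to the fibre
  product \<open>B \<times>\<^sub>D C\<close> (to \<open>D\<close> from the amalgamated sum \<open>(B \<oplus> C) / {(f a, - g a)}\<close>) is an isomorphism.
  The universal properties, with test objects over
  an arbitrary carrier type, are derived below.
\<close>

definition commutative_square where
  "commutative_square K A B C D f g h k \<longleftrightarrow>
    linear_map K A B f \<and> linear_map K A C g \<and> linear_map K B D h \<and> linear_map K C D k \<and>
    (\<forall>a\<in>carrier A. h (f a) = k (g a))"

definition fibre_product where
  "fibre_product B C h k = {(b, c). b \<in> carrier B \<and> c \<in> carrier C \<and> h b = k c}"

definition pullback_square where
  "pullback_square K A B C D f g h k \<longleftrightarrow>
    commutative_square K A B C D f g h k \<and>
    bij_betw (\<lambda>a. (f a, g a)) (carrier A) (fibre_product B C h k)"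

definition amalgamated_sum where
  "amalgamated_sum A B C f g =
    quotient_space (direct_sum B C) ((\<lambda>a. (f a, \<ominus>\<^bsub>C\<^esub> g a)) ` carrier A)"

definition pushout_square where
  "pushout_square K A B C D f g h k \<longleftrightarrow>
    commutative_square K A B C D f g h k \<and>
    bij_betw (\<lambda>X. the_elem ((\<lambda>(b, c). h b \<oplus>\<^bsub>D\<^esub> k c) ` X))
      (carrier (amalgamated_sum A B C f g)) (carrier D)"

lemma pullback_square_universal:
  assumes "pullback_square K A B C D f g h k" "linear_map K T B p" "linear_map K T C q"
    and "\<And>t. t \<in> carrier T \<Longrightarrow> h (p t) = k (q t)"
  shows "\<exists>u. linear_map K T A u \<and> (\<forall>t\<in>carrier T. f (u t) = p t \<and> g (u t) = q t) \<and>
    (\<forall>u'\<in>carrier T \<rightarrow> carrier A. (\<forall>t\<in>carrier T. f (u' t) = p t \<and> g (u' t) = q t) \<longrightarrow>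
      (\<forall>t\<in>carrier T. u' t = u t))"
proof -
  interpret f: linear_map K A B f using assms(1) by (simp add: pullback_square_def commutative_square_def)
  interpret g: linear_map K A C g using assms(1) by (simp add: pullback_square_def commutative_square_def)
  interpret p: linear_map K T B p by fact
  interpret q: linear_map K T C q by fact
  let ?c = "\<lambda>a. (f a, g a)"
  have bij: "bij_betw ?c (carrier A) (fibre_product B C h k)"
    using assms(1) by (simp add: pullback_square_def)
  have inj: "a = b" if "a \<in> carrier A" "b \<in> carrier A" "f a = f b" "g a = g b" for a b
    using bij that by (auto simp: bij_betw_def inj_on_def)
  have "\<exists>a\<in>carrier A. f a = p t \<and> g a = q t" if "t \<in> carrier T" for t
  proof -
    have "(p t, q t) \<in> ?c ` carrier A"
      using bij that assms(4) by (auto simp: bij_betw_def fibre_product_def)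
    then show ?thesis by auto
  qed
  then obtain u where u: "\<And>t. t \<in> carrier T \<Longrightarrow> u t \<in> carrier A \<and> f (u t) = p t \<and> g (u t) = q t"
    by metis
  have "linear_map K T A u"
    unfolding linear_map_iff module_hom_def
    using u p.V.vectorspace_axioms f.V.vectorspace_axioms
    by (intro conjI CollectI) (auto intro: inj)
  then show ?thesis using u inj
    by (intro exI[of _ u]) (auto simp: Pi_def)
qed


lemma pushout_square_iff:
  assumes "commutative_square K A B C D f g h k"
  shows "pushout_square K A B C D f g h k \<longleftrightarrow>
    (\<forall>d\<in>carrier D. \<exists>b\<in>carrier B. \<exists>c\<in>carrier C. d = h b \<oplus>\<^bsub>D\<^esub> k c) \<and>
    (\<forall>b\<in>carrier B. \<forall>c\<in>carrier C. h b \<oplus>\<^bsub>D\<^esub> k c = \<zero>\<^bsub>D\<^esub> \<longrightarrow>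
      (\<exists>a\<in>carrier A. b = f a \<and> c = \<ominus>\<^bsub>C\<^esub> g a))"
proof -
  interpret A: vectorspace K A using assms by (simp add: commutative_square_def linear_map_iff)
  interpret B: vectorspace K B using assms by (simp add: commutative_square_def linear_map_iff)
  interpret C: vectorspace K C using assms by (simp add: commutative_square_def linear_map_iff)
  interpret D: vectorspace K D using assms by (simp add: commutative_square_def linear_map_iff)
  interpret f: linear_map K A B f using assms by (simp add: commutative_square_def)
  interpret g: linear_map K A C g using assms by (simp add: commutative_square_def)
  interpret h: linear_map K B D h using assms by (simp add: commutative_square_def)
  interpret k: linear_map K C D k using assms by (simp add: commutative_square_def)
  let ?M = "direct_sum B C"
  let ?N = "(\<lambda>a. (f a, \<ominus>\<^bsub>C\<^esub> g a)) ` carrier A"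
  let ?\<phi> = "\<lambda>(b, c). h b \<oplus>\<^bsub>D\<^esub> k c"
  let ?c = "\<lambda>X. the_elem (?\<phi> ` X)"
  have hk: "h (f a) = k (g a)" if "a \<in> carrier A" for a
    using assms that by (simp add: commutative_square_def)
  have carM: "carrier ?M = carrier B \<times> carrier C" by (simp add: direct_sum_def)
  have M: "vectorspace K ?M"
    using B.vectorspace_axioms C.vectorspace_axioms by (rule direct_sum_is_vs)
  interpret M: vectorspace K ?M by (rule M)
  interpret \<phi>: linear_map K ?M D ?\<phi>
    unfolding linear_map_iff
    using M D.vectorspace_axioms
    by (auto simp: module_hom_def direct_sum_def D.smult_r_distr D.M.a_ac)
  have "linear_map K A ?M (\<lambda>a. (f a, \<ominus>\<^bsub>C\<^esub> g a))"
    unfolding linear_map_iff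
    using M A.vectorspace_axioms
    by (auto simp: module_hom_def direct_sum_def C.M.minus_add C.smult_r_minus)
  then have sub: "submodule K ?N ?M"
    using mod_hom.im_is_submodule[of K A ?M] by (simp add: linear_map_def mod_hom.im_def)
  interpret N: abelian_subgroup ?N ?M using sub by (rule submodule_abelian_subgroup)
  have zN: "?\<phi> n = \<zero>\<^bsub>D\<^esub>" if "n \<in> ?N" for n
    using that by (auto simp: hk D.M.r_neg)
  have img: "?\<phi> ` (?N +>\<^bsub>?M\<^esub> w) = {?\<phi> w}" if w: "w \<in> carrier ?M" for w
  proof -
    have eq: "?\<phi> (n \<oplus>\<^bsub>?M\<^esub> w) = ?\<phi> w" if "n \<in> ?N" for n
      using that w zN[OF that] N.a_Hcarr[OF that] by (simp only: \<phi>.f_add) simp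
    have "?\<phi> ` (?N +>\<^bsub>?M\<^esub> w) \<subseteq> {?\<phi> w}"
    proof
      fix y assume "y \<in> ?\<phi> ` (?N +>\<^bsub>?M\<^esub> w)"
      then obtain n where n: "n \<in> ?N" "y = ?\<phi> (n \<oplus>\<^bsub>?M\<^esub> w)"
        unfolding a_r_coset_def' by blast
      show "y \<in> {?\<phi> w}" using n(2) eq[OF n(1)] by (simp only: singleton_iff)
    qed
    then show ?thesis using N.a_rcos_self[OF w] by blast
  qed
  have cq: "?c (?N +>\<^bsub>?M\<^esub> w) = ?\<phi> w" if "w \<in> carrier ?M" for w
    using img[OF that] by simp
  have "pushout_square K A B C D f g h k \<longleftrightarrow>
    inj_on ?c ((\<lambda>w. ?N +>\<^bsub>?M\<^esub> w) ` carrier ?M) \<and> ?\<phi> ` carrier ?M = carrier D"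
    using assms
    by (simp add: pushout_square_def amalgamated_sum_def carrier_quotient_space bij_betw_def
        image_image cq cong: image_cong)
  also have "inj_on ?c ((\<lambda>w. ?N +>\<^bsub>?M\<^esub> w) ` carrier ?M) \<longleftrightarrow>
    (\<forall>w\<in>carrier ?M. ?\<phi> w = \<zero>\<^bsub>D\<^esub> \<longrightarrow> w \<in> ?N)"
  proof safe
    fix b c
    assume inj: "inj_on ?c ((\<lambda>w. ?N +>\<^bsub>?M\<^esub> w) ` carrier ?M)"
      and w: "(b, c) \<in> carrier ?M" and 0: "h b \<oplus>\<^bsub>D\<^esub> k c = \<zero>\<^bsub>D\<^esub>"
    have "?N +>\<^bsub>?M\<^esub> (b, c) = ?N +>\<^bsub>?M\<^esub> \<zero>\<^bsub>?M\<^esub>"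
      using inj_onD[OF inj, of "?N +>\<^bsub>?M\<^esub> (b, c)" "?N +>\<^bsub>?M\<^esub> \<zero>\<^bsub>?M\<^esub>"] w 0
        cq[OF w] cq[OF M.M.zero_closed] \<phi>.f0_is_0 by force
    then show "(b, c) \<in> ?N"
      using N.a_rcos_self[OF w] coset_zero[OF sub] by simp
  next
    assume ker: "\<forall>w\<in>carrier ?M. ?\<phi> w = \<zero>\<^bsub>D\<^esub> \<longrightarrow> w \<in> ?N"
    show "inj_on ?c ((\<lambda>w. ?N +>\<^bsub>?M\<^esub> w) ` carrier ?M)"
    proof (rule inj_onI, clarify)
      fix v w assume v: "v \<in> carrier ?M" and w: "w \<in> carrier ?M"
        and "?c (?N +>\<^bsub>?M\<^esub> v) = ?c (?N +>\<^bsub>?M\<^esub> w)"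
      then have "?\<phi> (v \<ominus>\<^bsub>?M\<^esub> w) = \<zero>\<^bsub>D\<^esub>"
        using cq[OF v] cq[OF w] \<phi>.f_minus[OF v w] \<phi>.f_im[OF w] by (simp add: D.M.r_neg a_minus_def)
      then show "?N +>\<^bsub>?M\<^esub> v = ?N +>\<^bsub>?M\<^esub> w"
        using ker v w coset_eq_iff[OF sub v w] M.M.minus_closed by blast
    qed
  qed
  also have "\<dots> \<longleftrightarrow> (\<forall>b\<in>carrier B. \<forall>c\<in>carrier C. h b \<oplus>\<^bsub>D\<^esub> k c = \<zero>\<^bsub>D\<^esub> \<longrightarrow>
      (\<exists>a\<in>carrier A. b = f a \<and> c = \<ominus>\<^bsub>C\<^esub> g a))"
    unfolding carM by auto
  also have "?\<phi> ` carrier ?M = carrier D \<longleftrightarrow>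
    (\<forall>d\<in>carrier D. \<exists>b\<in>carrier B. \<exists>c\<in>carrier C. d = h b \<oplus>\<^bsub>D\<^esub> k c)"
  proof -
    have "?\<phi> ` (carrier B \<times> carrier C) \<subseteq> carrier D" by auto
    then have "?\<phi> ` (carrier B \<times> carrier C) = carrier D \<longleftrightarrow>
        (\<forall>d\<in>carrier D. d \<in> ?\<phi> ` (carrier B \<times> carrier C))"
      by blast
    then show ?thesis unfolding carM by (simp add: image_iff)
  qed
  finally show ?thesis by blast
qed

lemma pushout_square_universal:
  assumes "pushout_square K A B C D f g h k" "linear_map K B T p" "linear_map K C T q"
    and pq: "\<And>a. a \<in> carrier A \<Longrightarrow> p (f a) = q (g a)"
  shows "\<exists>u. linear_map K D T u \<and>
    (\<forall>b\<in>carrier B. u (h b) = p b) \<and> (\<forall>c\<in>carrier C. u (k c) = q c) \<and>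
    (\<forall>u'. linear_map K D T u' \<longrightarrow>
      (\<forall>b\<in>carrier B. u' (h b) = p b) \<longrightarrow> (\<forall>c\<in>carrier C. u' (k c) = q c) \<longrightarrow>
      (\<forall>d\<in>carrier D. u' d = u d))"
proof -
  have comm: "commutative_square K A B C D f g h k"
    using assms(1) by (simp add: pushout_square_def)
  note po = assms(1)[unfolded pushout_square_iff[OF comm]]
  interpret A: vectorspace K A using comm by (simp add: commutative_square_def linear_map_iff)
  interpret B: vectorspace K B using comm by (simp add: commutative_square_def linear_map_iff)
  interpret C: vectorspace K C using comm by (simp add: commutative_square_def linear_map_iff)
  interpret D: vectorspace K D using comm by (simp add: commutative_square_def linear_map_iff)
  interpret f: linear_map K A B f using comm by (simp add: commutative_square_def)
  interpret g: linear_map K A C g using comm by (simp add: commutative_square_def)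
  interpret h: linear_map K B D h using comm by (simp add: commutative_square_def)
  interpret k: linear_map K C D k using comm by (simp add: commutative_square_def)
  interpret T: vectorspace K T using assms(2) by (simp add: linear_map_iff)
  interpret p: linear_map K B T p by fact
  interpret q: linear_map K C T q by fact
  have wd: "p b \<oplus>\<^bsub>T\<^esub> q c = p b' \<oplus>\<^bsub>T\<^esub> q c'"
    if car: "b \<in> carrier B" "b' \<in> carrier B" "c \<in> carrier C" "c' \<in> carrier C"
      and eq: "h b \<oplus>\<^bsub>D\<^esub> k c = h b' \<oplus>\<^bsub>D\<^esub> k c'" for b b' c c'
  proof -
    have "h (b \<ominus>\<^bsub>B\<^esub> b') \<oplus>\<^bsub>D\<^esub> k (c \<ominus>\<^bsub>C\<^esub> c') = (h b \<oplus>\<^bsub>D\<^esub> k c) \<ominus>\<^bsub>D\<^esub> (h b' \<oplus>\<^bsub>D\<^esub> k c')"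
      using car by (simp add: a_minus_def D.M.a_ac D.M.minus_add)
    also have "\<dots> = \<zero>\<^bsub>D\<^esub>" unfolding eq using car by (simp add: a_minus_def D.M.r_neg)
    finally obtain a where a: "a \<in> carrier A" "b \<ominus>\<^bsub>B\<^esub> b' = f a" "c \<ominus>\<^bsub>C\<^esub> c' = \<ominus>\<^bsub>C\<^esub> g a"
      using po car B.M.minus_closed C.M.minus_closed by meson
    have "(p b \<oplus>\<^bsub>T\<^esub> q c) \<ominus>\<^bsub>T\<^esub> (p b' \<oplus>\<^bsub>T\<^esub> q c') = p (b \<ominus>\<^bsub>B\<^esub> b') \<oplus>\<^bsub>T\<^esub> q (c \<ominus>\<^bsub>C\<^esub> c')"
      using car by (simp add: a_minus_def T.M.a_ac T.M.minus_add)
    also have "\<dots> = \<zero>\<^bsub>T\<^esub>" unfolding a(2,3) using a(1) by (simp add: pq T.M.r_neg)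
    finally show ?thesis using car T.M.minus_other_side by simp
  qed
  obtain \<beta> \<gamma> where bc: "\<And>d. d \<in> carrier D \<Longrightarrow>
      \<beta> d \<in> carrier B \<and> \<gamma> d \<in> carrier C \<and> d = h (\<beta> d) \<oplus>\<^bsub>D\<^esub> k (\<gamma> d)"
    using po by metis
  define u where "u d = p (\<beta> d) \<oplus>\<^bsub>T\<^esub> q (\<gamma> d)" for d
  have u: "u (h b \<oplus>\<^bsub>D\<^esub> k c) = p b \<oplus>\<^bsub>T\<^esub> q c" if "b \<in> carrier B" "c \<in> carrier C" for b c
    using bc[of "h b \<oplus>\<^bsub>D\<^esub> k c"] that unfolding u_def by (intro wd) auto
  have uh: "u (h b) = p b" if "b \<in> carrier B" for b
    using u[of b "\<zero>\<^bsub>C\<^esub>"] that by simp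
  have uk: "u (k c) = q c" if "c \<in> carrier C" for c
    using u[of "\<zero>\<^bsub>B\<^esub>" c] that by simp
  have "u (d \<oplus>\<^bsub>D\<^esub> d') = u d \<oplus>\<^bsub>T\<^esub> u d'" if d: "d \<in> carrier D" "d' \<in> carrier D" for d d'
  proof -
    have "d \<oplus>\<^bsub>D\<^esub> d' = (h (\<beta> d) \<oplus>\<^bsub>D\<^esub> k (\<gamma> d)) \<oplus>\<^bsub>D\<^esub> (h (\<beta> d') \<oplus>\<^bsub>D\<^esub> k (\<gamma> d'))"
      using bc d by metis
    also have "\<dots> = h (\<beta> d \<oplus>\<^bsub>B\<^esub> \<beta> d') \<oplus>\<^bsub>D\<^esub> k (\<gamma> d \<oplus>\<^bsub>C\<^esub> \<gamma> d')"
      using bc d by (simp add: D.M.a_ac)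
    finally show ?thesis
      using u[of "\<beta> d \<oplus>\<^bsub>B\<^esub> \<beta> d'" "\<gamma> d \<oplus>\<^bsub>C\<^esub> \<gamma> d'"] bc d by (simp add: u_def T.M.a_ac)
  qed
  moreover have "u (r \<odot>\<^bsub>D\<^esub> d) = r \<odot>\<^bsub>T\<^esub> u d" if d: "r \<in> carrier K" "d \<in> carrier D" for r d
  proof -
    have "r \<odot>\<^bsub>D\<^esub> d = r \<odot>\<^bsub>D\<^esub> (h (\<beta> d) \<oplus>\<^bsub>D\<^esub> k (\<gamma> d))"
      using bc[OF d(2)] by simp
    also have "\<dots> = h (r \<odot>\<^bsub>B\<^esub> \<beta> d) \<oplus>\<^bsub>D\<^esub> k (r \<odot>\<^bsub>C\<^esub> \<gamma> d)"
      using bc[OF d(2)] d(1) D.smult_r_distr[OF d(1)] by (metis h.f_im k.f_im h.f_smult k.f_smult)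
    finally show ?thesis
      using u[of "r \<odot>\<^bsub>B\<^esub> \<beta> d" "r \<odot>\<^bsub>C\<^esub> \<gamma> d"] bc d by (simp add: u_def T.smult_r_distr)
  qed
  moreover have "u d \<in> carrier T" if "d \<in> carrier D" for d
    using bc that by (simp add: u_def)
  ultimately have "linear_map K D T u"
    unfolding linear_map_iff module_hom_def
    using D.vectorspace_axioms T.vectorspace_axioms by auto
  moreover have "u' d = u d" if u': "linear_map K D T u'" "\<forall>b\<in>carrier B. u' (h b) = p b"
    "\<forall>c\<in>carrier C. u' (k c) = q c" and d: "d \<in> carrier D" for u' d
  proof -
    interpret u': linear_map K D T u' by fact
    have "u' d = u' (h (\<beta> d) \<oplus>\<^bsub>D\<^esub> k (\<gamma> d))" using bc d by metis
    also have "\<dots> = u d"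
    proof -
      have "\<beta> d \<in> carrier B" "\<gamma> d \<in> carrier C" using bc[OF d] by auto
      then show ?thesis using u' by (simp add: u_def)
    qed
    finally show ?thesis .
  qed
  ultimately show ?thesis using uh uk by (intro exI[of _ u]) blast
qed

section \<open>Functors from a poset to vector spaces\<close>

record ('p, 'k, 'v) vfunctor =
  obj :: "'p \<Rightarrow> ('k, 'v) module"
  arr :: "'p \<Rightarrow> 'p \<Rightarrow> 'v \<Rightarrow> 'v"

definition is_vfunctor :: "('k, 'm) ring_scheme \<Rightarrow> ('p::order, 'k, 'v) vfunctor \<Rightarrow> bool" where
  "is_vfunctor K F \<longleftrightarrow>
    (\<forall>x. vectorspace K (obj F x)) \<and>
    (\<forall>x y. x \<le> y \<longrightarrow> linear_map K (obj F x) (obj F y) (arr F x y)) \<and>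
    (\<forall>x. \<forall>v\<in>carrier (obj F x). arr F x x v = v) \<and>
    (\<forall>x y z. x \<le> y \<longrightarrow> y \<le> z \<longrightarrow>
      (\<forall>v\<in>carrier (obj F x). arr F y z (arr F x y v) = arr F x z v))"

definition pointwise_fin_dim :: "('k, 'm) ring_scheme \<Rightarrow> ('p, 'k, 'v) vfunctor \<Rightarrow> bool" where
  "pointwise_fin_dim K F \<longleftrightarrow> (\<forall>x. vectorspace.fin_dim K (obj F x))"

definition vfunctor_iso ::
    "('k, 'm) ring_scheme \<Rightarrow> ('p::order, 'k, 'v) vfunctor \<Rightarrow> ('p, 'k, 'w) vfunctor \<Rightarrow> bool" where
  "vfunctor_iso K F G \<longleftrightarrow>
    (\<exists>\<eta>. (\<forall>x. linear_map K (obj F x) (obj G x) (\<eta> x) \<and>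
              bij_betw (\<eta> x) (carrier (obj F x)) (carrier (obj G x))) \<and>
         (\<forall>x y. x \<le> y \<longrightarrow>
            (\<forall>v\<in>carrier (obj F x). \<eta> y (arr F x y v) = arr G x y (\<eta> x v))))"

definition direct_sum_vfunctor ::
    "('p, 'k, 'v) vfunctor \<Rightarrow> ('p, 'k, 'w) vfunctor \<Rightarrow> ('p, 'k, 'v \<times> 'w) vfunctor" where
  "direct_sum_vfunctor F G =
    \<lparr>obj = (\<lambda>x. direct_sum (obj F x) (obj G x)),
     arr = (\<lambda>x y. map_prod (arr F x y) (arr G x y))\<rparr>"

definition middle_exact ::
    "('p::distrib_lattice, 'k, 'v) vfunctor \<Rightarrow> bool" where
  "middle_exact F \<longleftrightarrow>
    (\<forall>x y. (\<lambda>v. (arr F (inf x y) x v, arr F (inf x y) y v)) ` carrier (obj F (inf x y)) =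
      {w \<in> carrier (direct_sum (obj F x) (obj F y)).
        arr F x (sup x y) (fst w) \<ominus>\<^bsub>obj F (sup x y)\<^esub> arr F y (sup x y) (snd w)
          = \<zero>\<^bsub>obj F (sup x y)\<^esub>})"

definition degree1 :: "('k, 'm) ring_scheme \<Rightarrow> ('p::distrib_lattice, 'k, 'v) vfunctor \<Rightarrow> bool" where
  "degree1 K F \<longleftrightarrow>
    (\<forall>x y. pullback_square K
      (obj F (inf x y)) (obj F x) (obj F y) (obj F (sup x y))
      (arr F (inf x y) x) (arr F (inf x y) y) (arr F x (sup x y)) (arr F y (sup x y)))"

definition codegree1 :: "('k, 'm) ring_scheme \<Rightarrow> ('p::distrib_lattice, 'k, 'v) vfunctor \<Rightarrow> bool" where
  "codegree1 K F \<longleftrightarrow>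
    (\<forall>x y. pushout_square K
      (obj F (inf x y)) (obj F x) (obj F y) (obj F (sup x y))
      (arr F (inf x y) x) (arr F (inf x y) y) (arr F x (sup x y)) (arr F y (sup x y)))"

section \<open>Unbounded chain complexes\<close>

text \<open>Homological grading: \<open>bdry C n\<close> maps degree \<open>n\<close> to degree \<open>n - 1\<close>.\<close>

record ('k, 'v) cplx =
  grade :: "int \<Rightarrow> ('k, 'v) module"
  bdry :: "int \<Rightarrow> 'v \<Rightarrow> 'v"

definition is_cplx :: "('k, 'm) ring_scheme \<Rightarrow> ('k, 'v) cplx \<Rightarrow> bool" where
  "is_cplx K C \<longleftrightarrow>
    (\<forall>n. linear_map K (grade C n) (grade C (n - 1)) (bdry C n)) \<and>
    (\<forall>n. \<forall>v\<in>carrier (grade C n). bdry C (n - 1) (bdry C n v) = \<zero>\<^bsub>grade C (n - 1 - 1)\<^esub>)"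

definition is_chain_map ::
    "('k, 'm) ring_scheme \<Rightarrow> ('k, 'v) cplx \<Rightarrow> ('k, 'w) cplx \<Rightarrow> (int \<Rightarrow> 'v \<Rightarrow> 'w) \<Rightarrow> bool" where
  "is_chain_map K C D f \<longleftrightarrow>
    is_cplx K C \<and> is_cplx K D \<and>
    (\<forall>n. linear_map K (grade C n) (grade D n) (f n)) \<and>
    (\<forall>n. \<forall>v\<in>carrier (grade C n). f (n - 1) (bdry C n v) = bdry D n (f n v))"

definition cycles :: "('k, 'v) cplx \<Rightarrow> int \<Rightarrow> 'v set" where
  "cycles C n = {v \<in> carrier (grade C n). bdry C n v = \<zero>\<^bsub>grade C (n - 1)\<^esub>}"

definition boundaries :: "('k, 'v) cplx \<Rightarrow> int \<Rightarrow> 'v set" where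
  "boundaries C n = bdry C (n + 1) ` carrier (grade C (n + 1))"

definition homology :: "('k, 'v) cplx \<Rightarrow> int \<Rightarrow> ('k, 'v set) module" where
  "homology C n = quotient_space ((grade C n)\<lparr>carrier := cycles C n\<rparr>) (boundaries C n)"

text \<open>The class \<open>X = z + B\<close> is sent to \<open>f z + B'\<close>, written without choosing a representative.\<close>

definition homology_map ::
    "('k, 'w) cplx \<Rightarrow> (int \<Rightarrow> 'v \<Rightarrow> 'w) \<Rightarrow> int \<Rightarrow> 'v set \<Rightarrow> 'w set" where
  "homology_map D f n X = boundaries D n <+>\<^bsub>grade D n\<^esub> (f n ` X)"

definition quasi_iso ::
    "('k, 'm) ring_scheme \<Rightarrow> ('k, 'v) cplx \<Rightarrow> ('k, 'w) cplx \<Rightarrow> (int \<Rightarrow> 'v \<Rightarrow> 'w) \<Rightarrow> bool" where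
  "quasi_iso K C D f \<longleftrightarrow>
    is_chain_map K C D f \<and>
    (\<forall>n. bij_betw (homology_map D f n) (carrier (homology C n)) (carrier (homology D n)))"

lemma is_cplx_vectorspace: "is_cplx K C \<Longrightarrow> vectorspace K (grade C n)"
  by (auto simp: is_cplx_def linear_map_iff)

lemma cycles_closed: "z \<in> cycles C n \<Longrightarrow> z \<in> carrier (grade C n)"
  by (simp add: cycles_def)

lemma submodule_boundaries:
  assumes "is_cplx K C"
  shows "submodule K (boundaries C n) ((grade C n)\<lparr>carrier := cycles C n\<rparr>)"
    and "vectorspace K ((grade C n)\<lparr>carrier := cycles C n\<rparr>)"
    and "submodule K (boundaries C n) (grade C n)"
proof -
  interpret d: linear_map K "grade C n" "grade C (n - 1)" "bdry C n"
    using assms by (simp add: is_cplx_def)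
  interpret d': linear_map K "grade C (n + 1)" "grade C n" "bdry C (n + 1)"
    using assms spec[of "\<lambda>n. linear_map K (grade C n) (grade C (n - 1)) (bdry C n)" "n + 1"]
    by (simp add: is_cplx_def)
  have Z: "submodule K (cycles C n) (grade C n)"
    using d.kerT_is_subspace by (simp add: VectorSpace.subspace_def cycles_def d.ker_def)
  show vs: "vectorspace K ((grade C n)\<lparr>carrier := cycles C n\<rparr>)"
    using module.submodule_is_module[OF _ Z] is_cplx_vectorspace[OF assms, of n]
    by (simp add: vectorspace_def)
  show B: "submodule K (boundaries C n) (grade C n)"
    using d'.im_is_submodule by (simp add: boundaries_def d'.im_def)
  have "boundaries C n \<subseteq> cycles C n"
  proof
    fix z assume "z \<in> boundaries C n"
    then obtain v where v: "v \<in> carrier (grade C (n + 1))" "z = bdry C (n + 1) v"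
      by (auto simp: boundaries_def)
    have "bdry C (n + 1 - 1) (bdry C (n + 1) v) = \<zero>\<^bsub>grade C (n + 1 - 1 - 1)\<^esub>"
      using assms v(1) unfolding is_cplx_def by blast
    then show "z \<in> cycles C n" using v by (simp add: cycles_def)
  qed
  then show "submodule K (boundaries C n) ((grade C n)\<lparr>carrier := cycles C n\<rparr>)"
    using B vs unfolding LinearCombinations.submodule_def vectorspace_def by simp
qed

lemma carrier_homology:
  "carrier (homology C n) = (\<lambda>z. boundaries C n +>\<^bsub>grade C n\<^esub> z) ` cycles C n"
  by (simp add: homology_def carrier_quotient_space a_r_coset_def')

lemma vectorspace_homology: "is_cplx K C \<Longrightarrow> vectorspace K (homology C n)"
  unfolding homology_def by (rule vectorspace_quotient_space[OF submodule_boundaries(2,1)])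

lemma homology_map_coset:
  assumes "is_chain_map K C D f" "z \<in> carrier (grade C n)"
  shows "homology_map D f n (boundaries C n +>\<^bsub>grade C n\<^esub> z) = boundaries D n +>\<^bsub>grade D n\<^esub> f n z"
proof -
  have "f n ` boundaries C n \<subseteq> boundaries D n"
  proof clarsimp
    fix b assume "b \<in> boundaries C n"
    then obtain v where v: "v \<in> carrier (grade C (n + 1))" "b = bdry C (n + 1) v"
      by (auto simp: boundaries_def)
    have "f (n + 1 - 1) (bdry C (n + 1) v) = bdry D (n + 1) (f (n + 1) v)"
      using assms(1) v(1) unfolding is_chain_map_def by blast
    moreover have "f (n + 1) v \<in> carrier (grade D (n + 1))"
      using assms(1) v(1) by (auto simp: is_chain_map_def linear_map_iff module_hom_def)
    ultimately show "f n b \<in> boundaries D n" using v by (auto simp: boundaries_def)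
  qed
  moreover have "f n \<in> module_hom K (grade C n) (grade D n)"
    using assms(1) by (simp add: is_chain_map_def linear_map_iff)
  moreover have "is_cplx K C" "is_cplx K D" using assms(1) by (auto simp: is_chain_map_def)
  ultimately show ?thesis
    using assms(2) unfolding homology_map_def
    by (intro coset_image) (auto intro: submodule_boundaries)
qed

lemma linear_map_homology_map:
  assumes "is_chain_map K C D f"
  shows "linear_map K (homology C n) (homology D n) (homology_map D f n)"
proof -
  have C: "is_cplx K C" and D: "is_cplx K D" using assms by (auto simp: is_chain_map_def)
  let ?C = "(grade C n)\<lparr>carrier := cycles C n\<rparr>" and ?D = "(grade D n)\<lparr>carrier := cycles D n\<rparr>"
  have fz: "f n z \<in> cycles D n" if "z \<in> cycles C n" for z
  proof -
    interpret f: linear_map K "grade C (n - 1)" "grade D (n - 1)" "f (n - 1)"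
      using assms by (simp add: is_chain_map_def)
    show ?thesis
      using assms that f.f0_is_0 unfolding is_chain_map_def cycles_def linear_map_iff module_hom_def
      by (smt (verit, best) PiE mem_Collect_eq)
  qed
  interpret f: linear_map K "grade C n" "grade D n" "f n" using assms by (simp add: is_chain_map_def)
  interpret Z: vectorspace K ?C using C by (rule submodule_boundaries)
  have cl: "z \<oplus>\<^bsub>grade C n\<^esub> z' \<in> cycles C n" if "z \<in> cycles C n" "z' \<in> cycles C n" for z z'
    using Z.M.a_closed that by simp
  have cl': "c \<odot>\<^bsub>grade C n\<^esub> z \<in> cycles C n" if "c \<in> carrier K" "z \<in> cycles C n" for c z
    using Z.smult_closed that by simp
  have coset: "boundaries C n +>\<^bsub>?C\<^esub> z = boundaries C n +>\<^bsub>grade C n\<^esub> z"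
    "boundaries D n +>\<^bsub>?D\<^esub> w = boundaries D n +>\<^bsub>grade D n\<^esub> w" for z w
    by (auto simp: a_r_coset_def')
  note hm = homology_map_coset[OF assms cycles_closed]
  note add = add_quotient_space[OF submodule_boundaries(1)[OF C], of _ n, folded homology_def, simplified coset]
    add_quotient_space[OF submodule_boundaries(1)[OF D], of _ n, folded homology_def, simplified coset]
  note smult = smult_quotient_space[OF submodule_boundaries(1)[OF C], of _ _ n, folded homology_def, simplified coset]
    smult_quotient_space[OF submodule_boundaries(1)[OF D], of _ _ n, folded homology_def, simplified coset]
  have "homology_map D f n \<in> module_hom K (homology C n) (homology D n)"
    by (auto simp: module_hom_def carrier_homology hm fz cl cl' add smult cycles_closed)
  then show ?thesis using C D by (simp add: linear_map_iff vectorspace_homology)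
qed

text \<open>
  The homotopy limit of \<open>B \<rightarrow>\<^sub>h D \<leftarrow>\<^sub>k C\<close>. Every object of the projective model structure is fibrant,
  so it is computed by the pullback of \<open>B \<times> C \<rightarrow> D \<times> D\<close> along the path object of \<open>D\<close>: in degree
  \<open>n\<close> it consists of \<open>(b, c, d)\<close> with \<open>b\<close>, \<open>c\<close> of degree \<open>n\<close> and \<open>d\<close> (a path from \<open>h b\<close> to \<open>k c\<close>)
  of degree \<open>n + 1\<close>, with differential \<open>(\<partial>b, \<partial>c, h b - k c - \<partial>d)\<close>.
\<close>

definition homotopy_pullback ::
    "('k, 'b) cplx \<Rightarrow> ('k, 'c) cplx \<Rightarrow> ('k, 'd) cplx \<Rightarrow> (int \<Rightarrow> 'b \<Rightarrow> 'd) \<Rightarrow> (int \<Rightarrow> 'c \<Rightarrow> 'd)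
      \<Rightarrow> ('k, 'b \<times> 'c \<times> 'd) cplx" where
  "homotopy_pullback B C D h k =
    \<lparr>grade = (\<lambda>n. direct_sum (grade B n) (direct_sum (grade C n) (grade D (n + 1)))),
     bdry = (\<lambda>n (b, c, d).
       (bdry B n b, bdry C n c,
        (h n b \<ominus>\<^bsub>grade D n\<^esub> k n c) \<ominus>\<^bsub>grade D n\<^esub> bdry D (n + 1) d))\<rparr>"

text \<open>
  For a strictly commutative square the canonical map to the homotopy limit uses constant paths.
\<close>

definition homotopy_cartesian ::
    "('k, 'm) ring_scheme \<Rightarrow> ('k, 'a) cplx \<Rightarrow> ('k, 'b) cplx \<Rightarrow> ('k, 'c) cplx \<Rightarrow> ('k, 'd) cplx
      \<Rightarrow> (int \<Rightarrow> 'a \<Rightarrow> 'b) \<Rightarrow> (int \<Rightarrow> 'a \<Rightarrow> 'c) \<Rightarrow> (int \<Rightarrow> 'b \<Rightarrow> 'd) \<Rightarrow> (int \<Rightarrow> 'c \<Rightarrow> 'd) \<Rightarrow> bool" where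
  "homotopy_cartesian K A B C D f g h k \<longleftrightarrow>
    quasi_iso K A (homotopy_pullback B C D h k) (\<lambda>n a. (f n a, g n a, \<zero>\<^bsub>grade D (n + 1)\<^esub>))"

lemma diff_zero_right:
  assumes "abelian_group G" "x \<in> carrier G"
  shows "x \<ominus>\<^bsub>G\<^esub> \<zero>\<^bsub>G\<^esub> = x"
proof -
  interpret abelian_group G by fact
  have "\<ominus>\<^bsub>G\<^esub> \<zero>\<^bsub>G\<^esub> = \<zero>\<^bsub>G\<^esub>" by (rule minus_equality) simp_all
  then show ?thesis using assms(2) by (simp add: a_minus_def)
qed

lemma is_cplx_homotopy_pullback:
  assumes h: "is_chain_map K B D h" and k: "is_chain_map K C D k"
  shows "is_cplx K (homotopy_pullback B C D h k)"
proof -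
  have cB: "is_cplx K B" and cC: "is_cplx K C" and cD: "is_cplx K D"
    using h k by (auto simp: is_chain_map_def)
  have vs: "vectorspace K (grade (homotopy_pullback B C D h k) n)" for n
    using cB cC cD by (simp add: homotopy_pullback_def direct_sum_is_vs is_cplx_vectorspace)
  have lin: "linear_map K (grade B n) (grade B (n - 1)) (bdry B n)"
    "linear_map K (grade C n) (grade C (n - 1)) (bdry C n)"
    "linear_map K (grade D (n + 1)) (grade D n) (bdry D (n + 1))"
    "linear_map K (grade B n) (grade D n) (h n)" "linear_map K (grade C n) (grade D n) (k n)" for n
    using h k spec[of "\<lambda>n. linear_map K (grade D n) (grade D (n - 1)) (bdry D n)" "n + 1"]
    by (auto simp: is_chain_map_def is_cplx_def)
  have dd: "bdry C (n - 1) (bdry C n v) = \<zero>\<^bsub>grade C (n - 1 - 1)\<^esub>"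
    if "is_cplx K C" "v \<in> carrier (grade C n)" for n v and C :: "('a, 'x) cplx"
    using that by (simp add: is_cplx_def)
  have "linear_map K (grade (homotopy_pullback B C D h k) n)
      (grade (homotopy_pullback B C D h k) (n - 1)) (bdry (homotopy_pullback B C D h k) n)" for n
  proof -
    interpret B: linear_map K "grade B n" "grade B (n - 1)" "bdry B n" by (rule lin)
    interpret C: linear_map K "grade C n" "grade C (n - 1)" "bdry C n" by (rule lin)
    interpret Dn: vectorspace K "grade D n" using cD by (rule is_cplx_vectorspace)
    interpret D: linear_map K "grade D (n + 1)" "grade D n" "bdry D (n + 1)" by (rule lin)
    interpret h: linear_map K "grade B n" "grade D n" "h n" by (rule lin)
    interpret k: linear_map K "grade C n" "grade D n" "k n" by (rule lin)
    have "bdry (homotopy_pullback B C D h k) n \<in> module_hom K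
      (grade (homotopy_pullback B C D h k) n) (grade (homotopy_pullback B C D h k) (n - 1))"
      by (auto simp: module_hom_def homotopy_pullback_def direct_sum_def a_minus_def
          Dn.smult_r_distr Dn.smult_r_minus Dn.M.minus_add Dn.M.a_ac)
    then show ?thesis using vs by (simp add: linear_map_iff)
  qed
  moreover have "bdry (homotopy_pullback B C D h k) (n - 1) (bdry (homotopy_pullback B C D h k) n v)
      = \<zero>\<^bsub>grade (homotopy_pullback B C D h k) (n - 1 - 1)\<^esub>"
    if v: "v \<in> carrier (grade (homotopy_pullback B C D h k) n)" for n v
  proof -
    obtain b c d where v': "v = (b, c, d)" "b \<in> carrier (grade B n)" "c \<in> carrier (grade C n)"
      "d \<in> carrier (grade D (n + 1))"
      using v by (cases v) (auto simp: homotopy_pullback_def direct_sum_def)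
    interpret Dn: vectorspace K "grade D n" using cD by (rule is_cplx_vectorspace)
    interpret Dn1: vectorspace K "grade D (n - 1)" using cD by (rule is_cplx_vectorspace)
    interpret D: linear_map K "grade D n" "grade D (n - 1)" "bdry D n"
      using cD by (simp add: is_cplx_def)
    interpret D1: linear_map K "grade D (n + 1)" "grade D n" "bdry D (n + 1)" by (rule lin)
    interpret h: linear_map K "grade B n" "grade D n" "h n" by (rule lin)
    interpret k: linear_map K "grade C n" "grade D n" "k n" by (rule lin)
    have h': "h (n - 1) (bdry B n b) = bdry D n (h n b)"
      and k': "k (n - 1) (bdry C n c) = bdry D n (k n c)"
      using h k v' by (auto simp: is_chain_map_def)
    have car: "h n b \<in> carrier (grade D n)" "k n c \<in> carrier (grade D n)"
      "bdry D (n + 1) d \<in> carrier (grade D n)"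
      using v' by auto
    have dd': "bdry D n (bdry D (n + 1) d) = \<zero>\<^bsub>grade D (n - 1)\<^esub>"
      using dd[OF cD, of d "n + 1"] v' by simp
    let ?X = "bdry D n (h n b) \<ominus>\<^bsub>grade D (n - 1)\<^esub> bdry D n (k n c)"
    have X: "?X \<in> carrier (grade D (n - 1))"
      using car by (intro Dn1.M.minus_closed D.f_im)
    have "bdry D n ((h n b \<ominus>\<^bsub>grade D n\<^esub> k n c) \<ominus>\<^bsub>grade D n\<^esub> bdry D (n + 1) d) =
        ?X \<ominus>\<^bsub>grade D (n - 1)\<^esub> \<zero>\<^bsub>grade D (n - 1)\<^esub>"
      using car by (simp add: dd')
    also have "\<dots> = ?X"
      using X by (rule diff_zero_right[OF Dn1.abelian_group_axioms])
    finally have "?X \<ominus>\<^bsub>grade D (n - 1)\<^esub>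
        bdry D n ((h n b \<ominus>\<^bsub>grade D n\<^esub> k n c) \<ominus>\<^bsub>grade D n\<^esub> bdry D (n + 1) d) =
        \<zero>\<^bsub>grade D (n - 1)\<^esub>"
      using X by (simp only: Dn1.minus_other_side)
    then show ?thesis
      using v' dd[OF cB] dd[OF cC] by (simp add: homotopy_pullback_def direct_sum_def h' k')
  qed
  ultimately show ?thesis by (simp add: is_cplx_def)
qed

lemma is_chain_map_to_homotopy_pullback:
  assumes f: "is_chain_map K A B f" and g: "is_chain_map K A C g"
    and h: "is_chain_map K B D h" and k: "is_chain_map K C D k"
    and comm: "\<And>n a. a \<in> carrier (grade A n) \<Longrightarrow> h n (f n a) = k n (g n a)"
  shows "is_chain_map K A (homotopy_pullback B C D h k)
    (\<lambda>n a. (f n a, g n a, \<zero>\<^bsub>grade D (n + 1)\<^esub>))"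
proof -
  have hp: "is_cplx K (homotopy_pullback B C D h k)"
    using h k by (rule is_cplx_homotopy_pullback)
  have cA: "is_cplx K A" and cD: "is_cplx K D"
    using f h by (auto simp: is_chain_map_def)
  have "linear_map K (grade A n) (grade (homotopy_pullback B C D h k) n)
      (\<lambda>a. (f n a, g n a, \<zero>\<^bsub>grade D (n + 1)\<^esub>))" for n
  proof -
    interpret D: vectorspace K "grade D (n + 1)" using cD by (rule is_cplx_vectorspace)
    interpret f: linear_map K "grade A n" "grade B n" "f n" using f by (simp add: is_chain_map_def)
    interpret g: linear_map K "grade A n" "grade C n" "g n" using g by (simp add: is_chain_map_def)
    show ?thesis
      using is_cplx_vectorspace[OF hp, of n] is_cplx_vectorspace[OF cA, of n]
      by (auto simp: linear_map_iff module_hom_def homotopy_pullback_def direct_sum_def)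
  qed
  moreover have "(f (n - 1) (bdry A n a), g (n - 1) (bdry A n a), \<zero>\<^bsub>grade D (n - 1 + 1)\<^esub>)
      = bdry (homotopy_pullback B C D h k) n (f n a, g n a, \<zero>\<^bsub>grade D (n + 1)\<^esub>)"
    if a: "a \<in> carrier (grade A n)" for n a
  proof -
    interpret Dn: vectorspace K "grade D n" using cD by (rule is_cplx_vectorspace)
    interpret D: linear_map K "grade D (n + 1)" "grade D n" "bdry D (n + 1)"
      using cD spec[of "\<lambda>n. linear_map K (grade D n) (grade D (n - 1)) (bdry D n)" "n + 1"]
      by (simp add: is_cplx_def)
    interpret g: linear_map K "grade A n" "grade C n" "g n" using g by (simp add: is_chain_map_def)
    interpret k: linear_map K "grade C n" "grade D n" "k n" using k by (simp add: is_chain_map_def)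
    have "k n (g n a) \<in> carrier (grade D n)" using a by simp
    then show ?thesis
      using f g a comm[OF a]
      by (simp add: is_chain_map_def homotopy_pullback_def a_minus_def Dn.M.r_neg)
  qed
  ultimately show ?thesis using cA hp by (simp add: is_chain_map_def)
qed

section \<open>Functors from a poset to chain complexes\<close>

record ('p, 'k, 'v) cfunctor =
  cobj :: "'p \<Rightarrow> ('k, 'v) cplx"
  carr :: "'p \<Rightarrow> 'p \<Rightarrow> int \<Rightarrow> 'v \<Rightarrow> 'v"

definition is_cfunctor :: "('k, 'm) ring_scheme \<Rightarrow> ('p::order, 'k, 'v) cfunctor \<Rightarrow> bool" where
  "is_cfunctor K \<Phi> \<longleftrightarrow>
    (\<forall>x. is_cplx K (cobj \<Phi> x)) \<and>
    (\<forall>x y. x \<le> y \<longrightarrow> is_chain_map K (cobj \<Phi> x) (cobj \<Phi> y) (carr \<Phi> x y)) \<and>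
    (\<forall>x n. \<forall>v\<in>carrier (grade (cobj \<Phi> x) n). carr \<Phi> x x n v = v) \<and>
    (\<forall>x y z n. x \<le> y \<longrightarrow> y \<le> z \<longrightarrow>
      (\<forall>v\<in>carrier (grade (cobj \<Phi> x) n). carr \<Phi> y z n (carr \<Phi> x y n v) = carr \<Phi> x z n v))"

definition homology_vfunctor ::
    "int \<Rightarrow> ('p, 'k, 'v) cfunctor \<Rightarrow> ('p, 'k, 'v set) vfunctor" where
  "homology_vfunctor n \<Phi> =
    \<lparr>obj = (\<lambda>x. homology (cobj \<Phi> x) n),
     arr = (\<lambda>x y. homology_map (cobj \<Phi> y) (carr \<Phi> x y) n)\<rparr>"

lemma is_vfunctor_homology_vfunctor:
  assumes "is_cfunctor K \<Phi>"
  shows "is_vfunctor K (homology_vfunctor n \<Phi>)"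
proof -
  have cx: "is_cplx K (cobj \<Phi> x)" for x using assms by (simp add: is_cfunctor_def)
  have cm: "is_chain_map K (cobj \<Phi> x) (cobj \<Phi> y) (carr \<Phi> x y)" if "x \<le> y" for x y
    using assms that by (simp add: is_cfunctor_def)
  note hm = homology_map_coset[OF cm cycles_closed]
  have cl: "carr \<Phi> x y n z \<in> carrier (grade (cobj \<Phi> y) n)"
    if "x \<le> y" "z \<in> cycles (cobj \<Phi> x) n" for x y z
    using cm[OF that(1)] cycles_closed[OF that(2)] by (auto simp: is_chain_map_def linear_map_iff module_hom_def)
  have id: "carr \<Phi> x x n z = z" if "z \<in> cycles (cobj \<Phi> x) n" for x z
    using assms cycles_closed[OF that] by (simp add: is_cfunctor_def)
  have comp: "carr \<Phi> y w n (carr \<Phi> x y n z) = carr \<Phi> x w n z"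
    if "x \<le> y" "y \<le> w" "z \<in> cycles (cobj \<Phi> x) n" for x y w z
    using assms that(1,2) cycles_closed[OF that(3)] unfolding is_cfunctor_def by blast
  show ?thesis
    unfolding is_vfunctor_def
    by (auto simp: homology_vfunctor_def vectorspace_homology cx linear_map_homology_map cm
        carrier_homology hm homology_map_coset[OF cm cl] id comp intro: order_trans)
qed

definition homotopy_degree1 ::
    "('k, 'm) ring_scheme \<Rightarrow> ('p::distrib_lattice, 'k, 'v) cfunctor \<Rightarrow> bool" where
  "homotopy_degree1 K \<Phi> \<longleftrightarrow>
    (\<forall>x y. homotopy_cartesian K
      (cobj \<Phi> (inf x y)) (cobj \<Phi> x) (cobj \<Phi> y) (cobj \<Phi> (sup x y))
      (carr \<Phi> (inf x y) x) (carr \<Phi> (inf x y) y) (carr \<Phi> x (sup x y)) (carr \<Phi> y (sup x y)))"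

end

theory Submission
  imports Defs
begin

text \<open>
  Let \<open>Ker x\<close> consist of the vectors of \<open>F x\<close> that vanish on both far edges, in \<open>F (x1, \<infinity>)\<close> and in
  \<open>F (\<infinity>, x2)\<close>. Middle exactness of the squares with two corners on a far edge makes the structure
  maps of the subfunctor \<open>Ker\<close> surjective, so \<open>Ker\<close> is codegree 1, and any complement of \<open>Ker\<close> is
  degree 1 because it has no nonzero vector vanishing on both edges. A complement exists because
  \<open>Ker\<close> is injective relative to \<open>F\<close>: by Baer's criterion one has to extend partial sections of
  \<open>Ker\<close>; finitely many values are glued by middle exactness, one step of a staircase at a time, and
  finite dimension reduces the general case to this one.

  A functor that depends on one coordinate only is both degree 1 and codegree 1, and a complex of
  such functors is homotopy degree 1. Both summands of \<open>F\<close> are resolved by such functors.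
  Conversely, for a homotopy cartesian square, surjectivity on \<open>H\<^sub>0\<close> of the map to the homotopy limit
  is middle exactness.
\<close>

section \<open>Subspaces\<close>

text \<open>Middle exactness is what both kinds of functor share: degree 1 adds that no nonzero
  vector of \<open>F (inf x y)\<close> dies at both \<open>x\<close> and \<open>y\<close>, codegree
  1 adds that \<open>F x\<close> and \<open>F y\<close> together generate
  \<open>F (sup x y)\<close>. So the failure of injectivity has to be split off, and
  \<open>Ker\<close> contains all of it: since each factor is a chain, the coordinates of
  \<open>inf x y\<close> are coordinates of \<open>x\<close> or of \<open>y\<close>, hence a vector
  that dies at both also dies on both far edges. The far edges exist because each chain has a
  greatest element; the least element plays the dual role in the resolution, where surjectivity
  makes every \<open>Ker x\<close> a quotient of \<open>Ker\<close> at the origin. The obstacle is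
  that \<open>Ker\<close> is canonical but a complement is not: pointwise complements need not be
  respected by the structure maps. The complement is therefore found by maximality, and it serves a
  second time in the resolution: the degree 0 homology there is naturally the sum of
  \<open>Ker\<close> and \<open>F / Ker\<close>, so identifying it with \<open>F\<close> takes a
  natural retraction of \<open>F\<close> onto \<open>Ker\<close>.\<close>

context abelian_group begin

lemma minus_eq_zero_iff:
  assumes "a \<in> carrier G" "b \<in> carrier G" shows "a \<ominus> b = \<zero> \<longleftrightarrow> a = b"
  using assms by (metis minus_eq minus_equality minus_minus r_neg a_inv_closed a_comm)

lemma minus_add_cancel:
  assumes "a \<in> carrier G" "b \<in> carrier G" shows "(a \<ominus> b) \<oplus> b = a"
  using assms by (simp add: minus_eq a_assoc l_neg)

lemma add_minus_cancel:
  assumes "a \<in> carrier G" "b \<in> carrier G" shows "(a \<oplus> b) \<ominus> b = a"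
  using assms by (simp add: minus_eq a_assoc r_neg)

lemma add_eq_add_imp_minus_eq_minus:
  assumes "a \<in> carrier G" "b \<in> carrier G" "c \<in> carrier G" "d \<in> carrier G" "a \<oplus> b = c \<oplus> d"
  shows "a \<ominus> c = d \<ominus> b"
proof -
  have "a = (c \<oplus> d) \<ominus> b" using assms(1-4) assms(5)[symmetric] by (simp add: minus_eq a_assoc r_neg)
  also have "\<dots> = c \<oplus> (d \<ominus> b)" using assms by (simp add: minus_eq a_assoc)
  finally show ?thesis using assms by (metis a_ac(2) minus_eq r_neg1 a_inv_closed minus_closed a_comm)
qed

lemma minus_eq_minus_swap:
  assumes "a \<in> carrier G" "b \<in> carrier G" "c \<in> carrier G" "d \<in> carrier G" "a \<ominus> b = c \<ominus> d"
  shows "a \<ominus> c = b \<ominus> d"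
proof -
  have "a \<oplus> \<ominus> b = c \<oplus> \<ominus> d" using assms(5) by (simp add: minus_eq)
  then have "a \<ominus> c = \<ominus> d \<ominus> \<ominus> b" using assms by (intro add_eq_add_imp_minus_eq_minus) simp_all
  then show ?thesis using assms by (simp add: minus_eq a_comm)
qed

end

lemma submodule_closed:
  assumes "submodule K N M"
  shows "v \<in> N \<Longrightarrow> v \<in> carrier M" "v \<in> N \<Longrightarrow> w \<in> N \<Longrightarrow> v \<oplus>\<^bsub>M\<^esub> w \<in> N" "\<zero>\<^bsub>M\<^esub> \<in> N"
    "c \<in> carrier K \<Longrightarrow> v \<in> N \<Longrightarrow> c \<odot>\<^bsub>M\<^esub> v \<in> N"
    "v \<in> N \<Longrightarrow> \<ominus>\<^bsub>M\<^esub> v \<in> N" "v \<in> N \<Longrightarrow> w \<in> N \<Longrightarrow> v \<ominus>\<^bsub>M\<^esub> w \<in> N"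
proof -
  interpret abelian_subgroup N M using assms by (rule submodule_abelian_subgroup)
  show "v \<in> N \<Longrightarrow> v \<in> carrier M" "v \<in> N \<Longrightarrow> w \<in> N \<Longrightarrow> v \<oplus>\<^bsub>M\<^esub> w \<in> N" "\<zero>\<^bsub>M\<^esub> \<in> N"
    "c \<in> carrier K \<Longrightarrow> v \<in> N \<Longrightarrow> c \<odot>\<^bsub>M\<^esub> v \<in> N" "v \<in> N \<Longrightarrow> \<ominus>\<^bsub>M\<^esub> v \<in> N"
    "v \<in> N \<Longrightarrow> w \<in> N \<Longrightarrow> v \<ominus>\<^bsub>M\<^esub> w \<in> N"
    using assms by (auto simp: submodule_def a_minus_def)
qed

lemma vectorspace_subspace:
  "vectorspace K M \<Longrightarrow> submodule K N M \<Longrightarrow> vectorspace K (M\<lparr>carrier := N\<rparr>)"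
  using module.submodule_is_module by (auto simp: vectorspace_def)

context vectorspace begin

text \<open>Finite dimension gives the descending chain condition. A subspace is measured by the
  largest size of an independent subset, computed inside the ambient space, so subspaces are never
  turned into spaces of their own.\<close>

lemma minimal_subspace_exists:
  assumes "fin_dim" and ne: "\<T> \<noteq> {}" and sub: "\<And>T. T \<in> \<T> \<Longrightarrow> submodule K T V"
  obtains T where "T \<in> \<T>" "\<And>T'. T' \<in> \<T> \<Longrightarrow> T' \<subseteq> T \<Longrightarrow> T' = T"
proof -
  define r where "r T = Max (card ` {S. S \<subseteq> T \<and> lin_indpt S})" for T
  have fin: "finite (card ` {S. S \<subseteq> T \<and> lin_indpt S})" if "T \<in> \<T>" for T
  proof (rule finite_subset)
    show "card ` {S. S \<subseteq> T \<and> lin_indpt S} \<subseteq> {..dim}"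
      using li_le_dim(2)[OF assms(1)] submodule.subset[OF sub[OF that]] by auto
  qed simp
  have empty: "lin_indpt {}" by (auto simp: lin_dep_def)
  \<comment> \<open>A largest independent set of \<open>T'\<close> stays independent after adding a
    vector of \<open>T\<close> outside \<open>T'\<close>, because its span lies in
    \<open>T'\<close>.\<close>
  have less: "r T' < r T" if T: "T \<in> \<T>" "T' \<in> \<T>" "T' \<subset> T" for T T'
  proof -
    have "r T' \<in> card ` {S. S \<subseteq> T' \<and> lin_indpt S}"
      unfolding r_def using fin[OF T(2)] empty by (intro Max_in) auto
    then obtain S where S: "S \<subseteq> T'" "lin_indpt S" "r T' = card S" by auto
    obtain v where v: "v \<in> T" "v \<notin> T'" using T(3) by auto
    have car: "S \<subseteq> carrier V" "v \<in> carrier V"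
      using S v submodule.subset[OF sub[OF T(1)]] T(3) by auto
    have "span S \<subseteq> T'" using span_is_subset[OF S(1) sub[OF T(2)]] .
    then have "lin_indpt (S \<union> {v})"
      using lin_dep_iff_in_span[OF car(1) S(2) car(2)] v S by auto
    then have "card (S \<union> {v}) \<in> card ` {S. S \<subseteq> T \<and> lin_indpt S}"
      using S(1) v T(3) by auto
    then have "card (S \<union> {v}) \<le> r T" unfolding r_def using fin[OF T(1)] by (rule Max_ge[rotated])
    moreover have "card (S \<union> {v}) = card S + 1"
      using S v li_le_dim(1)[OF assms(1) car(1) S(2)] by (simp add: card_insert_if) blast
    ultimately show ?thesis using S by simp
  qed
  obtain T where T: "T \<in> \<T>" "\<And>T'. T' \<in> \<T> \<Longrightarrow> r T \<le> r T'"
    using ne ex_has_least_nat[of "\<lambda>T. T \<in> \<T>" _ r] by blast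
  show ?thesis
    using T less by (intro that[of T]) (auto simp: not_le[symmetric])
qed

end

section \<open>Functors to vector spaces\<close>

locale vect_functor =
  fixes K :: "('k, 'm) ring_scheme" and F :: "('p::order, 'k, 'v) vfunctor"
  assumes is_vfunctor: "is_vfunctor K F"
begin

sublocale V: vectorspace K "obj F x" for x
  using is_vfunctor by (simp add: is_vfunctor_def)

lemma arr_linear: "x \<le> y \<Longrightarrow> linear_map K (obj F x) (obj F y) (arr F x y)"
  using is_vfunctor by (simp add: is_vfunctor_def)

context
  fixes x y :: 'p assumes xy: "x \<le> y"
begin

interpretation f: linear_map K "obj F x" "obj F y" "arr F x y"
  using xy by (rule arr_linear)

lemma arr_closed [simp]: "v \<in> carrier (obj F x) \<Longrightarrow> arr F x y v \<in> carrier (obj F y)"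
  by simp

lemma arr_zero [simp]: "arr F x y \<zero>\<^bsub>obj F x\<^esub> = \<zero>\<^bsub>obj F y\<^esub>"
  by simp

lemma arr_smult [simp]: "c \<in> carrier K \<Longrightarrow> v \<in> carrier (obj F x) \<Longrightarrow>
    arr F x y (c \<odot>\<^bsub>obj F x\<^esub> v) = c \<odot>\<^bsub>obj F y\<^esub> arr F x y v"
  by simp

lemma arr_neg [simp]: "v \<in> carrier (obj F x) \<Longrightarrow>
    arr F x y (\<ominus>\<^bsub>obj F x\<^esub> v) = \<ominus>\<^bsub>obj F y\<^esub> arr F x y v"
  by simp

context
  fixes v w assumes vw: "v \<in> carrier (obj F x)" "w \<in> carrier (obj F x)"
begin

lemma arr_add [simp]: "arr F x y (v \<oplus>\<^bsub>obj F x\<^esub> w) = arr F x y v \<oplus>\<^bsub>obj F y\<^esub> arr F x y w"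
  using vw by simp

lemma arr_minus [simp]: "arr F x y (v \<ominus>\<^bsub>obj F x\<^esub> w) = arr F x y v \<ominus>\<^bsub>obj F y\<^esub> arr F x y w"
  using vw by simp

end

end

lemma arr_id [simp]: "v \<in> carrier (obj F x) \<Longrightarrow> arr F x x v = v"
  using is_vfunctor by (simp add: is_vfunctor_def)

lemma arr_comp [simp]: "x \<le> y \<Longrightarrow> y \<le> z \<Longrightarrow> v \<in> carrier (obj F x) \<Longrightarrow>
    arr F y z (arr F x y v) = arr F x z v"
  using is_vfunctor unfolding is_vfunctor_def by blast

definition subfunctor :: "('p \<Rightarrow> 'v set) \<Rightarrow> bool" where
  "subfunctor S \<longleftrightarrow> (\<forall>x. submodule K (S x) (obj F x)) \<and>
    (\<forall>x y v. x \<le> y \<longrightarrow> v \<in> S x \<longrightarrow> arr F x y v \<in> S y)"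

definition restrict_vfunctor :: "('p \<Rightarrow> 'v set) \<Rightarrow> ('p, 'k, 'v) vfunctor" where
  "restrict_vfunctor S = \<lparr>obj = \<lambda>x. (obj F x)\<lparr>carrier := S x\<rparr>, arr = arr F\<rparr>"

lemma subfunctor_closed:
  assumes "subfunctor S"
  shows "v \<in> S x \<Longrightarrow> v \<in> carrier (obj F x)" "v \<in> S x \<Longrightarrow> w \<in> S x \<Longrightarrow> v \<oplus>\<^bsub>obj F x\<^esub> w \<in> S x"
    "\<zero>\<^bsub>obj F x\<^esub> \<in> S x" "c \<in> carrier K \<Longrightarrow> v \<in> S x \<Longrightarrow> c \<odot>\<^bsub>obj F x\<^esub> v \<in> S x"
    "v \<in> S x \<Longrightarrow> \<ominus>\<^bsub>obj F x\<^esub> v \<in> S x" "v \<in> S x \<Longrightarrow> w \<in> S x \<Longrightarrow> v \<ominus>\<^bsub>obj F x\<^esub> w \<in> S x"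
    "x \<le> y \<Longrightarrow> v \<in> S x \<Longrightarrow> arr F x y v \<in> S y"
proof -
  have "submodule K (S x) (obj F x)" using assms unfolding subfunctor_def by blast
  note sub = submodule_closed[OF this]
  show "v \<in> S x \<Longrightarrow> v \<in> carrier (obj F x)" "v \<in> S x \<Longrightarrow> w \<in> S x \<Longrightarrow> v \<oplus>\<^bsub>obj F x\<^esub> w \<in> S x"
    "\<zero>\<^bsub>obj F x\<^esub> \<in> S x" "c \<in> carrier K \<Longrightarrow> v \<in> S x \<Longrightarrow> c \<odot>\<^bsub>obj F x\<^esub> v \<in> S x"
    "v \<in> S x \<Longrightarrow> \<ominus>\<^bsub>obj F x\<^esub> v \<in> S x" "v \<in> S x \<Longrightarrow> w \<in> S x \<Longrightarrow> v \<ominus>\<^bsub>obj F x\<^esub> w \<in> S x"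
    by (fact sub)+
  show "x \<le> y \<Longrightarrow> v \<in> S x \<Longrightarrow> arr F x y v \<in> S y"
    using assms unfolding subfunctor_def by blast
qed

lemma is_vfunctor_restrict:
  assumes "subfunctor S" shows "is_vfunctor K (restrict_vfunctor S)"
proof -
  note S = subfunctor_closed[OF assms]
  have vs: "vectorspace K ((obj F x)\<lparr>carrier := S x\<rparr>)" for x
    using assms vectorspace_subspace[OF V.vectorspace_axioms] unfolding subfunctor_def by blast
  have "arr F x y \<in> module_hom K ((obj F x)\<lparr>carrier := S x\<rparr>) ((obj F y)\<lparr>carrier := S y\<rparr>)"
    if "x \<le> y" for x y
    using S(1,7) that by (simp add: module_hom_def Pi_iff)
  moreover have "arr F x x v = v" if "v \<in> S x" for x v
    using S(1) that by simp
  moreover have "arr F y z (arr F x y v) = arr F x z v" if "x \<le> y" "y \<le> z" "v \<in> S x" for x y z v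
    using S(1) that by simp
  ultimately show ?thesis
    using vs by (simp add: is_vfunctor_def linear_map_iff restrict_vfunctor_def)
qed

end

section \<open>Complements of subfunctors\<close>

lemma submodule_sum_unique:
  assumes "submodule K G M" "submodule K S M" "G \<inter> S = {\<zero>\<^bsub>M\<^esub>}"
    and "g \<in> G" "g' \<in> G" "s \<in> S" "s' \<in> S" and eq: "g \<oplus>\<^bsub>M\<^esub> s = g' \<oplus>\<^bsub>M\<^esub> s'"
  shows "g = g'" "s = s'"
proof -
  interpret module K M using assms(1) by (simp add: submodule_def)
  note G = submodule_closed[OF assms(1)] and S = submodule_closed[OF assms(2)]
  note car = G(1)[OF assms(4)] G(1)[OF assms(5)] S(1)[OF assms(6)] S(1)[OF assms(7)]
  have d: "g \<ominus>\<^bsub>M\<^esub> g' = s' \<ominus>\<^bsub>M\<^esub> s"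
    using car eq by (intro M.add_eq_add_imp_minus_eq_minus)
  then have "g \<ominus>\<^bsub>M\<^esub> g' \<in> G \<inter> S"
    using G(6)[OF assms(4,5)] S(6)[OF assms(7,6)] by simp
  then show "g = g'" "s = s'"
    using assms(3) d M.minus_eq_zero_iff[OF car(1,2)] M.minus_eq_zero_iff[OF car(4,3)] by auto
qed

context vect_functor begin

definition complement :: "('p \<Rightarrow> 'v set) \<Rightarrow> ('p \<Rightarrow> 'v set) \<Rightarrow> bool" where
  "complement G S \<longleftrightarrow> subfunctor G \<and> subfunctor S \<and> (\<forall>x. G x \<inter> S x = {\<zero>\<^bsub>obj F x\<^esub>}) \<and>
    (\<forall>x. \<forall>v\<in>carrier (obj F x). \<exists>g\<in>G x. \<exists>s\<in>S x. v = g \<oplus>\<^bsub>obj F x\<^esub> s)"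

lemma subfunctorI:
  assumes "\<And>x v. v \<in> S x \<Longrightarrow> v \<in> carrier (obj F x)"
    and "\<And>x. \<zero>\<^bsub>obj F x\<^esub> \<in> S x"
    and "\<And>x v w. v \<in> S x \<Longrightarrow> w \<in> S x \<Longrightarrow> v \<oplus>\<^bsub>obj F x\<^esub> w \<in> S x"
    and "\<And>x c v. c \<in> carrier K \<Longrightarrow> v \<in> S x \<Longrightarrow> c \<odot>\<^bsub>obj F x\<^esub> v \<in> S x"
    and "\<And>x y v. x \<le> y \<Longrightarrow> v \<in> S x \<Longrightarrow> arr F x y v \<in> S y"
  shows "subfunctor S"
proof -
  have "submodule K (S x) (obj F x)" for x
  proof
    show "S x \<subseteq> carrier (obj F x)" using assms(1) by blast
  qed (fact assms V.module_axioms)+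
  then show ?thesis using assms(5) by (simp add: subfunctor_def)
qed

text \<open>The chain condition serves closure under addition: two vectors of the union lie in a
  common member. Subfunctors are coded as relations between points and vectors, so that pointwise
  inclusion becomes inclusion of sets, the form in which Zorn's lemma is applied.\<close>

lemma subfunctor_Union_chain:
  assumes "C \<noteq> {}" "\<And>M. M \<in> C \<Longrightarrow> subfunctor (\<lambda>x. M `` {x})"
    and chain: "\<And>M N. M \<in> C \<Longrightarrow> N \<in> C \<Longrightarrow> M \<subseteq> N \<or> N \<subseteq> M"
  shows "subfunctor (\<lambda>x. \<Union>C `` {x})"
proof (rule subfunctorI)
  note S = subfunctor_closed[OF assms(2)]
  show "v \<in> carrier (obj F x)" if "v \<in> \<Union>C `` {x}" for x v
    using that S(1) by blast
  show "\<zero>\<^bsub>obj F x\<^esub> \<in> \<Union>C `` {x}" for x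
    using assms(1) S(3) by blast
  show "c \<odot>\<^bsub>obj F x\<^esub> v \<in> \<Union>C `` {x}" if "c \<in> carrier K" "v \<in> \<Union>C `` {x}" for x c v
    using that S(4) by blast
  show "arr F x y v \<in> \<Union>C `` {y}" if "x \<le> y" "v \<in> \<Union>C `` {x}" for x y v
    using that S(7) by blast
  show "v \<oplus>\<^bsub>obj F x\<^esub> w \<in> \<Union>C `` {x}" if vw: "v \<in> \<Union>C `` {x}" "w \<in> \<Union>C `` {x}" for x v w
  proof -
    obtain M N where MN: "M \<in> C" "v \<in> M `` {x}" "N \<in> C" "w \<in> N `` {x}"
      using vw by blast
    then consider "w \<in> M `` {x}" | "v \<in> N `` {x}"
      using chain[of M N] by blast
    then show ?thesis
    proof cases
      case 1 with MN S(2) show ?thesis by blast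
    next
      case 2 with MN S(2) show ?thesis by blast
    qed
  qed
qed

text \<open>
  Baer's criterion: it suffices to extend a partially defined section of \<open>S\<close> from an up-set above
  \<open>x\<close> to \<open>x\<close>, that is a map to \<open>S\<close> from a subfunctor of the functor represented by \<open>x\<close>.
\<close>

lemma complement_exists:
  assumes S: "subfunctor S"
    and ext: "\<And>x U k. (\<And>y. y \<in> U \<Longrightarrow> x \<le> y) \<Longrightarrow> (\<And>y. y \<in> U \<Longrightarrow> k y \<in> S y) \<Longrightarrow>
      (\<And>y z. y \<in> U \<Longrightarrow> y \<le> z \<Longrightarrow> z \<in> U \<and> k z = arr F y z (k y)) \<Longrightarrow>
      \<exists>s\<in>S x. \<forall>y\<in>U. arr F x y s = k y"
  shows "\<exists>G. complement G S"
proof -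
  define \<A> where "\<A> = {M. subfunctor (\<lambda>x. M `` {x}) \<and> (\<forall>x. M `` {x} \<inter> S x = {\<zero>\<^bsub>obj F x\<^esub>})}"
  note Sc = subfunctor_closed[OF S]
  have A_I: "Sigma UNIV N \<in> \<A>"
    if "subfunctor N" "\<And>x. N x \<inter> S x = {\<zero>\<^bsub>obj F x\<^esub>}" for N
  proof -
    have "Sigma UNIV N `` {x} = N x" for x by auto
    then show ?thesis unfolding \<A>_def mem_Collect_eq using that by presburger
  qed
  have "\<exists>M\<in>\<A>. \<forall>X\<in>\<A>. M \<subseteq> X \<longrightarrow> X = M"
  proof (rule subset_Zorn_nonempty)
    have "subfunctor (\<lambda>x. {\<zero>\<^bsub>obj F x\<^esub>})"
      by (rule subfunctorI) auto
    moreover have "{\<zero>\<^bsub>obj F x\<^esub>} \<inter> S x = {\<zero>\<^bsub>obj F x\<^esub>}" for x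
      using Sc(3)[of x] by blast
    ultimately have "Sigma UNIV (\<lambda>x. {\<zero>\<^bsub>obj F x\<^esub>}) \<in> \<A>" by (rule A_I)
    then show "\<A> \<noteq> {}" by blast
  next
    fix C assume C: "C \<noteq> {}" "subset.chain \<A> C"
    then have CA: "M \<in> \<A>" if "M \<in> C" for M using that unfolding subset_chain_def by blast
    have "subfunctor (\<lambda>x. \<Union>C `` {x})"
    proof (rule subfunctor_Union_chain)
      show "M \<subseteq> N \<or> N \<subseteq> M" if "M \<in> C" "N \<in> C" for M N
        using that C(2) unfolding subset_chain_def by blast
      show "subfunctor (\<lambda>x. M `` {x})" if "M \<in> C" for M
        using CA[OF that] unfolding \<A>_def by blast
    qed (fact C(1))
    moreover have "\<Union>C `` {x} \<inter> S x = {\<zero>\<^bsub>obj F x\<^esub>}" for x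
    proof -
      have *: "M `` {x} \<inter> S x = {\<zero>\<^bsub>obj F x\<^esub>}" if "M \<in> C" for M
        using CA[OF that] unfolding \<A>_def by blast
      have "\<Union>C `` {x} \<inter> S x = (\<Union>M\<in>C. M `` {x} \<inter> S x)" by blast
      also have "\<dots> = {\<zero>\<^bsub>obj F x\<^esub>}" using C(1) * by blast
      finally show ?thesis .
    qed
    ultimately show "\<Union>C \<in> \<A>" unfolding \<A>_def by blast
  qed
  then obtain M where M: "M \<in> \<A>" and max: "\<And>N. N \<in> \<A> \<Longrightarrow> M \<subseteq> N \<Longrightarrow> N = M" by blast
  define G where "G x = M `` {x}" for x
  have G: "subfunctor G" and G0: "G x \<inter> S x = {\<zero>\<^bsub>obj F x\<^esub>}" for x
    using M unfolding \<A>_def G_def by blast+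
  note Gc = subfunctor_closed[OF G]
  have G_max: "N x \<subseteq> G x" if "subfunctor N" "\<And>x. N x \<inter> S x = {\<zero>\<^bsub>obj F x\<^esub>}" "\<And>x. G x \<subseteq> N x" for N x
  proof -
    have "Sigma UNIV N \<in> \<A>" using that(1,2) by (rule A_I)
    moreover have "M \<subseteq> Sigma UNIV N" using that(3) unfolding G_def by auto
    ultimately have "Sigma UNIV N = M" by (rule max)
    then show ?thesis unfolding G_def by auto
  qed
  have "\<exists>g\<in>G x. \<exists>s\<in>S x. w = g \<oplus>\<^bsub>obj F x\<^esub> s" if w: "w \<in> carrier (obj F x)" for x w
  proof -
    \<comment> \<open>\<open>U\<close> consists of the points above \<open>x\<close> where the image
      of \<open>w\<close> already splits; its \<open>S\<close>-component there is the partial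
      section \<open>k\<close> to be extended.\<close>
    define U where "U = {y. x \<le> y \<and> (\<exists>g\<in>G y. \<exists>s\<in>S y. arr F x y w = g \<oplus>\<^bsub>obj F y\<^esub> s)}"
    have "\<exists>s. \<exists>g\<in>G y. s \<in> S y \<and> arr F x y w = g \<oplus>\<^bsub>obj F y\<^esub> s" if "y \<in> U" for y
      using that by (auto simp: U_def)
    then obtain k where k: "\<And>y. y \<in> U \<Longrightarrow> \<exists>g\<in>G y. k y \<in> S y \<and> arr F x y w = g \<oplus>\<^bsub>obj F y\<^esub> k y"
      by metis
    \<comment> \<open>Uniqueness of the splitting is what makes \<open>k\<close> commute with the
      structure maps.\<close>
    have k_unique: "s = k y" if "x \<le> y" "g \<in> G y" "s \<in> S y" "arr F x y w = g \<oplus>\<^bsub>obj F y\<^esub> s" for y g s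
    proof -
      have "y \<in> U" using that by (auto simp: U_def)
      then obtain g' where "g' \<in> G y" "k y \<in> S y" "arr F x y w = g' \<oplus>\<^bsub>obj F y\<^esub> k y"
        using k by blast
      then show ?thesis
        using that G S G0[of y] unfolding subfunctor_def by (metis submodule_sum_unique(2))
    qed
    have "\<exists>s\<in>S x. \<forall>y\<in>U. arr F x y s = k y"
    proof (rule ext)
      show "x \<le> y" if "y \<in> U" for y using that by (simp add: U_def)
      show "k y \<in> S y" if "y \<in> U" for y using k[OF that] by blast
      show "z \<in> U \<and> k z = arr F y z (k y)" if y: "y \<in> U" "y \<le> z" for y z
      proof -
        obtain g where g: "g \<in> G y" "k y \<in> S y" "arr F x y w = g \<oplus>\<^bsub>obj F y\<^esub> k y"
          using k[OF y(1)] by blast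
        have xy: "x \<le> y" using y by (simp add: U_def)
        have "arr F x z w = arr F y z (arr F x y w)" using xy y(2) w by simp
        also have "\<dots> = arr F y z g \<oplus>\<^bsub>obj F z\<^esub> arr F y z (k y)"
          unfolding g(3) using y(2) g Gc(1) Sc(1) by simp
        finally have eq: "arr F x z w = arr F y z g \<oplus>\<^bsub>obj F z\<^esub> arr F y z (k y)" .
        have mem: "arr F y z g \<in> G z" "arr F y z (k y) \<in> S z"
          using g y(2) Gc(7) Sc(7) by auto
        have xz: "x \<le> z" using xy y(2) by (rule order_trans)
        show ?thesis using eq mem xz k_unique[OF xz mem eq] by (auto simp: U_def)
      qed
    qed
    then obtain s where s: "s \<in> S x" "\<And>y. y \<in> U \<Longrightarrow> arr F x y s = k y" by blast
    \<comment> \<open>Subtracting the extension moves \<open>w\<close> into \<open>G\<close> at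
      every point of \<open>U\<close>, without changing it modulo \<open>S\<close>.\<close>
    define w' where "w' = w \<ominus>\<^bsub>obj F x\<^esub> s"
    have w': "w' \<in> carrier (obj F x)" using w Sc(1)[OF s(1)] by (simp add: w'_def)
    have wU: "arr F x y w' \<in> G y" if "y \<in> U" for y
    proof -
      obtain g where g: "g \<in> G y" "k y \<in> S y" "arr F x y w = g \<oplus>\<^bsub>obj F y\<^esub> k y"
        using k[OF \<open>y \<in> U\<close>] by blast
      have "x \<le> y" using that by (simp add: U_def)
      then have "arr F x y w' = (g \<oplus>\<^bsub>obj F y\<^esub> k y) \<ominus>\<^bsub>obj F y\<^esub> k y"
        using w Sc(1)[OF s(1)] s(2)[OF that] g(3) by (simp add: w'_def)
      also have "\<dots> = g" using g Gc(1) Sc(1) by (simp add: V.M.add_minus_cancel)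
      finally show ?thesis using g(1) by simp
    qed
    \<comment> \<open>\<open>N\<close> is generated by \<open>G\<close> and \<open>w'\<close>. If it
      still meets \<open>S\<close> trivially, then maximality of \<open>G\<close> puts
      \<open>w'\<close> into \<open>G\<close>, and \<open>w\<close> splits at
      \<open>x\<close>.\<close>
    define N where "N y = (if x \<le> y then {g \<oplus>\<^bsub>obj F y\<^esub> c \<odot>\<^bsub>obj F y\<^esub> arr F x y w' | g c.
      g \<in> G y \<and> c \<in> carrier K} else G y)" for y
    have N_I: "g \<oplus>\<^bsub>obj F y\<^esub> c \<odot>\<^bsub>obj F y\<^esub> arr F x y w' \<in> N y"
      if "x \<le> y" "g \<in> G y" "c \<in> carrier K" for y g c
      using that unfolding N_def by auto
    have N_E: thesis if "v \<in> N y" "x \<le> y"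
      "\<And>g c. g \<in> G y \<Longrightarrow> c \<in> carrier K \<Longrightarrow> v = g \<oplus>\<^bsub>obj F y\<^esub> c \<odot>\<^bsub>obj F y\<^esub> arr F x y w' \<Longrightarrow> thesis"
      for v y thesis
      using that unfolding N_def by auto
    have N_G: "N y = G y" if "\<not> x \<le> y" for y using that by (simp add: N_def)
    have GN: "G y \<subseteq> N y" for y
    proof (cases "x \<le> y")
      case True
      have "g = g \<oplus>\<^bsub>obj F y\<^esub> \<zero>\<^bsub>K\<^esub> \<odot>\<^bsub>obj F y\<^esub> arr F x y w'" if "g \<in> G y" for g
        using Gc(1)[OF that] w' True by simp
      then show ?thesis using N_I[OF True _ V.R.zero_closed] by (metis subsetI)
    qed (simp add: N_G)
    have car: "g \<in> carrier (obj F y)" "c \<odot>\<^bsub>obj F y\<^esub> arr F x y w' \<in> carrier (obj F y)"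
      "arr F x y w' \<in> carrier (obj F y)"
      if "x \<le> y" "g \<in> G y" "c \<in> carrier K" for y g c
      using that w' Gc(1) by auto
    have "subfunctor N"
    proof (rule subfunctorI)
      fix y
      show "\<zero>\<^bsub>obj F y\<^esub> \<in> N y" using GN Gc(3) by blast
      fix v assume v: "v \<in> N y"
      show "v \<in> carrier (obj F y)"
        using v car Gc(1) unfolding N_def by (auto split: if_splits)
      show "v \<oplus>\<^bsub>obj F y\<^esub> u \<in> N y" if u: "u \<in> N y" for u
      proof (cases "x \<le> y")
        case True
        obtain g c where g: "g \<in> G y" "c \<in> carrier K" "v = g \<oplus>\<^bsub>obj F y\<^esub> c \<odot>\<^bsub>obj F y\<^esub> arr F x y w'"
          using N_E[OF v True] by blast
        obtain h d where h: "h \<in> G y" "d \<in> carrier K" "u = h \<oplus>\<^bsub>obj F y\<^esub> d \<odot>\<^bsub>obj F y\<^esub> arr F x y w'"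
          using N_E[OF u True] by blast
        have "v \<oplus>\<^bsub>obj F y\<^esub> u = (g \<oplus>\<^bsub>obj F y\<^esub> h) \<oplus>\<^bsub>obj F y\<^esub> (c \<oplus>\<^bsub>K\<^esub> d) \<odot>\<^bsub>obj F y\<^esub> arr F x y w'"
          using g h car[OF True] by (simp add: V.smult_l_distr V.M.a_ac)
        then show ?thesis using N_I[OF True Gc(2)] g h by simp
      qed (use u v Gc(2) N_G in auto)
      show "c \<odot>\<^bsub>obj F y\<^esub> v \<in> N y" if c: "c \<in> carrier K" for c
      proof (cases "x \<le> y")
        case True
        obtain g d where g: "g \<in> G y" "d \<in> carrier K" "v = g \<oplus>\<^bsub>obj F y\<^esub> d \<odot>\<^bsub>obj F y\<^esub> arr F x y w'"
          using N_E[OF v True] by blast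
        have "c \<odot>\<^bsub>obj F y\<^esub> v = c \<odot>\<^bsub>obj F y\<^esub> g \<oplus>\<^bsub>obj F y\<^esub> (c \<otimes>\<^bsub>K\<^esub> d) \<odot>\<^bsub>obj F y\<^esub> arr F x y w'"
          using g c car[OF True] by (simp add: V.smult_r_distr V.smult_assoc1)
        then show ?thesis using N_I[OF True Gc(4)] g c by simp
      qed (use c v Gc(4) N_G in auto)
      show "arr F y z v \<in> N z" if yz: "y \<le> z" for z
      proof (cases "x \<le> y")
        case True
        obtain g d where g: "g \<in> G y" "d \<in> carrier K" "v = g \<oplus>\<^bsub>obj F y\<^esub> d \<odot>\<^bsub>obj F y\<^esub> arr F x y w'"
          using N_E[OF v True] by blast
        have "arr F y z v = arr F y z g \<oplus>\<^bsub>obj F z\<^esub> d \<odot>\<^bsub>obj F z\<^esub> arr F x z w'"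
          using g True yz car[OF True] w' by simp
        then show ?thesis using N_I[of z] Gc(7)[OF yz] g True yz by (metis order_trans)
      next
        case False
        then show ?thesis using v Gc(7)[OF yz] GN[of z] by (auto simp: N_G)
      qed
    qed
    moreover have "N y \<inter> S y = {\<zero>\<^bsub>obj F y\<^esub>}" for y
    proof (cases "x \<le> y")
      case True
      have "v = \<zero>\<^bsub>obj F y\<^esub>" if v: "v \<in> N y" "v \<in> S y" for v
      proof -
        obtain g c where g: "g \<in> G y" "c \<in> carrier K" "v = g \<oplus>\<^bsub>obj F y\<^esub> c \<odot>\<^bsub>obj F y\<^esub> arr F x y w'"
          using N_E[OF v(1) True] by blast
        note cars = car[OF True g(1,2)]
        have vc: "v \<in> carrier (obj F y)" using v(2) Sc(1) by blast
        \<comment> \<open>For nonzero \<open>c\<close>, division by \<open>c\<close> splits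
          \<open>w'\<close> and hence \<open>w\<close> at \<open>y\<close>; so \<open>y\<close> lies
          in \<open>U\<close>, where \<open>w'\<close> is already in \<open>G\<close>.\<close>
        have "v \<in> G y"
        proof (cases "c = \<zero>\<^bsub>K\<^esub>")
          case True
          then show ?thesis using g cars by simp
        next
          case False
          then have ci: "inv\<^bsub>K\<^esub> c \<in> carrier K" "inv\<^bsub>K\<^esub> c \<otimes>\<^bsub>K\<^esub> c = \<one>\<^bsub>K\<^esub>"
            using g(2) V.field_Units by (auto simp: V.Units_l_inv)
          have "c \<odot>\<^bsub>obj F y\<^esub> arr F x y w' = \<ominus>\<^bsub>obj F y\<^esub> g \<oplus>\<^bsub>obj F y\<^esub> v"
            unfolding g(3) using cars by (simp add: V.M.r_neg1)
          moreover have "arr F x y w' = inv\<^bsub>K\<^esub> c \<odot>\<^bsub>obj F y\<^esub> (c \<odot>\<^bsub>obj F y\<^esub> arr F x y w')"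
            using ci g(2) cars by (simp flip: V.smult_assoc1)
          ultimately have "arr F x y w' =
              inv\<^bsub>K\<^esub> c \<odot>\<^bsub>obj F y\<^esub> (\<ominus>\<^bsub>obj F y\<^esub> g) \<oplus>\<^bsub>obj F y\<^esub> inv\<^bsub>K\<^esub> c \<odot>\<^bsub>obj F y\<^esub> v"
            using ci cars vc by (simp add: V.smult_r_distr)
          moreover have "arr F x y w = arr F x y w' \<oplus>\<^bsub>obj F y\<^esub> arr F x y s"
            using w Sc(1)[OF s(1)] \<open>x \<le> y\<close> by (simp add: w'_def V.M.minus_add_cancel)
          ultimately have "arr F x y w = inv\<^bsub>K\<^esub> c \<odot>\<^bsub>obj F y\<^esub> (\<ominus>\<^bsub>obj F y\<^esub> g) \<oplus>\<^bsub>obj F y\<^esub>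
              (inv\<^bsub>K\<^esub> c \<odot>\<^bsub>obj F y\<^esub> v \<oplus>\<^bsub>obj F y\<^esub> arr F x y s)"
            using ci cars vc Sc(1)[OF s(1)] \<open>x \<le> y\<close> by (simp add: V.M.a_assoc)
          moreover have "inv\<^bsub>K\<^esub> c \<odot>\<^bsub>obj F y\<^esub> (\<ominus>\<^bsub>obj F y\<^esub> g) \<in> G y"
            using Gc(4)[OF ci(1) Gc(5)[OF g(1)]] .
          moreover have "inv\<^bsub>K\<^esub> c \<odot>\<^bsub>obj F y\<^esub> v \<oplus>\<^bsub>obj F y\<^esub> arr F x y s \<in> S y"
            using Sc(2)[OF Sc(4)[OF ci(1) v(2)] Sc(7)[OF \<open>x \<le> y\<close> s(1)]] .
          ultimately have "y \<in> U" using \<open>x \<le> y\<close> by (auto simp: U_def)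
          then show ?thesis unfolding g(3) using Gc(2)[OF g(1) Gc(4)[OF g(2) wU]] by simp
        qed
        then show ?thesis using v(2) G0[of y] by blast
      qed
      then show ?thesis using Sc(3) GN[of y] Gc(3) by blast
    qed (simp add: N_G G0)
    ultimately have "N x \<subseteq> G x" using GN by (intro G_max)
    moreover have "w' \<in> N x"
      using N_I[OF order_refl Gc(3) V.one_closed] w' by simp
    ultimately have "w' \<in> G x" by blast
    moreover have "w = w' \<oplus>\<^bsub>obj F x\<^esub> s"
      using w Sc(1)[OF s(1)] by (simp add: w'_def V.M.minus_add_cancel)
    ultimately show ?thesis using s(1) by blast
  qed
  then have "complement G S"
    unfolding complement_def using G S G0 by blast
  then show ?thesis by blast
qed

end

section \<open>Middle-exact functors on a product of two chains\<close>

lemma middle_exactD: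
  assumes "middle_exact F" "v \<in> carrier (obj F x)" "w \<in> carrier (obj F y)"
    and "arr F x (sup x y) v \<ominus>\<^bsub>obj F (sup x y)\<^esub> arr F y (sup x y) w = \<zero>\<^bsub>obj F (sup x y)\<^esub>"
  obtains u where "u \<in> carrier (obj F (inf x y))" "arr F (inf x y) x u = v" "arr F (inf x y) y u = w"
proof -
  have "(v, w) \<in> {w \<in> carrier (direct_sum (obj F x) (obj F y)).
      arr F x (sup x y) (fst w) \<ominus>\<^bsub>obj F (sup x y)\<^esub> arr F y (sup x y) (snd w)
        = \<zero>\<^bsub>obj F (sup x y)\<^esub>}"
    using assms(2-4) by (simp add: direct_sum_def)
  also have "\<dots> = (\<lambda>v. (arr F (inf x y) x v, arr F (inf x y) y v)) ` carrier (obj F (inf x y))"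
    using assms(1) unfolding middle_exact_def by blast
  finally show ?thesis using that by blast
qed

text \<open>That the image lies in the kernel is functoriality, so what remains is the lifting of
  compatible pairs.\<close>

lemma middle_exact_iff:
  fixes F :: "('p::distrib_lattice, 'k, 'v) vfunctor"
  assumes "is_vfunctor K F"
  shows "middle_exact F \<longleftrightarrow> (\<forall>x y. \<forall>v\<in>carrier (obj F x). \<forall>w\<in>carrier (obj F y).
    arr F x (sup x y) v = arr F y (sup x y) w \<longrightarrow>
    (\<exists>u\<in>carrier (obj F (inf x y)). arr F (inf x y) x u = v \<and> arr F (inf x y) y u = w))"
    (is "_ \<longleftrightarrow> ?R")
proof -
  interpret F: vect_functor K F by (unfold_locales) fact
  have sub: "(\<lambda>v. (arr F (inf x y) x v, arr F (inf x y) y v)) ` carrier (obj F (inf x y)) \<subseteq>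
      {w \<in> carrier (direct_sum (obj F x) (obj F y)).
        arr F x (sup x y) (fst w) \<ominus>\<^bsub>obj F (sup x y)\<^esub> arr F y (sup x y) (snd w)
          = \<zero>\<^bsub>obj F (sup x y)\<^esub>}" for x y
    by (clarsimp simp: direct_sum_def F.V.M.minus_eq_zero_iff le_supI1)
  show ?thesis
  proof
    assume me: "middle_exact F"
    show ?R
    proof (intro allI ballI impI)
      fix x y v w assume vw: "v \<in> carrier (obj F x)" "w \<in> carrier (obj F y)"
        and "arr F x (sup x y) v = arr F y (sup x y) w"
      then have "arr F x (sup x y) v \<ominus>\<^bsub>obj F (sup x y)\<^esub> arr F y (sup x y) w = \<zero>\<^bsub>obj F (sup x y)\<^esub>"
        by (simp add: F.V.M.minus_eq_zero_iff)
      then show "\<exists>u\<in>carrier (obj F (inf x y)). arr F (inf x y) x u = v \<and> arr F (inf x y) y u = w"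
        using middle_exactD[OF me vw] by blast
    qed
  next
    assume R: ?R
    have "{w \<in> carrier (direct_sum (obj F x) (obj F y)).
        arr F x (sup x y) (fst w) \<ominus>\<^bsub>obj F (sup x y)\<^esub> arr F y (sup x y) (snd w)
          = \<zero>\<^bsub>obj F (sup x y)\<^esub>} \<subseteq>
      (\<lambda>v. (arr F (inf x y) x v, arr F (inf x y) y v)) ` carrier (obj F (inf x y))" for x y
    proof
      fix p assume p: "p \<in> {w \<in> carrier (direct_sum (obj F x) (obj F y)).
        arr F x (sup x y) (fst w) \<ominus>\<^bsub>obj F (sup x y)\<^esub> arr F y (sup x y) (snd w)
          = \<zero>\<^bsub>obj F (sup x y)\<^esub>}"
      define v w where "v = fst p" "w = snd p"
      then have vw: "v \<in> carrier (obj F x)" "w \<in> carrier (obj F y)" "p = (v, w)"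
        and eq: "arr F x (sup x y) v \<ominus>\<^bsub>obj F (sup x y)\<^esub> arr F y (sup x y) w = \<zero>\<^bsub>obj F (sup x y)\<^esub>"
        using p by (simp_all add: direct_sum_def mem_Times_iff)
      have "arr F x (sup x y) v = arr F y (sup x y) w"
        using eq F.V.M.minus_eq_zero_iff[OF F.arr_closed[OF sup_ge1 vw(1)] F.arr_closed[OF sup_ge2 vw(2)]]
        by blast
      then obtain u where "u \<in> carrier (obj F (inf x y))" "arr F (inf x y) x u = v" "arr F (inf x y) y u = w"
        using R[rule_format, OF vw(1,2)] by blast
      then show "p \<in> (\<lambda>v. (arr F (inf x y) x v, arr F (inf x y) y v)) ` carrier (obj F (inf x y))"
        unfolding vw(3) by blast
    qed
    with sub show "middle_exact F" unfolding middle_exact_def by blast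
  qed
qed

text \<open>Stated for any two complete chains: completeness provides a least and a greatest element
  in each coordinate, and \<open>[0, \<infinity>]\<close> is the case in mind.\<close>

locale grid_functor = vect_functor K F
  for K :: "('k, 'm) ring_scheme"
    and F :: "('a::complete_linorder \<times> 'b::complete_linorder, 'k, 'v) vfunctor" +
  assumes middle_exact: "middle_exact F" and fin_dim: "pointwise_fin_dim K F"
begin

text \<open>Two incomparable points of a product of chains are always opposite corners of such a
  rectangle, with their meet and join as the other two.\<close>

lemma middle_exact_rect:
  assumes "a \<le> a'" "b \<le> b'" "v \<in> carrier (obj F (a, b'))" "w \<in> carrier (obj F (a', b))"
    and "arr F (a, b') (a', b') v = arr F (a', b) (a', b') w"
  obtains u where "u \<in> carrier (obj F (a, b))" "arr F (a, b) (a, b') u = v" "arr F (a, b) (a', b) u = w"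
proof -
  have eq: "inf (a, b') (a', b) = (a, b)" "sup (a, b') (a', b) = (a', b')"
    using assms(1,2) by (simp_all add: inf_absorb1 inf_absorb2 sup_absorb1 sup_absorb2)
  show ?thesis
    using middle_exact[unfolded middle_exact_iff[OF is_vfunctor], rule_format, OF assms(3,4)] assms(5) that
    unfolding eq by blast
qed

definition Ker :: "'a \<times> 'b \<Rightarrow> 'v set" where
  "Ker x = {v \<in> carrier (obj F x). arr F x (fst x, Orderings.top) v = \<zero>\<^bsub>obj F (fst x, Orderings.top)\<^esub> \<and>
    arr F x (Orderings.top, snd x) v = \<zero>\<^bsub>obj F (Orderings.top, snd x)\<^esub>}"

lemma le_edge: "x \<le> (fst x, Orderings.top)" "x \<le> (Orderings.top, snd x)"
  for x :: "'a \<times> 'b"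
  by (simp_all add: less_eq_prod_def)

lemma arr_eq_zero_mono:
  assumes "x \<le> y" "y \<le> z" "v \<in> carrier (obj F x)" "arr F x y v = \<zero>\<^bsub>obj F y\<^esub>"
  shows "arr F x z v = \<zero>\<^bsub>obj F z\<^esub>"
  using arr_comp[OF assms(1-3)] assms(2,4) by simp

lemma subfunctor_Ker: "subfunctor Ker"
proof (rule subfunctorI)
  show "v \<in> carrier (obj F x)" if "v \<in> Ker x" for x v using that by (simp add: Ker_def)
  show "\<zero>\<^bsub>obj F x\<^esub> \<in> Ker x" for x using le_edge[of x] by (simp add: Ker_def)
  show "v \<oplus>\<^bsub>obj F x\<^esub> w \<in> Ker x" if "v \<in> Ker x" "w \<in> Ker x" for x v w
    using that le_edge[of x] by (simp add: Ker_def)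
  show "c \<odot>\<^bsub>obj F x\<^esub> v \<in> Ker x" if "c \<in> carrier K" "v \<in> Ker x" for x c v
    using that le_edge[of x] by (simp add: Ker_def)
  show "arr F x y v \<in> Ker y" if xy: "x \<le> y" and v: "v \<in> Ker x" for x y v
  proof -
    have le: "(fst x, Orderings.top) \<le> (fst y, Orderings.top :: 'b)" "(Orderings.top :: 'a, snd x) \<le> (Orderings.top, snd y)"
      using xy by (simp_all add: less_eq_prod_def)
    have "arr F x (fst y, Orderings.top) v = \<zero>\<^bsub>obj F (fst y, Orderings.top)\<^esub>" "arr F x (Orderings.top, snd y) v = \<zero>\<^bsub>obj F (Orderings.top, snd y)\<^esub>"
      using v le le_edge[of x] by (auto simp: Ker_def intro: arr_eq_zero_mono)
    then show ?thesis using v xy le_edge[of y] by (simp add: Ker_def)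
  qed
qed

lemmas Ker_closed = subfunctor_closed[OF subfunctor_Ker]

text \<open>The factors are chains, so each coordinate of \<open>inf x y\<close> is that of
  \<open>x\<close> or of \<open>y\<close>, and the map from \<open>inf x y\<close> to either of its
  far edges factors through \<open>x\<close> or \<open>y\<close>.\<close>

lemma Ker_inf:
  assumes v: "v \<in> carrier (obj F (inf x y))"
    and "arr F (inf x y) x v \<in> Ker x" "arr F (inf x y) y v \<in> Ker y"
  shows "v \<in> Ker (inf x y)"
proof -
  have edge: "arr F (inf x y) (fst z, Orderings.top) v = \<zero>\<^bsub>obj F (fst z, Orderings.top)\<^esub> \<and>
      arr F (inf x y) (Orderings.top, snd z) v = \<zero>\<^bsub>obj F (Orderings.top, snd z)\<^esub>"
    if "z \<in> {x, y}" for z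
    using that assms arr_comp[OF _ le_edge(1) v] arr_comp[OF _ le_edge(2) v] by (auto simp: Ker_def)
  have "fst (inf x y) \<in> {fst x, fst y}" "snd (inf x y) \<in> {snd x, snd y}"
    by (simp_all add: inf_min min_def)
  then show ?thesis using v edge[of x] edge[of y] unfolding Ker_def mem_Collect_eq
    by (metis insert_iff singletonD)
qed

text \<open>Lift along the first coordinate, then along the second. In each rectangle the other
  prescribed corner is zero on a far edge, so the lift vanishes there by construction; the vanishing
  on the other edge is inherited by functoriality.\<close>

lemma Ker_surj:
  assumes "x \<le> y" "v \<in> Ker y"
  obtains u where "u \<in> Ker x" "arr F x y u = v"
proof -
  obtain a b a' b' where xy: "x = (a, b)" "y = (a', b')" by (cases x, cases y)
  have ab: "a \<le> a'" "b \<le> b'" using assms(1) by (auto simp: xy)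
  have v: "v \<in> carrier (obj F (a', b'))" "arr F (a', b') (a', Orderings.top) v = \<zero>\<^bsub>obj F (a', Orderings.top)\<^esub>"
      "arr F (a', b') (Orderings.top, b') v = \<zero>\<^bsub>obj F (Orderings.top, b')\<^esub>"
    using assms(2) by (auto simp: Ker_def xy)
  obtain t where t: "t \<in> carrier (obj F (a, b'))" "arr F (a, b') (a, Orderings.top) t = \<zero>\<^bsub>obj F (a, Orderings.top)\<^esub>"
    "arr F (a, b') (a', b') t = v"
    using middle_exact_rect[of a a' b' Orderings.top "\<zero>\<^bsub>obj F (a, Orderings.top)\<^esub>" v] ab v by auto
  have t3: "arr F (a, b') (Orderings.top, b') t = \<zero>\<^bsub>obj F (Orderings.top, b')\<^esub>"
    using arr_comp[of "(a, b')" "(a', b')" "(Orderings.top, b')" t] t v ab by simp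
  \<comment> \<open>The partner of \<open>t\<close> is pushed out to \<open>Orderings.top\<close>
    and not just to \<open>a'\<close>, since \<open>u\<close> has to vanish on the far edge.\<close>
  obtain u where u: "u \<in> carrier (obj F (a, b))" "arr F (a, b) (a, b') u = t"
    "arr F (a, b) (Orderings.top, b) u = \<zero>\<^bsub>obj F (Orderings.top, b)\<^esub>"
    using middle_exact_rect[of a Orderings.top b b' t "\<zero>\<^bsub>obj F (Orderings.top, b)\<^esub>"] ab t t3 by auto
  have "arr F (a, b) (a, Orderings.top) u = \<zero>\<^bsub>obj F (a, Orderings.top)\<^esub>"
    using arr_comp[of "(a, b)" "(a, b')" "(a, Orderings.top)" u] t u ab by simp
  moreover have "arr F (a, b) (a', b') u = v"
    using arr_comp[of "(a, b)" "(a, b')" "(a', b')" u] t u ab by simp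
  ultimately show ?thesis using that[of u] u by (simp add: Ker_def xy)
qed

text \<open>The lift is taken in \<open>F\<close>, and \<open>Ker_inf\<close> puts it into
  \<open>Ker\<close>.\<close>

lemma Ker_rect:
  assumes "a \<le> a'" "b \<le> b'" "v \<in> Ker (a, b')" "w \<in> Ker (a', b)"
    and "arr F (a, b') (a', b') v = arr F (a', b) (a', b') w"
  obtains u where "u \<in> Ker (a, b)" "arr F (a, b) (a, b') u = v" "arr F (a, b) (a', b) u = w"
proof -
  obtain u where u: "u \<in> carrier (obj F (a, b))" "arr F (a, b) (a, b') u = v" "arr F (a, b) (a', b) u = w"
    using middle_exact_rect[OF assms(1,2) Ker_closed(1)[OF assms(3)] Ker_closed(1)[OF assms(4)] assms(5)] .
  have "inf (a, b') (a', b) = (a, b)" using assms(1,2) by (simp add: inf_absorb1 inf_absorb2)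
  then have "u \<in> Ker (a, b)" using Ker_inf[of u "(a, b')" "(a', b)"] u assms(3,4) by simp
  then show ?thesis using that u by blast
qed

end

section \<open>Extending partial sections of the kernel functor\<close>

context grid_functor begin

text \<open>Points are added in order of increasing first coordinate, so a new point
  \<open>y\<close> lies weakly to the right of all earlier ones. Then it only matters how
  \<open>y\<close> compares with the lowest earlier point \<open>z\<close>: if it is not lower, its
  value is forced by that at \<open>z\<close>; otherwise a rectangle with \<open>y\<close> as a
  corner adjusts the solution without disturbing the old values.\<close>

lemma Ker_glue_finite:
  assumes U: "\<And>y. y \<in> U \<Longrightarrow> x \<le> y" "\<And>y. y \<in> U \<Longrightarrow> k y \<in> Ker y"
      "\<And>y z. y \<in> U \<Longrightarrow> y \<le> z \<Longrightarrow> z \<in> U \<and> k z = arr F y z (k y)"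
    and "finite Y" "Y \<subseteq> U"
  shows "\<exists>s\<in>Ker x. \<forall>y\<in>Y. arr F x y s = k y"
  using assms(4,5)
proof (induction Y rule: finite_ranking_induct[where f = fst])
  case empty
  then show ?case using Ker_closed(3) by blast
next
  case (insert y Y)
  then have yU: "y \<in> U" and YU: "Y \<subseteq> U" by auto
  obtain a b where y: "y = (a, b)" by (cases y)
  obtain x1 x2 where x: "x = (x1, x2)" by (cases x)
  obtain s where s: "s \<in> Ker x" "\<And>z. z \<in> Y \<Longrightarrow> arr F x z s = k z"
    using insert.IH[OF YU] by blast
  show ?case
  proof (cases "Y = {}")
    case True
    obtain u where "u \<in> Ker x" "arr F x y u = k y" using Ker_surj[OF U(1,2)[OF yU]] .
    then show ?thesis using True by blast
  next
    case False
    obtain z where z: "z \<in> Y" "\<And>w. w \<in> Y \<Longrightarrow> snd z \<le> snd w"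
      using ex_min_if_finite[of "snd ` Y"] insert.hyps(1) False by (auto simp: not_less)
    obtain a' b' where z': "z = (a', b')" by (cases z)
    have zU: "z \<in> U" using z(1) YU by blast
    have a'a: "a' \<le> a" using insert.hyps(2)[OF z(1)] by (simp add: y z')
    have le: "x1 \<le> a" "x2 \<le> b" "x1 \<le> a'" "x2 \<le> b'" using U(1)[OF yU] U(1)[OF zU] by (auto simp: x y z')
    have sc: "s \<in> carrier (obj F x)" using Ker_closed(1)[OF s(1)] .
    show ?thesis
    proof (cases "b' \<le> b")
      case True
      then have "z \<le> y" using a'a by (simp add: y z')
      then have "k y = arr F z y (arr F x z s)" using U(3)[OF zU \<open>z \<le> y\<close>] s(2)[OF z(1)] by metis
      then have "arr F x y s = k y" using \<open>z \<le> y\<close> U(1)[OF zU] sc by simp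
      then show ?thesis using s by blast
    next
      case False
      \<comment> \<open>Every point of \<open>Y\<close> lies above \<open>m\<close>, since
        \<open>z\<close> has the least second coordinate; so a new solution that agrees with
        \<open>s\<close> at \<open>m\<close> agrees with it on \<open>Y\<close>.\<close>
      define m where "m = (x1, b')"
      define n where "n = (x1, b)"
      have bb: "b \<le> b'" using False by simp
      have xm: "x \<le> m" "n \<le> m" "x \<le> n" "n \<le> y" using le bb by (auto simp: x y m_def n_def)
      \<comment> \<open>Both sides equal \<open>k (a, b')\<close>: this corner lies above
        \<open>z\<close> because \<open>a' \<le> a\<close>, and above \<open>y\<close> because
        \<open>b \<le> b'\<close>.\<close>
      have eq: "arr F m (a, b') (arr F x m s) = arr F y (a, b') (k y)"
      proof -
        have za: "z \<le> (a, b')" "m \<le> (a, b')" "y \<le> (a, b')" using a'a le bb by (auto simp: z' m_def y)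
        have "arr F m (a, b') (arr F x m s) = arr F x (a, b') s" using arr_comp[OF xm(1) za(2) sc] .
        also have "\<dots> = arr F z (a, b') (arr F x z s)" using arr_comp[OF U(1)[OF zU] za(1) sc] by simp
        also have "\<dots> = k (a, b')" using U(3)[OF zU za(1)] s(2)[OF z(1)] by metis
        also have "\<dots> = arr F y (a, b') (k y)" using U(3)[OF yU za(3)] by blast
        finally show ?thesis .
      qed
      have "arr F x m s \<in> Ker m" using Ker_closed(7)[OF xm(1) s(1)] .
      then obtain u where u: "u \<in> Ker n" "arr F n m u = arr F x m s" "arr F n y u = k y"
        using Ker_rect[OF le(1) bb, of "arr F x m s" "k y"] U(2)[OF yU] eq unfolding m_def n_def y by blast
      \<comment> \<open>The glued vector lives at \<open>n\<close>; surjectivity of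
        \<open>Ker\<close> brings it down to \<open>x\<close>.\<close>
      obtain u' where u': "u' \<in> Ker x" "arr F x n u' = u" using Ker_surj[OF xm(3) u(1)] .
      have u'c: "u' \<in> carrier (obj F x)" using Ker_closed(1)[OF u'(1)] .
      have "arr F x y u' = k y" using arr_comp[OF xm(3,4) u'c] u u' by simp
      moreover have "arr F x w u' = k w" if w: "w \<in> Y" for w
      proof -
        have "m \<le> w" using z(2)[OF w] U(1)[of w] w YU by (auto simp: less_eq_prod_def m_def x z')
        have "arr F x w u' = arr F m w (arr F x m u')" using arr_comp[OF xm(1) \<open>m \<le> w\<close> u'c] by simp
        also have "arr F x m u' = arr F x m s" using arr_comp[OF xm(3,2) u'c] u u' by simp
        also have "arr F m w (arr F x m s) = arr F x w s" using arr_comp[OF xm(1) \<open>m \<le> w\<close> sc] .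
        finally show ?thesis using s(2)[OF w] by simp
      qed
      ultimately show ?thesis using u'(1) by blast
    qed
  qed
qed

text \<open>
  Finite-dimensionality supplies the compactness: the vectors vanishing on a finite set \<open>Y\<close> form a
  subspace, and a minimal one among these already determines the solution on all of \<open>U\<close>.
\<close>

lemma Ker_extension:
  assumes U: "\<And>y. y \<in> U \<Longrightarrow> x \<le> y" "\<And>y. y \<in> U \<Longrightarrow> k y \<in> Ker y"
      "\<And>y z. y \<in> U \<Longrightarrow> y \<le> z \<Longrightarrow> z \<in> U \<and> k z = arr F y z (k y)"
  shows "\<exists>s\<in>Ker x. \<forall>y\<in>U. arr F x y s = k y"
proof -
  define T where "T Y = {s \<in> Ker x. \<forall>y\<in>Y. arr F x y s = \<zero>\<^bsub>obj F y\<^esub>}" for Y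
  have sub: "submodule K (T Y) (obj F x)" if "Y \<subseteq> U" for Y
  proof (intro submodule.intro V.module_axioms)
    have xy: "x \<le> y" if "y \<in> Y" for y using that \<open>Y \<subseteq> U\<close> U(1) by blast
    show "T Y \<subseteq> carrier (obj F x)" unfolding T_def using Ker_closed(1) by blast
    show "\<zero>\<^bsub>obj F x\<^esub> \<in> T Y" using Ker_closed(3) xy by (simp add: T_def)
    show "v \<oplus>\<^bsub>obj F x\<^esub> w \<in> T Y" if "v \<in> T Y" "w \<in> T Y" for v w
      using that Ker_closed(1,2) xy by (simp add: T_def)
    show "c \<odot>\<^bsub>obj F x\<^esub> v \<in> T Y" if "c \<in> carrier K" "v \<in> T Y" for c v
      using that Ker_closed(1,4) xy by (simp add: T_def)
  qed
  have fd: "V.fin_dim x" using fin_dim unfolding pointwise_fin_dim_def by blast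
  obtain T0 where T0: "T0 \<in> T ` {Y. finite Y \<and> Y \<subseteq> U}"
    and min: "\<And>T'. T' \<in> T ` {Y. finite Y \<and> Y \<subseteq> U} \<Longrightarrow> T' \<subseteq> T0 \<Longrightarrow> T' = T0"
  proof (rule V.minimal_subspace_exists[OF fd])
    show "T ` {Y. finite Y \<and> Y \<subseteq> U} \<noteq> {}" by blast
    show "submodule K T' (obj F x)" if "T' \<in> T ` {Y. finite Y \<and> Y \<subseteq> U}" for T'
      using that sub by blast
  qed blast
  then obtain Y where Y: "finite Y" "Y \<subseteq> U" "T0 = T Y" by blast
  obtain s where s: "s \<in> Ker x" "\<And>y. y \<in> Y \<Longrightarrow> arr F x y s = k y"
    using Ker_glue_finite[OF U Y(1,2)] by blast
  have "arr F x y s = k y" if y: "y \<in> U" for y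
  proof -
    have yY: "finite (insert y Y)" "insert y Y \<subseteq> U" using Y y by auto
    obtain s' where s': "s' \<in> Ker x" "\<And>z. z \<in> insert y Y \<Longrightarrow> arr F x z s' = k z"
      using Ker_glue_finite[OF U yY] by blast
    have c: "s \<in> carrier (obj F x)" "s' \<in> carrier (obj F x)" using Ker_closed(1) s(1) s'(1) by blast+
    have xz: "x \<le> z" if "z \<in> Y" for z using that Y U(1) by blast
    have kc: "k z \<in> carrier (obj F z)" if "z \<in> Y" for z using that Y U(2) Ker_closed(1) by blast
    have "s' \<ominus>\<^bsub>obj F x\<^esub> s \<in> T Y"
      using Ker_closed(6)[OF s'(1) s(1)] c s(2) s'(2) xz kc
      by (simp add: T_def V.M.minus_eq_zero_iff)
    \<comment> \<open>Solutions on \<open>Y\<close> and on \<open>insert y Y\<close> differ by an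
      element of \<open>T Y\<close>; by minimality this difference vanishes at \<open>y\<close> too,
      so \<open>s\<close> has the right value there.\<close>
    moreover have "T (insert y Y) = T Y"
      unfolding Y(3)[symmetric]
    proof (rule min)
      show "T (insert y Y) \<in> T ` {Y. finite Y \<and> Y \<subseteq> U}" using yY by blast
      show "T (insert y Y) \<subseteq> T0" unfolding Y(3) T_def by blast
    qed
    ultimately have "arr F x y (s' \<ominus>\<^bsub>obj F x\<^esub> s) = \<zero>\<^bsub>obj F y\<^esub>" by (auto simp: T_def)
    then have "arr F x y s' \<ominus>\<^bsub>obj F y\<^esub> arr F x y s = \<zero>\<^bsub>obj F y\<^esub>" using c U(1)[OF y] by simp
    then have "arr F x y s' = arr F x y s"
      using c U(1)[OF y] by (simp add: V.M.minus_eq_zero_iff)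
    then show ?thesis using s'(2)[of y] by simp
  qed
  then show ?thesis using s(1) by blast
qed

lemma Ker_complement: "\<exists>G. complement G Ker"
  using subfunctor_Ker Ker_extension by (rule complement_exists) 

end

section \<open>Degree 1 and codegree 1 functors\<close>

lemma commutative_square_vfunctor:
  fixes F :: "('p::distrib_lattice, 'k, 'v) vfunctor"
  assumes "is_vfunctor K F"
  shows "commutative_square K (obj F (inf x y)) (obj F x) (obj F y) (obj F (sup x y))
    (arr F (inf x y) x) (arr F (inf x y) y) (arr F x (sup x y)) (arr F y (sup x y))"
proof -
  interpret vect_functor K F by unfold_locales fact
  show ?thesis
    unfolding commutative_square_def
    by (intro conjI arr_linear ballI) (simp_all add: arr_comp)
qed

text \<open>Surjectivity onto the fibre product is middle exactness, and injectivity can be tested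
  at zero.\<close>

lemma degree1_iff:
  fixes F :: "('p::distrib_lattice, 'k, 'v) vfunctor"
  assumes "is_vfunctor K F"
  shows "degree1 K F \<longleftrightarrow> middle_exact F \<and>
    (\<forall>x y. \<forall>u\<in>carrier (obj F (inf x y)). arr F (inf x y) x u = \<zero>\<^bsub>obj F x\<^esub> \<longrightarrow>
      arr F (inf x y) y u = \<zero>\<^bsub>obj F y\<^esub> \<longrightarrow> u = \<zero>\<^bsub>obj F (inf x y)\<^esub>)" (is "_ \<longleftrightarrow> _ \<and> ?inj")
proof -
  interpret vect_functor K F by unfold_locales fact
  let ?c = "\<lambda>x y a. (arr F (inf x y) x a, arr F (inf x y) y a)"
  let ?P = "\<lambda>x y. fibre_product (obj F x) (obj F y) (arr F x (sup x y)) (arr F y (sup x y))"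
  have into: "?c x y ` carrier (obj F (inf x y)) \<subseteq> ?P x y" for x y
    by (simp add: fibre_product_def image_subset_iff)
  have onto: "?P x y \<subseteq> ?c x y ` carrier (obj F (inf x y)) \<longleftrightarrow>
    (\<forall>v\<in>carrier (obj F x). \<forall>w\<in>carrier (obj F y).
    arr F x (sup x y) v = arr F y (sup x y) w \<longrightarrow>
    (\<exists>u\<in>carrier (obj F (inf x y)). arr F (inf x y) x u = v \<and> arr F (inf x y) y u = w))" for x y
    unfolding fibre_product_def by blast
  have inj: "inj_on (?c x y) (carrier (obj F (inf x y))) \<longleftrightarrow>
    (\<forall>u\<in>carrier (obj F (inf x y)). arr F (inf x y) x u = \<zero>\<^bsub>obj F x\<^esub> \<longrightarrow>
      arr F (inf x y) y u = \<zero>\<^bsub>obj F y\<^esub> \<longrightarrow> u = \<zero>\<^bsub>obj F (inf x y)\<^esub>)" for x y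
  proof (intro iffI ballI impI)
    fix u assume "inj_on (?c x y) (carrier (obj F (inf x y)))" "u \<in> carrier (obj F (inf x y))"
      "arr F (inf x y) x u = \<zero>\<^bsub>obj F x\<^esub>" "arr F (inf x y) y u = \<zero>\<^bsub>obj F y\<^esub>"
    then show "u = \<zero>\<^bsub>obj F (inf x y)\<^esub>"
      by (elim inj_onD) simp_all
  next
    assume ker: "\<forall>u\<in>carrier (obj F (inf x y)). arr F (inf x y) x u = \<zero>\<^bsub>obj F x\<^esub> \<longrightarrow>
      arr F (inf x y) y u = \<zero>\<^bsub>obj F y\<^esub> \<longrightarrow> u = \<zero>\<^bsub>obj F (inf x y)\<^esub>"
    show "inj_on (?c x y) (carrier (obj F (inf x y)))"
    proof (rule inj_onI)
      fix u w assume uw: "u \<in> carrier (obj F (inf x y))" "w \<in> carrier (obj F (inf x y))" "?c x y u = ?c x y w"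
      have "u \<ominus>\<^bsub>obj F (inf x y)\<^esub> w = \<zero>\<^bsub>obj F (inf x y)\<^esub>"
        using uw by (intro ker[rule_format]) (simp_all add: V.M.minus_eq_zero_iff)
      then show "u = w" using uw by (simp add: V.M.minus_eq_zero_iff)
    qed
  qed
  have "pullback_square K (obj F (inf x y)) (obj F x) (obj F y) (obj F (sup x y))
      (arr F (inf x y) x) (arr F (inf x y) y) (arr F x (sup x y)) (arr F y (sup x y)) \<longleftrightarrow>
      inj_on (?c x y) (carrier (obj F (inf x y))) \<and> ?P x y \<subseteq> ?c x y ` carrier (obj F (inf x y))" for x y
    using commutative_square_vfunctor[OF assms, of x y] into[of x y]
    unfolding pullback_square_def bij_betw_def by blast
  then show ?thesis
    unfolding degree1_def inj onto middle_exact_iff[OF assms] by blast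
qed

text \<open>Injectivity of the map from the amalgamated sum is middle exactness, once the sign of
  the second component is absorbed.\<close>

lemma codegree1_iff:
  fixes F :: "('p::distrib_lattice, 'k, 'v) vfunctor"
  assumes "is_vfunctor K F"
  shows "codegree1 K F \<longleftrightarrow> middle_exact F \<and>
    (\<forall>x y. \<forall>d\<in>carrier (obj F (sup x y)). \<exists>v\<in>carrier (obj F x). \<exists>w\<in>carrier (obj F y).
      d = arr F x (sup x y) v \<oplus>\<^bsub>obj F (sup x y)\<^esub> arr F y (sup x y) w)" (is "_ \<longleftrightarrow> _ \<and> ?surj")
proof -
  interpret vect_functor K F by unfold_locales fact
  have "(\<forall>b\<in>carrier (obj F x). \<forall>c\<in>carrier (obj F y).
      arr F x (sup x y) b \<oplus>\<^bsub>obj F (sup x y)\<^esub> arr F y (sup x y) c = \<zero>\<^bsub>obj F (sup x y)\<^esub> \<longrightarrow>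
      (\<exists>a\<in>carrier (obj F (inf x y)). b = arr F (inf x y) x a \<and> c = \<ominus>\<^bsub>obj F y\<^esub> arr F (inf x y) y a)) \<longleftrightarrow>
    (\<forall>v\<in>carrier (obj F x). \<forall>w\<in>carrier (obj F y).
      arr F x (sup x y) v = arr F y (sup x y) w \<longrightarrow>
      (\<exists>u\<in>carrier (obj F (inf x y)). arr F (inf x y) x u = v \<and> arr F (inf x y) y u = w))"
    (is "?L = ?R") for x y
  proof (intro iffI ballI impI)
    fix v w assume L: ?L and vw: "v \<in> carrier (obj F x)" "w \<in> carrier (obj F y)"
      "arr F x (sup x y) v = arr F y (sup x y) w"
    have "\<exists>a\<in>carrier (obj F (inf x y)). v = arr F (inf x y) x a \<and>
        \<ominus>\<^bsub>obj F y\<^esub> w = \<ominus>\<^bsub>obj F y\<^esub> arr F (inf x y) y a"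
      using vw by (intro L[rule_format]) (simp_all add: V.M.r_neg)
    then obtain a where a: "a \<in> carrier (obj F (inf x y))" "v = arr F (inf x y) x a"
        "\<ominus>\<^bsub>obj F y\<^esub> w = \<ominus>\<^bsub>obj F y\<^esub> arr F (inf x y) y a" by blast
    have "w = arr F (inf x y) y a"
      using V.M.minus_minus[OF vw(2)] V.M.minus_minus[OF arr_closed[OF inf_le2 a(1)]]
      unfolding a(3) by (rule trans[OF sym])
    then show "\<exists>u\<in>carrier (obj F (inf x y)). arr F (inf x y) x u = v \<and> arr F (inf x y) y u = w"
      using a by blast
  next
    fix v w assume R: ?R and vw: "v \<in> carrier (obj F x)" "w \<in> carrier (obj F y)"
      "arr F x (sup x y) v \<oplus>\<^bsub>obj F (sup x y)\<^esub> arr F y (sup x y) w = \<zero>\<^bsub>obj F (sup x y)\<^esub>"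
    have "\<exists>u\<in>carrier (obj F (inf x y)). arr F (inf x y) x u = v \<and> arr F (inf x y) y u = \<ominus>\<^bsub>obj F y\<^esub> w"
      using vw(1,2) V.M.minus_equality[OF vw(3) arr_closed[OF sup_ge2 vw(2)] arr_closed[OF sup_ge1 vw(1)]]
      by (intro R[rule_format]) simp_all
    then show "\<exists>a\<in>carrier (obj F (inf x y)). v = arr F (inf x y) x a \<and> w = \<ominus>\<^bsub>obj F y\<^esub> arr F (inf x y) y a"
      using V.M.minus_minus[OF vw(2)] by metis
  qed
  then show ?thesis
    unfolding codegree1_def pushout_square_iff[OF commutative_square_vfunctor[OF assms]]
      middle_exact_iff[OF assms] by blast
qed

lemma is_vfunctor_direct_sum:
  assumes "is_vfunctor K G" "is_vfunctor K H"
  shows "is_vfunctor K (direct_sum_vfunctor G H)"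
proof -
  interpret G: vect_functor K G by unfold_locales fact
  interpret H: vect_functor K H by unfold_locales fact
  have vs: "vectorspace K (direct_sum (obj G x) (obj H x))" for x
    using G.V.vectorspace_axioms H.V.vectorspace_axioms by (rule direct_sum_is_vs)
  have "map_prod (arr G x y) (arr H x y) \<in>
      module_hom K (direct_sum (obj G x) (obj H x)) (direct_sum (obj G y) (obj H y))" if "x \<le> y" for x y
    using that by (simp add: module_hom_def direct_sum_def Pi_iff mem_Times_iff split_beta)
  then show ?thesis
    unfolding is_vfunctor_def linear_map_iff
    using vs by (simp add: direct_sum_vfunctor_def) (simp add: direct_sum_def mem_Times_iff split_paired_all)
qed

lemma middle_exact_direct_sum:
  fixes G :: "('p::distrib_lattice, 'k, 'v) vfunctor" and H :: "('p, 'k, 'w) vfunctor"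
  assumes "is_vfunctor K G" "is_vfunctor K H" "middle_exact G" "middle_exact H"
  shows "middle_exact (direct_sum_vfunctor G H)"
  unfolding middle_exact_iff[OF is_vfunctor_direct_sum[OF assms(1,2)]]
proof (intro allI ballI impI)
  note G = assms(3)[unfolded middle_exact_iff[OF assms(1)], rule_format]
  note H = assms(4)[unfolded middle_exact_iff[OF assms(2)], rule_format]
  fix x y v w
  assume v: "v \<in> carrier (obj (direct_sum_vfunctor G H) x)"
    and w: "w \<in> carrier (obj (direct_sum_vfunctor G H) y)"
    and eq: "arr (direct_sum_vfunctor G H) x (sup x y) v = arr (direct_sum_vfunctor G H) y (sup x y) w"
  obtain v1 v2 w1 w2 where vw: "v = (v1, v2)" "w = (w1, w2)" by (cases v, cases w)
  have car: "v1 \<in> carrier (obj G x)" "v2 \<in> carrier (obj H x)" "w1 \<in> carrier (obj G y)" "w2 \<in> carrier (obj H y)"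
    using v w by (simp_all add: direct_sum_vfunctor_def direct_sum_def vw)
  have eqs: "arr G x (sup x y) v1 = arr G y (sup x y) w1" "arr H x (sup x y) v2 = arr H y (sup x y) w2"
    using eq by (simp_all add: direct_sum_vfunctor_def vw)
  obtain u1 where "u1 \<in> carrier (obj G (inf x y))" "arr G (inf x y) x u1 = v1" "arr G (inf x y) y u1 = w1"
    using G[OF car(1,3) eqs(1)] by blast
  moreover obtain u2 where "u2 \<in> carrier (obj H (inf x y))" "arr H (inf x y) x u2 = v2" "arr H (inf x y) y u2 = w2"
    using H[OF car(2,4) eqs(2)] by blast
  ultimately show "\<exists>u\<in>carrier (obj (direct_sum_vfunctor G H) (inf x y)).
      arr (direct_sum_vfunctor G H) (inf x y) x u = v \<and> arr (direct_sum_vfunctor G H) (inf x y) y u = w"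
    by (intro bexI[of _ "(u1, u2)"]) (simp_all add: direct_sum_vfunctor_def direct_sum_def vw)
qed

lemma middle_exact_iso:
  fixes F :: "('p::distrib_lattice, 'k, 'v) vfunctor" and G :: "('p, 'k, 'w) vfunctor"
  assumes "is_vfunctor K F" "is_vfunctor K G" "vfunctor_iso K F G" "middle_exact G"
  shows "middle_exact F"
  unfolding middle_exact_iff[OF assms(1)]
proof (intro allI ballI impI)
  interpret F: vect_functor K F by unfold_locales fact
  note G = assms(4)[unfolded middle_exact_iff[OF assms(2)], rule_format]
  obtain \<eta> where bij: "\<And>x. bij_betw (\<eta> x) (carrier (obj F x)) (carrier (obj G x))"
    and nat: "\<And>x y v. x \<le> y \<Longrightarrow> v \<in> carrier (obj F x) \<Longrightarrow> \<eta> y (arr F x y v) = arr G x y (\<eta> x v)"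
    using assms(3) unfolding vfunctor_iso_def by blast
  have cl: "\<eta> x v \<in> carrier (obj G x)" if "v \<in> carrier (obj F x)" for x v
    using bij[of x] that by (rule bij_betwE[rule_format])
  have inj: "v = w" if "\<eta> x v = \<eta> x w" "v \<in> carrier (obj F x)" "w \<in> carrier (obj F x)" for x v w
    using bij_betw_imp_inj_on[OF bij] that by (rule inj_onD)
  fix x y v w
  assume vw: "v \<in> carrier (obj F x)" "w \<in> carrier (obj F y)" "arr F x (sup x y) v = arr F y (sup x y) w"
  have "arr G x (sup x y) (\<eta> x v) = arr G y (sup x y) (\<eta> y w)"
    using nat[OF sup_ge1 vw(1)] nat[OF sup_ge2 vw(2)] vw(3) by metis
  then obtain u where u: "u \<in> carrier (obj G (inf x y))" "arr G (inf x y) x u = \<eta> x v" "arr G (inf x y) y u = \<eta> y w"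
    using G[OF cl[OF vw(1)] cl[OF vw(2)]] by blast
  have "u \<in> \<eta> (inf x y) ` carrier (obj F (inf x y))"
    using u(1) unfolding bij_betw_imp_surj_on[OF bij] .
  then obtain t where t: "t \<in> carrier (obj F (inf x y))" "\<eta> (inf x y) t = u" by blast
  have "arr F (inf x y) x t = v"
    using nat[OF inf_le1 t(1)] F.arr_closed[OF inf_le1 t(1)] vw(1) unfolding t(2) u(2) by (rule inj)
  moreover have "arr F (inf x y) y t = w"
    using nat[OF inf_le2 t(1)] F.arr_closed[OF inf_le2 t(1)] vw(2) unfolding t(2) u(3) by (rule inj)
  ultimately show "\<exists>u\<in>carrier (obj F (inf x y)). arr F (inf x y) x u = v \<and> arr F (inf x y) y u = w"
    using t(1) by blast
qed

text \<open>Both degree conditions contain middle exactness, which passes to direct sums and along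
  isomorphisms.\<close>

lemma middle_exact_if_degree1_codegree1:
  fixes F :: "('p::distrib_lattice, 'k, 'v) vfunctor"
    and G :: "('p, 'k, 'g) vfunctor" and H :: "('p, 'k, 'h) vfunctor"
  assumes "is_vfunctor K F" "is_vfunctor K G" "degree1 K G" "is_vfunctor K H" "codegree1 K H"
    and "vfunctor_iso K F (direct_sum_vfunctor G H)"
  shows "middle_exact F"
proof (rule middle_exact_iso[OF assms(1) is_vfunctor_direct_sum[OF assms(2,4)] assms(6)])
  have "middle_exact G" using assms(3) unfolding degree1_iff[OF assms(2)] ..
  moreover have "middle_exact H" using assms(5) unfolding codegree1_iff[OF assms(4)] ..
  ultimately show "middle_exact (direct_sum_vfunctor G H)"
    by (rule middle_exact_direct_sum[OF assms(2,4)])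
qed

section \<open>Direct sum decompositions from complements\<close>

context vect_functor begin

lemma complementD:
  assumes "complement G S"
  shows "subfunctor G" "subfunctor S" "G x \<inter> S x = {\<zero>\<^bsub>obj F x\<^esub>}"
    "submodule K (G x) (obj F x)" "submodule K (S x) (obj F x)"
    "v \<in> carrier (obj F x) \<Longrightarrow> \<exists>g\<in>G x. \<exists>s\<in>S x. v = g \<oplus>\<^bsub>obj F x\<^esub> s"
  using assms unfolding complement_def subfunctor_def by simp_all

lemma complement_projections:
  assumes "complement G S"
  shows "\<exists>p q. (\<forall>x. \<forall>v\<in>carrier (obj F x). p x v \<in> G x) \<and> (\<forall>x. \<forall>v\<in>carrier (obj F x). q x v \<in> S x) \<and>
    (\<forall>x. \<forall>v\<in>carrier (obj F x). v = p x v \<oplus>\<^bsub>obj F x\<^esub> q x v) \<and>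
    (\<forall>x. \<forall>g\<in>G x. \<forall>s\<in>S x. p x (g \<oplus>\<^bsub>obj F x\<^esub> s) = g \<and> q x (g \<oplus>\<^bsub>obj F x\<^esub> s) = s)"
proof -
  note sub = complementD(4,5)[OF assms] and zero = complementD(3)[OF assms]
  have "\<forall>x v. \<exists>g s. v \<in> carrier (obj F x) \<longrightarrow> g \<in> G x \<and> s \<in> S x \<and> v = g \<oplus>\<^bsub>obj F x\<^esub> s"
    using complementD(6)[OF assms] by meson
  then obtain p q where pq: "\<And>x v. v \<in> carrier (obj F x) \<Longrightarrow>
      p x v \<in> G x \<and> q x v \<in> S x \<and> v = p x v \<oplus>\<^bsub>obj F x\<^esub> q x v"
    unfolding choice_iff by auto
  have "p x (g \<oplus>\<^bsub>obj F x\<^esub> s) = g \<and> q x (g \<oplus>\<^bsub>obj F x\<^esub> s) = s" if gs: "g \<in> G x" "s \<in> S x" for x g s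
  proof -
    have "g \<oplus>\<^bsub>obj F x\<^esub> s \<in> carrier (obj F x)"
      using submodule_closed(1)[OF sub(1) gs(1)] submodule_closed(1)[OF sub(2) gs(2)] by simp
    then show ?thesis
      using pq submodule_sum_unique[OF sub zero _ gs(1) _ gs(2)] by metis
  qed
  then show ?thesis using pq by (intro exI[of _ p] exI[of _ q]) simp
qed

text \<open>The structure maps preserve both summands, so uniqueness of the splitting makes the two
  projections linear and natural.\<close>

lemma direct_sum_iso_complement:
  assumes "complement G S"
  shows "vfunctor_iso K F (direct_sum_vfunctor (restrict_vfunctor G) (restrict_vfunctor S))"
proof -
  note GS = complementD(1,2)[OF assms]
  note Gc = subfunctor_closed[OF GS(1)] and Sc = subfunctor_closed[OF GS(2)]
  have ds: "is_vfunctor K (direct_sum_vfunctor (restrict_vfunctor G) (restrict_vfunctor S))"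
    using GS by (intro is_vfunctor_direct_sum is_vfunctor_restrict)
  obtain p q where pq: "\<And>x v. v \<in> carrier (obj F x) \<Longrightarrow> p x v \<in> G x"
    "\<And>x v. v \<in> carrier (obj F x) \<Longrightarrow> q x v \<in> S x"
    "\<And>x v. v \<in> carrier (obj F x) \<Longrightarrow> v = p x v \<oplus>\<^bsub>obj F x\<^esub> q x v"
    "\<And>x v g s. g \<in> G x \<Longrightarrow> s \<in> S x \<Longrightarrow> v = g \<oplus>\<^bsub>obj F x\<^esub> s \<Longrightarrow> p x v = g \<and> q x v = s"
    using complement_projections[OF assms] by metis
  define \<eta> where "\<eta> x v = (p x v, q x v)" for x v
  have obj: "obj (direct_sum_vfunctor (restrict_vfunctor G) (restrict_vfunctor S)) x =
      direct_sum ((obj F x)\<lparr>carrier := G x\<rparr>) ((obj F x)\<lparr>carrier := S x\<rparr>)" for x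
    by (simp add: direct_sum_vfunctor_def restrict_vfunctor_def)
  have car: "p x v \<in> carrier (obj F x)" "q x v \<in> carrier (obj F x)" if "v \<in> carrier (obj F x)" for x v
    by (rule Gc(1)[OF pq(1)[OF that]], rule Sc(1)[OF pq(2)[OF that]])
  have add: "p x (v \<oplus>\<^bsub>obj F x\<^esub> w) = p x v \<oplus>\<^bsub>obj F x\<^esub> p x w \<and> q x (v \<oplus>\<^bsub>obj F x\<^esub> w) = q x v \<oplus>\<^bsub>obj F x\<^esub> q x w"
    if vw: "v \<in> carrier (obj F x)" "w \<in> carrier (obj F x)" for x v w
  proof (rule pq(4))
    have "v \<oplus>\<^bsub>obj F x\<^esub> w = (p x v \<oplus>\<^bsub>obj F x\<^esub> q x v) \<oplus>\<^bsub>obj F x\<^esub> (p x w \<oplus>\<^bsub>obj F x\<^esub> q x w)"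
      using pq(3)[OF vw(1)] pq(3)[OF vw(2)] by simp
    then show "v \<oplus>\<^bsub>obj F x\<^esub> w = (p x v \<oplus>\<^bsub>obj F x\<^esub> p x w) \<oplus>\<^bsub>obj F x\<^esub> (q x v \<oplus>\<^bsub>obj F x\<^esub> q x w)"
      using car vw by (simp add: V.M.a_ac)
  qed (intro Gc(2) Sc(2) pq(1,2) vw)+
  have smult: "p x (c \<odot>\<^bsub>obj F x\<^esub> v) = c \<odot>\<^bsub>obj F x\<^esub> p x v \<and> q x (c \<odot>\<^bsub>obj F x\<^esub> v) = c \<odot>\<^bsub>obj F x\<^esub> q x v"
    if v: "v \<in> carrier (obj F x)" "c \<in> carrier K" for x v c
  proof (rule pq(4))
    have "c \<odot>\<^bsub>obj F x\<^esub> v = c \<odot>\<^bsub>obj F x\<^esub> (p x v \<oplus>\<^bsub>obj F x\<^esub> q x v)"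
      using pq(3)[OF v(1)] by simp
    then show "c \<odot>\<^bsub>obj F x\<^esub> v = c \<odot>\<^bsub>obj F x\<^esub> p x v \<oplus>\<^bsub>obj F x\<^esub> c \<odot>\<^bsub>obj F x\<^esub> q x v"
      using car v by (simp add: V.smult_r_distr)
  qed (intro Gc(4) Sc(4) pq(1,2) v)+
  have lin: "linear_map K (obj F x) (obj (direct_sum_vfunctor (restrict_vfunctor G) (restrict_vfunctor S)) x) (\<eta> x)" for x
    unfolding linear_map_iff
  proof (intro conjI V.vectorspace_axioms)
    show "vectorspace K (obj (direct_sum_vfunctor (restrict_vfunctor G) (restrict_vfunctor S)) x)"
      using ds unfolding is_vfunctor_def by simp
    show "\<eta> x \<in> module_hom K (obj F x) (obj (direct_sum_vfunctor (restrict_vfunctor G) (restrict_vfunctor S)) x)"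
      unfolding obj by (simp add: module_hom_def Pi_iff direct_sum_def \<eta>_def pq(1,2) add smult)
  qed
  have bij: "bij_betw (\<eta> x) (carrier (obj F x)) (carrier (obj (direct_sum_vfunctor (restrict_vfunctor G) (restrict_vfunctor S)) x))" for x
  proof (rule bij_betw_byWitness[where f' = "\<lambda>(g, s). g \<oplus>\<^bsub>obj F x\<^esub> s"])
    show "\<forall>a\<in>carrier (obj F x). (case \<eta> x a of (g, s) \<Rightarrow> g \<oplus>\<^bsub>obj F x\<^esub> s) = a"
      using pq(3) by (simp add: \<eta>_def)
    have 4: "\<eta> x (g \<oplus>\<^bsub>obj F x\<^esub> s) = (g, s)" if "g \<in> G x" "s \<in> S x" for g s
      using pq(4)[OF that refl] by (simp add: \<eta>_def)
    show "\<forall>a'\<in>carrier (obj (direct_sum_vfunctor (restrict_vfunctor G) (restrict_vfunctor S)) x).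
        \<eta> x (case a' of (g, s) \<Rightarrow> g \<oplus>\<^bsub>obj F x\<^esub> s) = a'"
      unfolding obj by (simp add: direct_sum_def 4)
    show "\<eta> x ` carrier (obj F x) \<subseteq> carrier (obj (direct_sum_vfunctor (restrict_vfunctor G) (restrict_vfunctor S)) x)"
      unfolding obj by (simp add: direct_sum_def \<eta>_def image_subset_iff pq(1,2))
    show "(\<lambda>(g, s). g \<oplus>\<^bsub>obj F x\<^esub> s) ` carrier (obj (direct_sum_vfunctor (restrict_vfunctor G) (restrict_vfunctor S)) x) \<subseteq> carrier (obj F x)"
      unfolding obj by (simp add: direct_sum_def image_subset_iff Gc(1) Sc(1))
  qed
  have nat: "\<eta> y (arr F x y v) = arr (direct_sum_vfunctor (restrict_vfunctor G) (restrict_vfunctor S)) x y (\<eta> x v)"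
    if "x \<le> y" "v \<in> carrier (obj F x)" for x y v
  proof -
    have "arr F x y v = arr F x y (p x v) \<oplus>\<^bsub>obj F y\<^esub> arr F x y (q x v)"
      using arr_add[OF that(1) car[OF that(2)]] pq(3)[OF that(2)] by simp
    then have "p y (arr F x y v) = arr F x y (p x v) \<and> q y (arr F x y v) = arr F x y (q x v)"
      by (intro pq(4) Gc(7) Sc(7) pq(1,2) that)
    then show ?thesis by (simp add: \<eta>_def direct_sum_vfunctor_def restrict_vfunctor_def)
  qed
  show ?thesis unfolding vfunctor_iso_def using lin bij nat by (intro exI[of _ \<eta>]) simp
qed

end

section \<open>The two summands of a middle-exact functor\<close>

context grid_functor begin

text \<open>A vector of \<open>G\<close> that dies at \<open>x\<close> and \<open>y\<close> lies in
  \<open>Ker\<close> by \<open>Ker_inf\<close>, hence is zero. For middle exactness, lift in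
  \<open>F\<close> and project the lift to \<open>G\<close>: the projection is natural, so the
  values at \<open>x\<close> and \<open>y\<close>, which lie in \<open>G\<close>, do not
  change.\<close>

lemma degree1_complement_Ker:
  assumes "complement G Ker"
  shows "degree1 K (restrict_vfunctor G)"
proof -
  note G = complementD(1)[OF assms]
  note Gc = subfunctor_closed[OF G]
  have inj: "u = \<zero>\<^bsub>obj F (inf x y)\<^esub>" if "u \<in> G (inf x y)" "arr F (inf x y) x u = \<zero>\<^bsub>obj F x\<^esub>"
    "arr F (inf x y) y u = \<zero>\<^bsub>obj F y\<^esub>" for x y u
  proof -
    have "u \<in> Ker (inf x y)" using that Gc(1) Ker_closed(3) by (intro Ker_inf) simp_all
    then show ?thesis using that(1) complementD(3)[OF assms] by (metis IntI singletonD)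
  qed
  obtain p q where pq: "\<And>x v. v \<in> carrier (obj F x) \<Longrightarrow> p x v \<in> G x"
    "\<And>x v. v \<in> carrier (obj F x) \<Longrightarrow> q x v \<in> Ker x"
    "\<And>x v. v \<in> carrier (obj F x) \<Longrightarrow> v = p x v \<oplus>\<^bsub>obj F x\<^esub> q x v"
    "\<And>x v g s. g \<in> G x \<Longrightarrow> s \<in> Ker x \<Longrightarrow> v = g \<oplus>\<^bsub>obj F x\<^esub> s \<Longrightarrow> p x v = g \<and> q x v = s"
    using complement_projections[OF assms] by metis
  have proj: "arr F z x (p z u) = arr F z x u" if "z \<le> x" "u \<in> carrier (obj F z)" "arr F z x u \<in> G x" for x z u
  proof -
    have c: "p z u \<in> carrier (obj F z)" "q z u \<in> carrier (obj F z)"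
      by (rule Gc(1)[OF pq(1)[OF that(2)]], rule Ker_closed(1)[OF pq(2)[OF that(2)]])
    have 1: "arr F z x u = arr F z x (p z u) \<oplus>\<^bsub>obj F x\<^esub> arr F z x (q z u)"
      using arr_add[OF that(1) c] pq(3)[OF that(2)] by simp
    have 2: "arr F z x u = arr F z x u \<oplus>\<^bsub>obj F x\<^esub> \<zero>\<^bsub>obj F x\<^esub>" using that by simp
    show ?thesis
      using pq(4)[OF Gc(7)[OF that(1) pq(1)[OF that(2)]] Ker_closed(7)[OF that(1) pq(2)[OF that(2)]] 1]
        pq(4)[OF that(3) Ker_closed(3) 2] by simp
  qed
  have R: "is_vfunctor K (restrict_vfunctor G)" using G by (rule is_vfunctor_restrict)
  have "\<exists>u\<in>G (inf x y). arr F (inf x y) x u = v \<and> arr F (inf x y) y u = w"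
    if vw: "v \<in> G x" "w \<in> G y" "arr F x (sup x y) v = arr F y (sup x y) w" for x y v w
  proof -
    obtain u where "u \<in> carrier (obj F (inf x y))" "arr F (inf x y) x u = v" "arr F (inf x y) y u = w"
      using middle_exact[unfolded middle_exact_iff[OF is_vfunctor], rule_format, OF Gc(1)[OF vw(1)] Gc(1)[OF vw(2)] vw(3)]
      by blast
    then show ?thesis
      using vw proj[OF inf_le1] proj[OF inf_le2] pq(1) by metis
  qed
  then show ?thesis
    unfolding degree1_iff[OF R] middle_exact_iff[OF R]
    using inj by (simp add: restrict_vfunctor_def)
qed

text \<open>Lifts taken in \<open>F\<close> stay in \<open>Ker\<close> by \<open>Ker_inf\<close>;
  and since the structure maps of \<open>Ker\<close> are surjective, \<open>x\<close> alone
  generates the value at \<open>sup x y\<close>.\<close>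

lemma codegree1_Ker: "codegree1 K (restrict_vfunctor Ker)"
proof -
  have R: "is_vfunctor K (restrict_vfunctor Ker)" using subfunctor_Ker by (rule is_vfunctor_restrict)
  have "\<exists>u\<in>Ker (inf x y). arr F (inf x y) x u = v \<and> arr F (inf x y) y u = w"
    if vw: "v \<in> Ker x" "w \<in> Ker y" "arr F x (sup x y) v = arr F y (sup x y) w" for x y v w
  proof -
    obtain u where "u \<in> carrier (obj F (inf x y))" "arr F (inf x y) x u = v" "arr F (inf x y) y u = w"
      using middle_exact[unfolded middle_exact_iff[OF is_vfunctor], rule_format, OF Ker_closed(1)[OF vw(1)] Ker_closed(1)[OF vw(2)] vw(3)]
      by blast
    then show ?thesis using vw Ker_inf by metis
  qed
  moreover have "\<exists>v\<in>Ker x. \<exists>w\<in>Ker y. d = arr F x (sup x y) v \<oplus>\<^bsub>obj F (sup x y)\<^esub> arr F y (sup x y) w"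
    if d: "d \<in> Ker (sup x y)" for x y d
  proof -
    obtain v where v: "v \<in> Ker x" "arr F x (sup x y) v = d" using Ker_surj[OF sup_ge1 d] .
    then have "d = arr F x (sup x y) v \<oplus>\<^bsub>obj F (sup x y)\<^esub> arr F y (sup x y) \<zero>\<^bsub>obj F y\<^esub>"
      using Ker_closed(1)[OF d] by simp
    then show ?thesis using v(1) Ker_closed(3) by blast
  qed
  ultimately show ?thesis
    unfolding codegree1_iff[OF R] middle_exact_iff[OF R] by (simp add: restrict_vfunctor_def)
qed

lemma degree1_codegree1_decomposition:
  "\<exists>(G :: ('a \<times> 'b, 'k, 'v) vfunctor) (H :: ('a \<times> 'b, 'k, 'v) vfunctor).
    is_vfunctor K G \<and> degree1 K G \<and> is_vfunctor K H \<and> codegree1 K H \<and>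
    vfunctor_iso K F (direct_sum_vfunctor G H)"
proof -
  obtain G where G: "complement G Ker" using Ker_complement ..
  show ?thesis
    using is_vfunctor_restrict[OF complementD(1)[OF G]] is_vfunctor_restrict[OF subfunctor_Ker]
      degree1_complement_Ker[OF G] codegree1_Ker direct_sum_iso_complement[OF G] by metis
qed

end

section \<open>Homotopy cartesian squares\<close>

lemma is_chain_mapD:
  assumes "is_chain_map K C D f"
  shows "is_cplx K C" "is_cplx K D" "linear_map K (grade C n) (grade D n) (f n)"
    "v \<in> carrier (grade C n) \<Longrightarrow> f n v \<in> carrier (grade D n)"
    "v \<in> carrier (grade C n) \<Longrightarrow> f (n - 1) (bdry C n v) = bdry D n (f n v)"
    "v \<in> carrier (grade C (n + 1)) \<Longrightarrow> f n (bdry C (n + 1) v) = bdry D (n + 1) (f (n + 1) v)"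
proof -
  show "is_cplx K C" "is_cplx K D" "linear_map K (grade C n) (grade D n) (f n)"
    "v \<in> carrier (grade C n) \<Longrightarrow> f (n - 1) (bdry C n v) = bdry D n (f n v)"
    using assms by (simp_all add: is_chain_map_def)
  show "v \<in> carrier (grade C n) \<Longrightarrow> f n v \<in> carrier (grade D n)"
    using assms by (auto simp: is_chain_map_def linear_map_iff module_hom_def)
  have "\<forall>n. \<forall>v\<in>carrier (grade C n). f (n - 1) (bdry C n v) = bdry D n (f n v)"
    using assms by (simp add: is_chain_map_def)
  from spec[OF this, of "n + 1"]
  show "v \<in> carrier (grade C (n + 1)) \<Longrightarrow> f n (bdry C (n + 1) v) = bdry D (n + 1) (f (n + 1) v)"
    by simp
qed

lemma is_cplxD:
  assumes "is_cplx K C"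
  shows "linear_map K (grade C n) (grade C (n - 1)) (bdry C n)"
    "linear_map K (grade C (n + 1)) (grade C n) (bdry C (n + 1))"
    "v \<in> carrier (grade C (n + 1)) \<Longrightarrow> bdry C n (bdry C (n + 1) v) = \<zero>\<^bsub>grade C (n - 1)\<^esub>"
proof -
  have lin: "\<forall>n. linear_map K (grade C n) (grade C (n - 1)) (bdry C n)"
    and zero: "\<forall>n. \<forall>v\<in>carrier (grade C n). bdry C (n - 1) (bdry C n v) = \<zero>\<^bsub>grade C (n - 1 - 1)\<^esub>"
    using assms by (simp_all add: is_cplx_def)
  show "linear_map K (grade C n) (grade C (n - 1)) (bdry C n)" using lin by simp
  show "linear_map K (grade C (n + 1)) (grade C n) (bdry C (n + 1))" using spec[OF lin, of "n + 1"] by simp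
  show "v \<in> carrier (grade C (n + 1)) \<Longrightarrow> bdry C n (bdry C (n + 1) v) = \<zero>\<^bsub>grade C (n - 1)\<^esub>"
    using spec[OF zero, of "n + 1"] by simp
qed

lemma homology_coset_eq_iff:
  assumes "is_cplx K C" "z \<in> carrier (grade C n)" "w \<in> carrier (grade C n)"
  shows "boundaries C n +>\<^bsub>grade C n\<^esub> z = boundaries C n +>\<^bsub>grade C n\<^esub> w \<longleftrightarrow>
    (\<exists>v\<in>carrier (grade C (n + 1)). z = bdry C (n + 1) v \<oplus>\<^bsub>grade C n\<^esub> w)"
proof -
  interpret C: vectorspace K "grade C n" using assms(1) by (rule is_cplx_vectorspace)
  interpret d: linear_map K "grade C (n + 1)" "grade C n" "bdry C (n + 1)"
    using assms(1) by (rule is_cplxD)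
  have "z \<ominus>\<^bsub>grade C n\<^esub> w = b \<longleftrightarrow> z = b \<oplus>\<^bsub>grade C n\<^esub> w" if "b \<in> carrier (grade C n)" for b
    using C.M.minus_add_cancel[OF assms(2,3)] C.M.add_minus_cancel[OF that assms(3)] by metis
  then show ?thesis
    unfolding coset_eq_iff[OF submodule_boundaries(3)[OF assms(1)] assms(2,3)]
    unfolding boundaries_def image_iff by (intro bex_cong) simp_all
qed

lemma add_homology:
  assumes "is_cplx K C" "z \<in> cycles C n" "w \<in> cycles C n"
  shows "(boundaries C n +>\<^bsub>grade C n\<^esub> z) \<oplus>\<^bsub>homology C n\<^esub> (boundaries C n +>\<^bsub>grade C n\<^esub> w)
    = boundaries C n +>\<^bsub>grade C n\<^esub> (z \<oplus>\<^bsub>grade C n\<^esub> w)"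
  using add_quotient_space[OF submodule_boundaries(1)[OF assms(1)], of z n w] assms(2,3)
  by (simp add: homology_def a_r_coset_def')

lemma smult_homology:
  assumes "is_cplx K C" "c \<in> carrier K" "z \<in> cycles C n"
  shows "c \<odot>\<^bsub>homology C n\<^esub> (boundaries C n +>\<^bsub>grade C n\<^esub> z)
    = boundaries C n +>\<^bsub>grade C n\<^esub> (c \<odot>\<^bsub>grade C n\<^esub> z)"
  using smult_quotient_space[OF submodule_boundaries(1)[OF assms(1)], of c z n] assms(2,3)
  by (simp add: homology_def a_r_coset_def')

text \<open>A criterion on representatives: by linearity of the induced map, injectivity is tested
  on cycles whose image bounds.\<close>

lemma quasi_isoI:
  assumes f: "is_chain_map K C D f"
    and inj: "\<And>n z v. z \<in> cycles C n \<Longrightarrow> v \<in> carrier (grade D (n + 1)) \<Longrightarrow> f n z = bdry D (n + 1) v \<Longrightarrow>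
      \<exists>u\<in>carrier (grade C (n + 1)). z = bdry C (n + 1) u"
    and surj: "\<And>n w. w \<in> cycles D n \<Longrightarrow>
      \<exists>z\<in>cycles C n. \<exists>v\<in>carrier (grade D (n + 1)). w = bdry D (n + 1) v \<oplus>\<^bsub>grade D n\<^esub> f n z"
  shows "quasi_iso K C D f"
  unfolding quasi_iso_def
proof (intro conjI allI f)
  fix n
  note C = is_chain_mapD(1)[OF f] and D = is_chain_mapD(2)[OF f]
  interpret HC: vectorspace K "homology C n" using C by (rule vectorspace_homology)
  interpret HD: vectorspace K "homology D n" using D by (rule vectorspace_homology)
  interpret H: linear_map K "homology C n" "homology D n" "homology_map D f n"
    using f by (rule linear_map_homology_map)
  interpret D: vectorspace K "grade D n" using D by (rule is_cplx_vectorspace)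
  interpret C: vectorspace K "grade C n" using C by (rule is_cplx_vectorspace)
  interpret dC: linear_map K "grade C (n + 1)" "grade C n" "bdry C (n + 1)" using C by (rule is_cplxD)
  interpret dD: linear_map K "grade D (n + 1)" "grade D n" "bdry D (n + 1)" using D by (rule is_cplxD)
  have zero: "\<zero>\<^bsub>homology C n\<^esub> = boundaries C n" "\<zero>\<^bsub>homology D n\<^esub> = boundaries D n"
    by (simp_all add: homology_def)
  have bC: "boundaries C n = boundaries C n +>\<^bsub>grade C n\<^esub> \<zero>\<^bsub>grade C n\<^esub>"
    using submodule_boundaries(3)[OF C] by (rule coset_zero)
  have bD: "boundaries D n = boundaries D n +>\<^bsub>grade D n\<^esub> \<zero>\<^bsub>grade D n\<^esub>"
    using submodule_boundaries(3)[OF D] by (rule coset_zero)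
  have ker: "X = \<zero>\<^bsub>homology C n\<^esub>"
    if X: "X \<in> carrier (homology C n)" "homology_map D f n X = \<zero>\<^bsub>homology D n\<^esub>" for X
  proof -
    obtain z where z: "z \<in> cycles C n" "X = boundaries C n +>\<^bsub>grade C n\<^esub> z"
      using X(1) by (auto simp: carrier_homology)
    note zc = cycles_closed[OF z(1)]
    have "boundaries D n +>\<^bsub>grade D n\<^esub> f n z = boundaries D n +>\<^bsub>grade D n\<^esub> \<zero>\<^bsub>grade D n\<^esub>"
      using X(2) homology_map_coset[OF f zc] bD unfolding z(2) zero by simp
    then obtain v where v: "v \<in> carrier (grade D (n + 1))" "f n z = bdry D (n + 1) v \<oplus>\<^bsub>grade D n\<^esub> \<zero>\<^bsub>grade D n\<^esub>"
      using homology_coset_eq_iff[OF D is_chain_mapD(4)[OF f zc] D.M.zero_closed] by blast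
    then have "f n z = bdry D (n + 1) v" by simp
    then obtain u where u: "u \<in> carrier (grade C (n + 1))" "z = bdry C (n + 1) u"
      using inj z(1) v(1) by blast
    then have "z = bdry C (n + 1) u \<oplus>\<^bsub>grade C n\<^esub> \<zero>\<^bsub>grade C n\<^esub>" by simp
    then have "X = boundaries C n +>\<^bsub>grade C n\<^esub> \<zero>\<^bsub>grade C n\<^esub>"
      unfolding z(2) using homology_coset_eq_iff[OF C zc C.M.zero_closed] u(1) by blast
    then show ?thesis using bC zero by simp
  qed
  have "inj_on (homology_map D f n) (carrier (homology C n))"
  proof (rule inj_onI)
    fix X Y assume XY: "X \<in> carrier (homology C n)" "Y \<in> carrier (homology C n)"
      "homology_map D f n X = homology_map D f n Y"
    have "homology_map D f n (X \<ominus>\<^bsub>homology C n\<^esub> Y) = \<zero>\<^bsub>homology D n\<^esub>"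
      using XY by (simp add: HD.M.minus_eq_zero_iff)
    then have "X \<ominus>\<^bsub>homology C n\<^esub> Y = \<zero>\<^bsub>homology C n\<^esub>"
      using XY by (intro ker) simp_all
    then show "X = Y" using XY by (simp add: HC.M.minus_eq_zero_iff)
  qed
  moreover have "homology_map D f n ` carrier (homology C n) = carrier (homology D n)"
  proof
    show "homology_map D f n ` carrier (homology C n) \<subseteq> carrier (homology D n)" by auto
    show "carrier (homology D n) \<subseteq> homology_map D f n ` carrier (homology C n)"
    proof
      fix Y assume "Y \<in> carrier (homology D n)"
      then obtain w where w: "w \<in> cycles D n" "Y = boundaries D n +>\<^bsub>grade D n\<^esub> w"
        by (auto simp: carrier_homology)
      obtain z v where z: "z \<in> cycles C n" "v \<in> carrier (grade D (n + 1))"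
        "w = bdry D (n + 1) v \<oplus>\<^bsub>grade D n\<^esub> f n z"
        using surj[OF w(1)] by blast
      note zc = cycles_closed[OF z(1)]
      have "Y = homology_map D f n (boundaries C n +>\<^bsub>grade C n\<^esub> z)"
        unfolding w(2) homology_map_coset[OF f zc]
        using homology_coset_eq_iff[OF D cycles_closed[OF w(1)] is_chain_mapD(4)[OF f zc]] z(2,3) by blast
      then show "Y \<in> homology_map D f n ` carrier (homology C n)"
        using z(1) by (auto simp: carrier_homology)
    qed
  qed
  ultimately show "bij_betw (homology_map D f n) (carrier (homology C n)) (carrier (homology D n))"
    by (simp add: bij_betw_def)
qed

text \<open>The path \<open>d\<close> completes \<open>(b, c)\<close> to a cycle of the homotopy
  limit. The image of \<open>a\<close>, a preimage of its class, differs from this cycle by a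
  boundary, whose first two components are the boundaries relating \<open>f n a\<close> to
  \<open>b\<close> and \<open>g n a\<close> to \<open>c\<close>.\<close>

lemma homotopy_cartesian_lift:
  assumes hc: "homotopy_cartesian K A B C D f g h k"
    and h: "is_chain_map K B D h" and k: "is_chain_map K C D k"
    and b: "b \<in> cycles B n" and c: "c \<in> cycles C n"
    and d: "d \<in> carrier (grade D (n + 1))" "h n b = bdry D (n + 1) d \<oplus>\<^bsub>grade D n\<^esub> k n c"
  shows "\<exists>a\<in>cycles A n. (\<exists>v\<in>carrier (grade B (n + 1)). f n a = bdry B (n + 1) v \<oplus>\<^bsub>grade B n\<^esub> b) \<and>
    (\<exists>w\<in>carrier (grade C (n + 1)). g n a = bdry C (n + 1) w \<oplus>\<^bsub>grade C n\<^esub> c)"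
proof -
  let ?P = "homotopy_pullback B C D h k"
  let ?\<phi> = "\<lambda>n a. (f n a, g n a, \<zero>\<^bsub>grade D (n + 1)\<^esub>)"
  have q: "quasi_iso K A ?P ?\<phi>" using hc by (simp add: homotopy_cartesian_def)
  then have \<phi>: "is_chain_map K A ?P ?\<phi>" by (simp add: quasi_iso_def)
  note P = is_chain_mapD(2)[OF \<phi>]
  interpret D: vectorspace K "grade D n" using is_chain_mapD(2)[OF h] by (rule is_cplx_vectorspace)
  interpret dD: linear_map K "grade D (n + 1)" "grade D n" "bdry D (n + 1)"
    using is_chain_mapD(2)[OF h] by (rule is_cplxD)
  note bc = cycles_closed[OF b] cycles_closed[OF c]
  note hk = is_chain_mapD(4)[OF h bc(1)] is_chain_mapD(4)[OF k bc(2)]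
  have bcd_car: "(b, c, d) \<in> carrier (grade ?P n)"
    using bc d(1) by (simp add: homotopy_pullback_def direct_sum_def)
  have "(h n b \<ominus>\<^bsub>grade D n\<^esub> k n c) \<ominus>\<^bsub>grade D n\<^esub> bdry D (n + 1) d = \<zero>\<^bsub>grade D n\<^esub>"
    using d hk by (simp add: D.M.add_minus_cancel D.M.minus_eq_zero_iff)
  then have "bdry ?P n (b, c, d) = \<zero>\<^bsub>grade ?P (n - 1)\<^esub>"
    using b c by (simp add: homotopy_pullback_def direct_sum_def cycles_def)
  then have bcd: "(b, c, d) \<in> cycles ?P n" using bcd_car by (simp add: cycles_def)
  then have "boundaries ?P n +>\<^bsub>grade ?P n\<^esub> (b, c, d) \<in> carrier (homology ?P n)"
    by (auto simp: carrier_homology)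
  also have "carrier (homology ?P n) = homology_map ?P ?\<phi> n ` carrier (homology A n)"
    using q by (simp add: quasi_iso_def bij_betw_def)
  finally obtain a where a: "a \<in> cycles A n"
    "boundaries ?P n +>\<^bsub>grade ?P n\<^esub> (b, c, d) = homology_map ?P ?\<phi> n (boundaries A n +>\<^bsub>grade A n\<^esub> a)"
    by (auto simp: carrier_homology)
  note ac = cycles_closed[OF a(1)]
  have "boundaries ?P n +>\<^bsub>grade ?P n\<^esub> ?\<phi> n a = boundaries ?P n +>\<^bsub>grade ?P n\<^esub> (b, c, d)"
    unfolding a(2) homology_map_coset[OF \<phi> ac] ..
  then obtain v where v: "v \<in> carrier (grade ?P (n + 1))" "?\<phi> n a = bdry ?P (n + 1) v \<oplus>\<^bsub>grade ?P n\<^esub> (b, c, d)"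
    using homology_coset_eq_iff[OF P is_chain_mapD(4)[OF \<phi> ac] bcd_car] by blast
  obtain b' c' d' where v': "v = (b', c', d')" by (cases v)
  have "b' \<in> carrier (grade B (n + 1))" "c' \<in> carrier (grade C (n + 1))"
    "f n a = bdry B (n + 1) b' \<oplus>\<^bsub>grade B n\<^esub> b" "g n a = bdry C (n + 1) c' \<oplus>\<^bsub>grade C n\<^esub> c"
    using v by (simp_all add: v' homotopy_pullback_def direct_sum_def)
  then show ?thesis using a(1) by blast
qed

text \<open>Equality of two classes at \<open>sup x y\<close> is witnessed by a chain
  \<open>d\<close> bounding the difference of representatives, which is exactly the path that the
  homotopy limit asks for.\<close>

lemma middle_exact_homology:
  fixes \<Phi> :: "('p::distrib_lattice, 'k, 'v) cfunctor"
  assumes "is_cfunctor K \<Phi>" "homotopy_degree1 K \<Phi>"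
  shows "middle_exact (homology_vfunctor n \<Phi>)"
  unfolding middle_exact_iff[OF is_vfunctor_homology_vfunctor[OF assms(1)]]
proof (intro allI ballI impI)
  fix x y :: 'p and X Y
  let ?H = "homology_vfunctor n \<Phi>" and ?i = "inf x y" and ?s = "sup x y"
  have cx: "is_cplx K (cobj \<Phi> x)" for x using assms(1) by (simp add: is_cfunctor_def)
  have cm: "is_chain_map K (cobj \<Phi> x) (cobj \<Phi> y) (carr \<Phi> x y)" if "x \<le> y" for x y
    using assms(1) that by (simp add: is_cfunctor_def)
  note f = cm[OF inf_le1, of x y] and g = cm[OF inf_le2, of x y]
    and h = cm[OF sup_ge1, of x y] and k = cm[OF sup_ge2, of y x]
  assume XY: "X \<in> carrier (obj ?H x)" "Y \<in> carrier (obj ?H y)" and eq: "arr ?H x ?s X = arr ?H y ?s Y"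
  obtain b where b: "b \<in> cycles (cobj \<Phi> x) n" "X = boundaries (cobj \<Phi> x) n +>\<^bsub>grade (cobj \<Phi> x) n\<^esub> b"
    using XY(1) by (auto simp: homology_vfunctor_def carrier_homology)
  obtain c where c: "c \<in> cycles (cobj \<Phi> y) n" "Y = boundaries (cobj \<Phi> y) n +>\<^bsub>grade (cobj \<Phi> y) n\<^esub> c"
    using XY(2) by (auto simp: homology_vfunctor_def carrier_homology)
  note bc = cycles_closed[OF b(1)] cycles_closed[OF c(1)]
  have "boundaries (cobj \<Phi> ?s) n +>\<^bsub>grade (cobj \<Phi> ?s) n\<^esub> carr \<Phi> x ?s n b =
      boundaries (cobj \<Phi> ?s) n +>\<^bsub>grade (cobj \<Phi> ?s) n\<^esub> carr \<Phi> y ?s n c"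
    using eq homology_map_coset[OF h bc(1)] homology_map_coset[OF k bc(2)]
    unfolding b(2) c(2) by (simp add: homology_vfunctor_def)
  then obtain d where d: "d \<in> carrier (grade (cobj \<Phi> ?s) (n + 1))"
      "carr \<Phi> x ?s n b = bdry (cobj \<Phi> ?s) (n + 1) d \<oplus>\<^bsub>grade (cobj \<Phi> ?s) n\<^esub> carr \<Phi> y ?s n c"
    using homology_coset_eq_iff[OF cx is_chain_mapD(4)[OF h bc(1)] is_chain_mapD(4)[OF k bc(2)]] by blast
  have hc: "homotopy_cartesian K (cobj \<Phi> ?i) (cobj \<Phi> x) (cobj \<Phi> y) (cobj \<Phi> ?s)
      (carr \<Phi> ?i x) (carr \<Phi> ?i y) (carr \<Phi> x ?s) (carr \<Phi> y ?s)"
    using assms(2) by (simp add: homotopy_degree1_def)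
  obtain a v w where a: "a \<in> cycles (cobj \<Phi> ?i) n"
    "v \<in> carrier (grade (cobj \<Phi> x) (n + 1))"
    "carr \<Phi> ?i x n a = bdry (cobj \<Phi> x) (n + 1) v \<oplus>\<^bsub>grade (cobj \<Phi> x) n\<^esub> b"
    "w \<in> carrier (grade (cobj \<Phi> y) (n + 1))"
    "carr \<Phi> ?i y n a = bdry (cobj \<Phi> y) (n + 1) w \<oplus>\<^bsub>grade (cobj \<Phi> y) n\<^esub> c"
    using homotopy_cartesian_lift[OF hc h k b(1) c(1) d] by blast
  note ac = cycles_closed[OF a(1)]
  show "\<exists>u\<in>carrier (obj ?H ?i). arr ?H ?i x u = X \<and> arr ?H ?i y u = Y"
  proof (intro bexI conjI)
    let ?u = "boundaries (cobj \<Phi> ?i) n +>\<^bsub>grade (cobj \<Phi> ?i) n\<^esub> a"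
    show "?u \<in> carrier (obj ?H ?i)" using a(1) by (auto simp: homology_vfunctor_def carrier_homology)
    show "arr ?H ?i x ?u = X"
      using homology_map_coset[OF f ac] homology_coset_eq_iff[OF cx is_chain_mapD(4)[OF f ac] bc(1)] a(2,3)
      unfolding b(2) by (auto simp: homology_vfunctor_def)
    show "arr ?H ?i y ?u = Y"
      using homology_map_coset[OF g ac] homology_coset_eq_iff[OF cx is_chain_mapD(4)[OF g ac] bc(2)] a(4,5)
      unfolding c(2) by (auto simp: homology_vfunctor_def)
  qed
qed

text \<open>The hypotheses say that \<open>0 \<rightarrow> A \<rightarrow> B \<oplus> C
  \<rightarrow> D \<rightarrow> 0\<close> is exact in each degree, with the difference of
  \<open>h\<close> and \<open>k\<close> as second map. The homotopy limit is the homotopy fibre of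
  that map, and for a surjection the fibre is the kernel up to quasi-isomorphism.\<close>

lemma homotopy_cartesianI:
  assumes f: "is_chain_map K A B f" and g: "is_chain_map K A C g"
    and h: "is_chain_map K B D h" and k: "is_chain_map K C D k"
    and comm: "\<And>n a. a \<in> carrier (grade A n) \<Longrightarrow> h n (f n a) = k n (g n a)"
    and inj: "\<And>n a. a \<in> carrier (grade A n) \<Longrightarrow> f n a = \<zero>\<^bsub>grade B n\<^esub> \<Longrightarrow> g n a = \<zero>\<^bsub>grade C n\<^esub> \<Longrightarrow>
      a = \<zero>\<^bsub>grade A n\<^esub>"
    and exact: "\<And>n b c. b \<in> carrier (grade B n) \<Longrightarrow> c \<in> carrier (grade C n) \<Longrightarrow> h n b = k n c \<Longrightarrow>
      \<exists>a\<in>carrier (grade A n). f n a = b \<and> g n a = c"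
    and surj: "\<And>n d. d \<in> carrier (grade D n) \<Longrightarrow>
      \<exists>b\<in>carrier (grade B n). \<exists>c\<in>carrier (grade C n). d = h n b \<oplus>\<^bsub>grade D n\<^esub> k n c"
  shows "homotopy_cartesian K A B C D f g h k"
proof -
  note A = is_chain_mapD(1)[OF f] and B = is_chain_mapD(1)[OF h] and C = is_chain_mapD(1)[OF k]
    and D = is_chain_mapD(2)[OF h]
  let ?P = "homotopy_pullback B C D h k"
  let ?\<phi> = "\<lambda>n a. (f n a, g n a, \<zero>\<^bsub>grade D (n + 1)\<^esub>)"
  have vs: "vectorspace K (grade A n)" "vectorspace K (grade B n)" "vectorspace K (grade C n)"
    "vectorspace K (grade D n)" for n
    using A B C D by (simp_all add: is_cplx_vectorspace)
  have surj': "\<exists>b\<in>carrier (grade B n). \<exists>c\<in>carrier (grade C n). d = h n b \<ominus>\<^bsub>grade D n\<^esub> k n c"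
    if d: "d \<in> carrier (grade D n)" for n d
  proof -
    interpret C: vectorspace K "grade C n" by (rule vs)
    interpret k: linear_map K "grade C n" "grade D n" "k n" using k by (rule is_chain_mapD)
    obtain b c where bc: "b \<in> carrier (grade B n)" "c \<in> carrier (grade C n)" "d = h n b \<oplus>\<^bsub>grade D n\<^esub> k n c"
      using surj[OF d] by metis
    then have "d = h n b \<ominus>\<^bsub>grade D n\<^esub> k n (\<ominus>\<^bsub>grade C n\<^esub> c)"
      by (simp add: a_minus_def)
    then show ?thesis using bc C.M.a_inv_closed by metis
  qed
  \<comment> \<open>Common to both halves: write \<open>d\<close> as the image of a pair and
    subtract the boundary of that pair from \<open>(b, c)\<close>; what remains lies in the kernel
    of \<open>B \<oplus> C \<rightarrow> D\<close> and so comes from \<open>A\<close>.\<close>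
  have split: "\<exists>u\<in>carrier (grade A n). \<exists>b'\<in>carrier (grade B (n + 1)). \<exists>c'\<in>carrier (grade C (n + 1)).
      d = h (n + 1) b' \<ominus>\<^bsub>grade D (n + 1)\<^esub> k (n + 1) c' \<and>
      b = bdry B (n + 1) b' \<oplus>\<^bsub>grade B n\<^esub> f n u \<and> c = bdry C (n + 1) c' \<oplus>\<^bsub>grade C n\<^esub> g n u"
    if b: "b \<in> carrier (grade B n)" and c: "c \<in> carrier (grade C n)" and d: "d \<in> carrier (grade D (n + 1))"
      and eq: "h n b \<ominus>\<^bsub>grade D n\<^esub> k n c = bdry D (n + 1) d" for n b c d
  proof -
    interpret B: vectorspace K "grade B n" by (rule vs)
    interpret C: vectorspace K "grade C n" by (rule vs)
    interpret D: vectorspace K "grade D n" by (rule vs)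
    interpret D1: vectorspace K "grade D (n + 1)" by (rule vs)
    interpret dB: linear_map K "grade B (n + 1)" "grade B n" "bdry B (n + 1)" using B by (rule is_cplxD)
    interpret dC: linear_map K "grade C (n + 1)" "grade C n" "bdry C (n + 1)" using C by (rule is_cplxD)
    interpret dD: linear_map K "grade D (n + 1)" "grade D n" "bdry D (n + 1)" using D by (rule is_cplxD)
    interpret h: linear_map K "grade B n" "grade D n" "h n" using h by (rule is_chain_mapD)
    interpret k: linear_map K "grade C n" "grade D n" "k n" using k by (rule is_chain_mapD)
    obtain b' c' where bc': "b' \<in> carrier (grade B (n + 1))" "c' \<in> carrier (grade C (n + 1))"
      "d = h (n + 1) b' \<ominus>\<^bsub>grade D (n + 1)\<^esub> k (n + 1) c'"
      using surj'[OF d] by metis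
    note car = is_chain_mapD(4)[OF h bc'(1)] is_chain_mapD(4)[OF k bc'(2)]
    have dbc: "bdry B (n + 1) b' \<in> carrier (grade B n)" "bdry C (n + 1) c' \<in> carrier (grade C n)"
      using bc' by simp_all
    have "h n b \<ominus>\<^bsub>grade D n\<^esub> k n c = h n (bdry B (n + 1) b') \<ominus>\<^bsub>grade D n\<^esub> k n (bdry C (n + 1) c')"
      unfolding eq bc'(3) using car is_chain_mapD(6)[OF h bc'(1)] is_chain_mapD(6)[OF k bc'(2)]
      by simp
    then have "h n b \<ominus>\<^bsub>grade D n\<^esub> h n (bdry B (n + 1) b') =
        k n c \<ominus>\<^bsub>grade D n\<^esub> k n (bdry C (n + 1) c')"
      using D.M.minus_eq_minus_swap[of "h n b" "k n c" "h n (bdry B (n + 1) b')" "k n (bdry C (n + 1) c')"]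
        b c dbc by simp
    then have "h n (b \<ominus>\<^bsub>grade B n\<^esub> bdry B (n + 1) b') = k n (c \<ominus>\<^bsub>grade C n\<^esub> bdry C (n + 1) c')"
      using b c dbc by simp
    then obtain u where u: "u \<in> carrier (grade A n)" "f n u = b \<ominus>\<^bsub>grade B n\<^esub> bdry B (n + 1) b'"
      "g n u = c \<ominus>\<^bsub>grade C n\<^esub> bdry C (n + 1) c'"
      using exact[OF B.M.minus_closed[OF b dbc(1)] C.M.minus_closed[OF c dbc(2)]] by metis
    have "b = bdry B (n + 1) b' \<oplus>\<^bsub>grade B n\<^esub> f n u"
      unfolding u(2) using b dbc B.M.minus_add_cancel[OF b dbc(1)] by (simp add: B.M.a_comm)
    moreover have "c = bdry C (n + 1) c' \<oplus>\<^bsub>grade C n\<^esub> g n u"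
      unfolding u(3) using c dbc C.M.minus_add_cancel[OF c dbc(2)] by (simp add: C.M.a_comm)
    ultimately show ?thesis using u(1) bc' by metis
  qed
  have unique: "a = a'" if "a \<in> carrier (grade A n)" "a' \<in> carrier (grade A n)"
    "f n a = f n a'" "g n a = g n a'" for n a a'
  proof -
    interpret A: vectorspace K "grade A n" by (rule vs)
    interpret B: vectorspace K "grade B n" by (rule vs)
    interpret C: vectorspace K "grade C n" by (rule vs)
    interpret f: linear_map K "grade A n" "grade B n" "f n" using f by (rule is_chain_mapD)
    interpret g: linear_map K "grade A n" "grade C n" "g n" using g by (rule is_chain_mapD)
    have "a \<ominus>\<^bsub>grade A n\<^esub> a' = \<zero>\<^bsub>grade A n\<^esub>"
      using that by (intro inj) (simp_all add: B.M.minus_eq_zero_iff C.M.minus_eq_zero_iff)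
    then show ?thesis using that A.M.minus_eq_zero_iff by metis
  qed
  have "quasi_iso K A ?P ?\<phi>"
  proof (rule quasi_isoI)
    show "is_chain_map K A ?P ?\<phi>" using f g h k comm by (rule is_chain_map_to_homotopy_pullback)
  next
    fix n z v assume z: "z \<in> cycles A n" and v: "v \<in> carrier (grade ?P (n + 1))"
      and eq: "?\<phi> n z = bdry ?P (n + 1) v"
    obtain b c d where v': "v = (b, c, d)" by (cases v)
    have car: "b \<in> carrier (grade B (n + 1))" "c \<in> carrier (grade C (n + 1))" "d \<in> carrier (grade D (n + 1 + 1))"
      using v by (simp_all add: v' homotopy_pullback_def direct_sum_def)
    have eqs: "f n z = bdry B (n + 1) b" "g n z = bdry C (n + 1) c"
      "(h (n + 1) b \<ominus>\<^bsub>grade D (n + 1)\<^esub> k (n + 1) c) \<ominus>\<^bsub>grade D (n + 1)\<^esub> bdry D (n + 1 + 1) d = \<zero>\<^bsub>grade D (n + 1)\<^esub>"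
      using eq by (simp_all add: v' homotopy_pullback_def)
    interpret D: vectorspace K "grade D (n + 1)" by (rule vs)
    interpret dD: linear_map K "grade D (n + 1 + 1)" "grade D (n + 1)" "bdry D (n + 1 + 1)" using D by (rule is_cplxD)
    have "h (n + 1) b \<ominus>\<^bsub>grade D (n + 1)\<^esub> k (n + 1) c = bdry D (n + 1 + 1) d"
      using eqs(3) D.M.minus_eq_zero_iff[OF D.M.minus_closed[OF is_chain_mapD(4)[OF h car(1)] is_chain_mapD(4)[OF k car(2)]]
        dD.f_im[OF car(3)]] by simp
    \<comment> \<open>Here \<open>split\<close> is applied one degree up, where
      \<open>(b, c, d)\<close> shows that the image of \<open>z\<close> bounds; the remainder
      \<open>u\<close> will have boundary \<open>z\<close>.\<close>
    then obtain u b' c' where u: "u \<in> carrier (grade A (n + 1))" "b' \<in> carrier (grade B (n + 1 + 1))"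
      "c' \<in> carrier (grade C (n + 1 + 1))"
      "b = bdry B (n + 1 + 1) b' \<oplus>\<^bsub>grade B (n + 1)\<^esub> f (n + 1) u"
      "c = bdry C (n + 1 + 1) c' \<oplus>\<^bsub>grade C (n + 1)\<^esub> g (n + 1) u"
      using split[OF car] by metis
    have fb: "bdry B (n + 1) b = f n (bdry A (n + 1) u)"
    proof -
      interpret B: vectorspace K "grade B (n + 1)" by (rule vs)
      interpret B0: vectorspace K "grade B n" by (rule vs)
      interpret d1: linear_map K "grade B (n + 1)" "grade B n" "bdry B (n + 1)" using B by (rule is_cplxD)
      interpret d2: linear_map K "grade B (n + 1 + 1)" "grade B (n + 1)" "bdry B (n + 1 + 1)" using B by (rule is_cplxD)
      have "bdry B (n + 1) b = bdry B (n + 1) (bdry B (n + 1 + 1) b') \<oplus>\<^bsub>grade B n\<^esub> bdry B (n + 1) (f (n + 1) u)"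
        unfolding u(4) using d2.f_im[OF u(2)] is_chain_mapD(4)[OF f u(1)] by (rule d1.f_add)
      then show ?thesis
        using is_cplxD(3)[OF B u(2)] is_chain_mapD(6)[OF f u(1)] d1.f_im[OF is_chain_mapD(4)[OF f u(1)]]
        by simp
    qed
    have gc: "bdry C (n + 1) c = g n (bdry A (n + 1) u)"
    proof -
      interpret C: vectorspace K "grade C (n + 1)" by (rule vs)
      interpret C0: vectorspace K "grade C n" by (rule vs)
      interpret d1: linear_map K "grade C (n + 1)" "grade C n" "bdry C (n + 1)" using C by (rule is_cplxD)
      interpret d2: linear_map K "grade C (n + 1 + 1)" "grade C (n + 1)" "bdry C (n + 1 + 1)" using C by (rule is_cplxD)
      have "bdry C (n + 1) c = bdry C (n + 1) (bdry C (n + 1 + 1) c') \<oplus>\<^bsub>grade C n\<^esub> bdry C (n + 1) (g (n + 1) u)"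
        unfolding u(5) using d2.f_im[OF u(3)] is_chain_mapD(4)[OF g u(1)] by (rule d1.f_add)
      then show ?thesis
        using is_cplxD(3)[OF C u(3)] is_chain_mapD(6)[OF g u(1)] d1.f_im[OF is_chain_mapD(4)[OF g u(1)]]
        by simp
    qed
    interpret dA: linear_map K "grade A (n + 1)" "grade A n" "bdry A (n + 1)" using A by (rule is_cplxD)
    have "z = bdry A (n + 1) u"
      using fb gc eqs(1,2) cycles_closed[OF z] dA.f_im[OF u(1)] by (intro unique) simp_all
    then show "\<exists>u\<in>carrier (grade A (n + 1)). z = bdry A (n + 1) u" using u(1) by blast
  next
    fix n w assume w: "w \<in> cycles ?P n"
    obtain b c d where w': "w = (b, c, d)" by (cases w)
    have car: "b \<in> carrier (grade B n)" "c \<in> carrier (grade C n)" "d \<in> carrier (grade D (n + 1))"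
      using cycles_closed[OF w] by (simp_all add: w' homotopy_pullback_def direct_sum_def)
    have eqs: "bdry B n b = \<zero>\<^bsub>grade B (n - 1)\<^esub>" "bdry C n c = \<zero>\<^bsub>grade C (n - 1)\<^esub>"
      "(h n b \<ominus>\<^bsub>grade D n\<^esub> k n c) \<ominus>\<^bsub>grade D n\<^esub> bdry D (n + 1) d = \<zero>\<^bsub>grade D n\<^esub>"
      using w by (simp_all add: w' cycles_def homotopy_pullback_def direct_sum_def)
    interpret A0: vectorspace K "grade A (n - 1)" by (rule vs)
    interpret B: vectorspace K "grade B n" by (rule vs)
    interpret C: vectorspace K "grade C n" by (rule vs)
    interpret B0: vectorspace K "grade B (n - 1)" by (rule vs)
    interpret C0: vectorspace K "grade C (n - 1)" by (rule vs)
    interpret D: vectorspace K "grade D n" by (rule vs)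
    interpret D1: vectorspace K "grade D (n + 1)" by (rule vs)
    interpret D2: vectorspace K "grade D (n + 1 + 1)" by (rule vs)
    interpret dB: linear_map K "grade B n" "grade B (n - 1)" "bdry B n" using B by (rule is_cplxD)
    interpret dC: linear_map K "grade C n" "grade C (n - 1)" "bdry C n" using C by (rule is_cplxD)
    interpret dA: linear_map K "grade A n" "grade A (n - 1)" "bdry A n" using A by (rule is_cplxD)
    interpret dB1: linear_map K "grade B (n + 1)" "grade B n" "bdry B (n + 1)" using B by (rule is_cplxD)
    interpret dC1: linear_map K "grade C (n + 1)" "grade C n" "bdry C (n + 1)" using C by (rule is_cplxD)
    interpret dD: linear_map K "grade D (n + 1)" "grade D n" "bdry D (n + 1)" using D by (rule is_cplxD)
    interpret dD1: linear_map K "grade D (n + 1 + 1)" "grade D (n + 1)" "bdry D (n + 1 + 1)" using D by (rule is_cplxD)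
    have "h n b \<ominus>\<^bsub>grade D n\<^esub> k n c = bdry D (n + 1) d"
      using eqs(3) D.M.minus_eq_zero_iff[OF D.M.minus_closed[OF is_chain_mapD(4)[OF h car(1)] is_chain_mapD(4)[OF k car(2)]]
        dD.f_im[OF car(3)]] by simp
    then obtain u b' c' where u: "u \<in> carrier (grade A n)" "b' \<in> carrier (grade B (n + 1))"
      "c' \<in> carrier (grade C (n + 1))" "d = h (n + 1) b' \<ominus>\<^bsub>grade D (n + 1)\<^esub> k (n + 1) c'"
      "b = bdry B (n + 1) b' \<oplus>\<^bsub>grade B n\<^esub> f n u" "c = bdry C (n + 1) c' \<oplus>\<^bsub>grade C n\<^esub> g n u"
      using split[OF car] by metis
    \<comment> \<open>\<open>u\<close> is a cycle: since \<open>b\<close> and \<open>c\<close> are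
      cycles, \<open>f\<close> and \<open>g\<close> both send its boundary to zero, and they are
      jointly injective.\<close>
    have "bdry B n b = bdry B n (bdry B (n + 1) b') \<oplus>\<^bsub>grade B (n - 1)\<^esub> bdry B n (f n u)"
      unfolding u(5) using dB1.f_im[OF u(2)] is_chain_mapD(4)[OF f u(1)] by (rule dB.f_add)
    then have "f (n - 1) (bdry A n u) = \<zero>\<^bsub>grade B (n - 1)\<^esub>"
      using eqs(1) is_cplxD(3)[OF B u(2)] is_chain_mapD(5)[OF f u(1)] dB.f_im[OF is_chain_mapD(4)[OF f u(1)]]
      by simp
    moreover have "bdry C n c = bdry C n (bdry C (n + 1) c') \<oplus>\<^bsub>grade C (n - 1)\<^esub> bdry C n (g n u)"
      unfolding u(6) using dC1.f_im[OF u(3)] is_chain_mapD(4)[OF g u(1)] by (rule dC.f_add)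
    then have "g (n - 1) (bdry A n u) = \<zero>\<^bsub>grade C (n - 1)\<^esub>"
      using eqs(2) is_cplxD(3)[OF C u(3)] is_chain_mapD(5)[OF g u(1)] dC.f_im[OF is_chain_mapD(4)[OF g u(1)]]
      by simp
    ultimately have "bdry A n u = \<zero>\<^bsub>grade A (n - 1)\<^esub>"
      using dA.f_im[OF u(1)] by (intro inj)
    then have "u \<in> cycles A n" using u(1) by (simp add: cycles_def)
    \<comment> \<open>The path component can be zero, because \<open>d\<close> is already the
      difference of the images of \<open>b'\<close> and \<open>c'\<close>.\<close>
    moreover have "(b', c', \<zero>\<^bsub>grade D (n + 1 + 1)\<^esub>) \<in> carrier (grade ?P (n + 1))"
      using u(2,3) D2.M.zero_closed by (simp add: homotopy_pullback_def direct_sum_def)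
    moreover have "w = bdry ?P (n + 1) (b', c', \<zero>\<^bsub>grade D (n + 1 + 1)\<^esub>) \<oplus>\<^bsub>grade ?P n\<^esub> ?\<phi> n u"
    proof -
      note hk = is_chain_mapD(4)[OF h u(2)] is_chain_mapD(4)[OF k u(3)]
      let ?d = "h (n + 1) b' \<ominus>\<^bsub>grade D (n + 1)\<^esub> k (n + 1) c'"
      have "?d \<ominus>\<^bsub>grade D (n + 1)\<^esub> bdry D (n + 1 + 1) \<zero>\<^bsub>grade D (n + 1 + 1)\<^esub> = ?d"
        unfolding dD1.f0_is_0
        using hk by (intro diff_zero_right D1.M.minus_closed D1.M.abelian_group_axioms)
      then have "d = ?d \<ominus>\<^bsub>grade D (n + 1)\<^esub> bdry D (n + 1 + 1) \<zero>\<^bsub>grade D (n + 1 + 1)\<^esub>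
          \<oplus>\<^bsub>grade D (n + 1)\<^esub> \<zero>\<^bsub>grade D (n + 1)\<^esub>"
        using hk u(4) by simp
      then show ?thesis
        unfolding w' homotopy_pullback_def direct_sum_def using u(5,6) by simp
    qed
    ultimately show "\<exists>z\<in>cycles A n. \<exists>v\<in>carrier (grade ?P (n + 1)). w = bdry ?P (n + 1) v \<oplus>\<^bsub>grade ?P n\<^esub> ?\<phi> n z"
      by blast
  qed
  then show ?thesis by (simp add: homotopy_cartesian_def)
qed

section \<open>Complexes of functors regarded as functors to complexes\<close>

definition cplx_cfunctor ::
    "(int \<Rightarrow> ('p, 'k, 'v) vfunctor) \<Rightarrow> (int \<Rightarrow> 'p \<Rightarrow> 'v \<Rightarrow> 'v) \<Rightarrow> ('p, 'k, 'v) cfunctor" where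
  "cplx_cfunctor E d =
    \<lparr>cobj = (\<lambda>x. \<lparr>grade = (\<lambda>n. obj (E n) x), bdry = (\<lambda>n. d n x)\<rparr>), carr = (\<lambda>x y n. arr (E n) x y)\<rparr>"

lemma is_cfunctor_cplx_cfunctor:
  fixes E :: "int \<Rightarrow> ('p::order, 'k, 'v) vfunctor"
  assumes E: "\<And>n. is_vfunctor K (E n)"
    and lin: "\<And>n x. linear_map K (obj (E n) x) (obj (E (n - 1)) x) (d n x)"
    and nat: "\<And>n x y v. x \<le> y \<Longrightarrow> v \<in> carrier (obj (E n) x) \<Longrightarrow>
      arr (E (n - 1)) x y (d n x v) = d n y (arr (E n) x y v)"
    and dd: "\<And>n x v. v \<in> carrier (obj (E n) x) \<Longrightarrow> d (n - 1) x (d n x v) = \<zero>\<^bsub>obj (E (n - 1 - 1)) x\<^esub>"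
  shows "is_cfunctor K (cplx_cfunctor E d)"
proof -
  have cplx: "is_cplx K (cobj (cplx_cfunctor E d) x)" for x
    using lin dd by (simp add: is_cplx_def cplx_cfunctor_def)
  then have "is_chain_map K (cobj (cplx_cfunctor E d) x) (cobj (cplx_cfunctor E d) y) (carr (cplx_cfunctor E d) x y)"
    if "x \<le> y" for x y
    using nat E that by (simp add: is_chain_map_def) (simp add: cplx_cfunctor_def is_vfunctor_def)
  moreover have "arr (E n) x x v = v" if "v \<in> carrier (obj (E n) x)" for x v n
    using E[of n] that by (simp add: is_vfunctor_def)
  moreover have "arr (E n) y z (arr (E n) x y v) = arr (E n) x z v"
    if "x \<le> y" "y \<le> z" "v \<in> carrier (obj (E n) x)" for x y z v n
    using E[of n] that unfolding is_vfunctor_def by blast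
  ultimately show ?thesis
    using cplx unfolding is_cfunctor_def by (simp add: cplx_cfunctor_def)
qed

text \<open>Degree 1 gives exactness on the left and in the middle, codegree 1 on the right;
  together they make every square a short exact sequence in each degree, as
  \<open>homotopy_cartesianI\<close> demands.\<close>

lemma homotopy_degree1_cplx_cfunctor:
  fixes E :: "int \<Rightarrow> ('p::distrib_lattice, 'k, 'v) vfunctor"
  assumes E: "\<And>n. is_vfunctor K (E n)"
    and \<Phi>: "is_cfunctor K (cplx_cfunctor E d)"
    and deg: "\<And>n. degree1 K (E n)" "\<And>n. codegree1 K (E n)"
  shows "homotopy_degree1 K (cplx_cfunctor E d)"
  unfolding homotopy_degree1_def
proof (intro allI)
  fix x y :: 'p
  let ?\<Phi> = "cplx_cfunctor E d"
  have grade: "grade (cobj ?\<Phi> x) n = obj (E n) x" and carr: "carr ?\<Phi> x y = (\<lambda>n. arr (E n) x y)" for x y n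
    by (simp_all add: cplx_cfunctor_def)
  have cm: "is_chain_map K (cobj ?\<Phi> x) (cobj ?\<Phi> y) (\<lambda>n. arr (E n) x y)" if "x \<le> y" for x y
    using \<Phi> that unfolding is_cfunctor_def carr by simp
  note me = deg(1)[unfolded degree1_iff[OF E], THEN conjunct1, unfolded middle_exact_iff[OF E], rule_format]
  note inj = deg(1)[unfolded degree1_iff[OF E], THEN conjunct2, rule_format]
  note surj = deg(2)[unfolded codegree1_iff[OF E], THEN conjunct2, rule_format]
  have comm: "arr (E n) x (sup x y) (arr (E n) (inf x y) x a) = arr (E n) y (sup x y) (arr (E n) (inf x y) y a)"
    if "a \<in> carrier (obj (E n) (inf x y))" for n a
  proof -
    interpret vect_functor K "E n" by unfold_locales (rule E)
    show ?thesis using arr_comp[OF inf_le1 sup_ge1 that] arr_comp[OF inf_le2 sup_ge2 that] by simp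
  qed
  show "homotopy_cartesian K (cobj ?\<Phi> (inf x y)) (cobj ?\<Phi> x) (cobj ?\<Phi> y) (cobj ?\<Phi> (sup x y))
      (carr ?\<Phi> (inf x y) x) (carr ?\<Phi> (inf x y) y) (carr ?\<Phi> x (sup x y)) (carr ?\<Phi> y (sup x y))"
    by (rule homotopy_cartesianI, unfold grade carr)
      (fact cm[OF inf_le1] cm[OF inf_le2] cm[OF sup_ge1] cm[OF sup_ge2] comm inj me surj)+
qed

section \<open>Products of functors\<close>

text \<open>A product indexed by \<open>nat\<close>, so that several summands in one degree of a
  complex share the carrier type \<open>nat \<Rightarrow> 'v\<close>; below, at most three factors
  in a degree can be nonzero. Multiplication and unit are dummies.\<close>

definition pi_module :: "(nat \<Rightarrow> ('k, 'v) module) \<Rightarrow> ('k, nat \<Rightarrow> 'v) module" where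
  "pi_module M =
    \<lparr>carrier = {v. \<forall>i. v i \<in> carrier (M i)}, mult = (\<lambda>_ _ i. \<zero>\<^bsub>M i\<^esub>), one = (\<lambda>i. \<zero>\<^bsub>M i\<^esub>),
     zero = (\<lambda>i. \<zero>\<^bsub>M i\<^esub>), add = (\<lambda>v w i. v i \<oplus>\<^bsub>M i\<^esub> w i), smult = (\<lambda>c v i. c \<odot>\<^bsub>M i\<^esub> v i)\<rparr>"

lemma pi_module_simps [simp]:
  "v \<in> carrier (pi_module M) \<longleftrightarrow> (\<forall>i. v i \<in> carrier (M i))"
  "\<zero>\<^bsub>pi_module M\<^esub> = (\<lambda>i. \<zero>\<^bsub>M i\<^esub>)"
  "v \<oplus>\<^bsub>pi_module M\<^esub> w = (\<lambda>i. v i \<oplus>\<^bsub>M i\<^esub> w i)"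
  "c \<odot>\<^bsub>pi_module M\<^esub> v = (\<lambda>i. c \<odot>\<^bsub>M i\<^esub> v i)"
  by (simp_all add: pi_module_def)

lemma vectorspace_pi_module:
  assumes "field K" "\<And>i. vectorspace K (M i)"
  shows "vectorspace K (pi_module M)"
proof -
  interpret M: vectorspace K "M i" for i by (rule assms)
  show ?thesis
  proof (rule vs_criteria)
    show "\<forall>v\<in>carrier (pi_module M). \<exists>neg_v\<in>carrier (pi_module M). v \<oplus>\<^bsub>pi_module M\<^esub> neg_v = \<zero>\<^bsub>pi_module M\<^esub>"
    proof
      fix v assume "v \<in> carrier (pi_module M)"
      then show "\<exists>w\<in>carrier (pi_module M). v \<oplus>\<^bsub>pi_module M\<^esub> w = \<zero>\<^bsub>pi_module M\<^esub>"
        by (intro bexI[of _ "\<lambda>i. \<ominus>\<^bsub>M i\<^esub> v i"]) (simp_all add: M.M.r_neg)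
    qed
  qed (simp_all add: assms(1) M.M.a_ac M.smult_l_distr M.smult_r_distr M.smult_assoc1)
qed

definition pi_vfunctor :: "(nat \<Rightarrow> ('p, 'k, 'v) vfunctor) \<Rightarrow> ('p, 'k, nat \<Rightarrow> 'v) vfunctor" where
  "pi_vfunctor E = \<lparr>obj = (\<lambda>x. pi_module (\<lambda>i. obj (E i) x)), arr = (\<lambda>x y v i. arr (E i) x y (v i))\<rparr>"

lemma pi_vfunctor_simps [simp]:
  "obj (pi_vfunctor E) x = pi_module (\<lambda>i. obj (E i) x)"
  "arr (pi_vfunctor E) x y v = (\<lambda>i. arr (E i) x y (v i))"
  by (simp_all add: pi_vfunctor_def)

lemma is_vfunctor_pi:
  assumes E: "\<And>i. is_vfunctor K (E i)"
  shows "is_vfunctor K (pi_vfunctor E)"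
proof -
  interpret E: vect_functor K "E i" for i by unfold_locales (rule E)
  have vs: "vectorspace K (pi_module (\<lambda>i. obj (E i) x))" for x
    by (rule vectorspace_pi_module) (rule E.V.field_axioms E.V.vectorspace_axioms)+
  have "arr (pi_vfunctor E) x y \<in> module_hom K (pi_module (\<lambda>i. obj (E i) x)) (pi_module (\<lambda>i. obj (E i) y))"
    if "x \<le> y" for x y
    using that by (simp add: module_hom_def Pi_iff)
  then show ?thesis
    unfolding is_vfunctor_def linear_map_iff using vs by simp
qed

lemma degree1_codegree1_pi:
  fixes E :: "nat \<Rightarrow> ('p::distrib_lattice, 'k, 'v) vfunctor"
  assumes E: "\<And>i. is_vfunctor K (E i)" and deg: "\<And>i. degree1 K (E i)" "\<And>i. codegree1 K (E i)"
  shows "degree1 K (pi_vfunctor E)" "codegree1 K (pi_vfunctor E)"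
proof -
  note P = is_vfunctor_pi[of K E, OF E]
  note me = deg(1)[unfolded degree1_iff[OF E], THEN conjunct1, unfolded middle_exact_iff[OF E], rule_format]
  note inj = deg(1)[unfolded degree1_iff[OF E], THEN conjunct2, rule_format]
  note surj = deg(2)[unfolded codegree1_iff[OF E], THEN conjunct2, rule_format]
  have "middle_exact (pi_vfunctor E)"
    unfolding middle_exact_iff[OF P]
  proof (intro allI ballI impI)
    fix x y v w
    assume vw: "v \<in> carrier (obj (pi_vfunctor E) x)" "w \<in> carrier (obj (pi_vfunctor E) y)"
      "arr (pi_vfunctor E) x (sup x y) v = arr (pi_vfunctor E) y (sup x y) w"
    have "\<forall>i. \<exists>u. u \<in> carrier (obj (E i) (inf x y)) \<and> arr (E i) (inf x y) x u = v i \<and> arr (E i) (inf x y) y u = w i"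
    proof
      fix i
      show "\<exists>u. u \<in> carrier (obj (E i) (inf x y)) \<and> arr (E i) (inf x y) x u = v i \<and> arr (E i) (inf x y) y u = w i"
        using me[of "v i" i x "w i" y] vw by (simp add: fun_eq_iff Bex_def)
    qed
    then obtain u where "\<forall>i. u i \<in> carrier (obj (E i) (inf x y)) \<and> arr (E i) (inf x y) x (u i) = v i \<and>
        arr (E i) (inf x y) y (u i) = w i"
      unfolding choice_iff by blast
    then show "\<exists>u\<in>carrier (obj (pi_vfunctor E) (inf x y)).
        arr (pi_vfunctor E) (inf x y) x u = v \<and> arr (pi_vfunctor E) (inf x y) y u = w"
      by (intro bexI[of _ u]) simp_all
  qed
  moreover have "u = \<zero>\<^bsub>obj (pi_vfunctor E) (inf x y)\<^esub>"
    if "u \<in> carrier (obj (pi_vfunctor E) (inf x y))" "arr (pi_vfunctor E) (inf x y) x u = \<zero>\<^bsub>obj (pi_vfunctor E) x\<^esub>"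
      "arr (pi_vfunctor E) (inf x y) y u = \<zero>\<^bsub>obj (pi_vfunctor E) y\<^esub>" for x y u
    using that inj by (simp add: fun_eq_iff)
  moreover have "\<exists>v\<in>carrier (obj (pi_vfunctor E) x). \<exists>w\<in>carrier (obj (pi_vfunctor E) y).
      d = arr (pi_vfunctor E) x (sup x y) v \<oplus>\<^bsub>obj (pi_vfunctor E) (sup x y)\<^esub> arr (pi_vfunctor E) y (sup x y) w"
    if d: "d \<in> carrier (obj (pi_vfunctor E) (sup x y))" for x y d
  proof -
    have "\<forall>i. \<exists>v w. v \<in> carrier (obj (E i) x) \<and> w \<in> carrier (obj (E i) y) \<and>
        d i = arr (E i) x (sup x y) v \<oplus>\<^bsub>obj (E i) (sup x y)\<^esub> arr (E i) y (sup x y) w"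
      using surj d unfolding Bex_def by simp
    then obtain v w where "\<forall>i. v i \<in> carrier (obj (E i) x) \<and> w i \<in> carrier (obj (E i) y) \<and>
        d i = arr (E i) x (sup x y) (v i) \<oplus>\<^bsub>obj (E i) (sup x y)\<^esub> arr (E i) y (sup x y) (w i)"
      unfolding choice_iff by blast
    then show ?thesis by (intro bexI[of _ v] bexI[of _ w]) (simp_all add: fun_eq_iff)
  qed
  ultimately show "degree1 K (pi_vfunctor E)" "codegree1 K (pi_vfunctor E)"
    unfolding degree1_iff[OF P] codegree1_iff[OF P] by metis+
qed

section \<open>Functors of one variable\<close>

text \<open>A square with two opposite sides bijective is both a pullback and a pushout. The corners
  are named instead of written with \<open>inf\<close> and \<open>sup\<close>, because
  \<open>x\<close> and \<open>y\<close> are exchanged in one of the two applications.\<close>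

lemma (in vect_functor) exact_square_if_bij:
  assumes le: "i \<le> x" "i \<le> y" "x \<le> s" "y \<le> s"
    and ix: "bij_betw (arr F i x) (carrier (obj F i)) (carrier (obj F x))"
    and ys: "bij_betw (arr F y s) (carrier (obj F y)) (carrier (obj F s))"
  shows "v \<in> carrier (obj F x) \<Longrightarrow> w \<in> carrier (obj F y) \<Longrightarrow> arr F x s v = arr F y s w \<Longrightarrow>
      \<exists>u\<in>carrier (obj F i). arr F i x u = v \<and> arr F i y u = w"
    and "u \<in> carrier (obj F i) \<Longrightarrow> arr F i x u = \<zero>\<^bsub>obj F x\<^esub> \<Longrightarrow> u = \<zero>\<^bsub>obj F i\<^esub>"
    and "d \<in> carrier (obj F s) \<Longrightarrow> \<exists>w\<in>carrier (obj F y). d = arr F y s w"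
proof -
  show "\<exists>u\<in>carrier (obj F i). arr F i x u = v \<and> arr F i y u = w"
    if vw: "v \<in> carrier (obj F x)" "w \<in> carrier (obj F y)" "arr F x s v = arr F y s w"
  proof -
    have "v \<in> arr F i x ` carrier (obj F i)" using vw(1) unfolding bij_betw_imp_surj_on[OF ix] .
    then obtain u where u: "u \<in> carrier (obj F i)" "v = arr F i x u" by (rule imageE)
    have "arr F y s (arr F i y u) = arr F y s w"
      using arr_comp[OF le(1,3) u(1)] arr_comp[OF le(2,4) u(1)] vw(3) unfolding u(2) by simp
    then have "arr F i y u = w"
      using bij_betw_imp_inj_on[OF ys] arr_closed[OF le(2) u(1)] vw(2) by (meson inj_onD)
    then show ?thesis using u by metis
  qed
  show "u = \<zero>\<^bsub>obj F i\<^esub>" if "u \<in> carrier (obj F i)" "arr F i x u = \<zero>\<^bsub>obj F x\<^esub>"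
    using inj_onD[OF bij_betw_imp_inj_on[OF ix], of u "\<zero>\<^bsub>obj F i\<^esub>"] le(1) that by simp
  show "\<exists>w\<in>carrier (obj F y). d = arr F y s w" if "d \<in> carrier (obj F s)"
  proof -
    have "d \<in> arr F y s ` carrier (obj F y)" using that unfolding bij_betw_imp_surj_on[OF ys] .
    then show ?thesis by (meson imageE)
  qed
qed

text \<open>With a coordinate for \<open>\<pi>\<close>, this says that the functor depends on that
  coordinate only, up to isomorphism.\<close>

definition constant_along :: "('p::order \<Rightarrow> 'c) \<Rightarrow> ('p, 'k, 'v) vfunctor \<Rightarrow> bool" where
  "constant_along \<pi> E \<longleftrightarrow> (\<forall>x y. x \<le> y \<longrightarrow> \<pi> x = \<pi> y \<longrightarrow>
    bij_betw (arr E x y) (carrier (obj E x)) (carrier (obj E y)))"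

text \<open>The values of \<open>\<pi>\<close> form a chain, so \<open>\<pi> x \<le> \<pi> y\<close>
  gives \<open>\<pi> (inf x y) = \<pi> x\<close> and \<open>\<pi> (sup x y) = \<pi> y\<close>; then
  two opposite sides of the square are bijective.\<close>

lemma degree1_codegree1_constant_along:
  fixes \<pi> :: "'p::distrib_lattice \<Rightarrow> 'c::linorder" and E :: "('p, 'k, 'v) vfunctor"
  assumes E: "is_vfunctor K E" and const: "constant_along \<pi> E"
    and \<pi>: "\<And>x y. \<pi> (inf x y) = min (\<pi> x) (\<pi> y)" "\<And>x y. \<pi> (sup x y) = max (\<pi> x) (\<pi> y)"
  shows "degree1 K E" "codegree1 K E"
proof -
  interpret vect_functor K E by unfold_locales fact
  \<comment> \<open>The second form has the operands of \<open>inf\<close> and \<open>sup\<close>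
    exchanged, for the opposite comparison of \<open>\<pi> x\<close> and
    \<open>\<pi> y\<close>.\<close>
  have bij: "bij_betw (arr E (inf x y) x) (carrier (obj E (inf x y))) (carrier (obj E x)) \<and>
      bij_betw (arr E y (sup x y)) (carrier (obj E y)) (carrier (obj E (sup x y)))"
    "bij_betw (arr E (inf y x) x) (carrier (obj E (inf y x))) (carrier (obj E x)) \<and>
      bij_betw (arr E y (sup y x)) (carrier (obj E y)) (carrier (obj E (sup y x)))"
    if "\<pi> x \<le> \<pi> y" for x y
    using const that \<pi>[of x y] \<pi>[of y x] unfolding constant_along_def by simp_all
  have *: "(\<forall>v\<in>carrier (obj E x). \<forall>w\<in>carrier (obj E y). arr E x (sup x y) v = arr E y (sup x y) w \<longrightarrow>
      (\<exists>u\<in>carrier (obj E (inf x y)). arr E (inf x y) x u = v \<and> arr E (inf x y) y u = w)) \<and>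
    (\<forall>u\<in>carrier (obj E (inf x y)). arr E (inf x y) x u = \<zero>\<^bsub>obj E x\<^esub> \<longrightarrow>
      arr E (inf x y) y u = \<zero>\<^bsub>obj E y\<^esub> \<longrightarrow> u = \<zero>\<^bsub>obj E (inf x y)\<^esub>) \<and>
    (\<forall>d\<in>carrier (obj E (sup x y)). \<exists>v\<in>carrier (obj E x). \<exists>w\<in>carrier (obj E y).
      d = arr E x (sup x y) v \<oplus>\<^bsub>obj E (sup x y)\<^esub> arr E y (sup x y) w)" for x y
  proof (cases "\<pi> x \<le> \<pi> y")
    case True
    note sq = exact_square_if_bij[OF inf_le1 inf_le2 sup_ge1 sup_ge2 bij(1)[OF True, THEN conjunct1] bij(1)[OF True, THEN conjunct2]]
    have "\<exists>v\<in>carrier (obj E x). \<exists>w\<in>carrier (obj E y). d = arr E x (sup x y) v \<oplus>\<^bsub>obj E (sup x y)\<^esub> arr E y (sup x y) w"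
      if d: "d \<in> carrier (obj E (sup x y))" for d
    proof -
      obtain w where w: "w \<in> carrier (obj E y)" "d = arr E y (sup x y) w" using sq(3)[OF d] by metis
      then show ?thesis by (intro bexI[of _ "\<zero>\<^bsub>obj E x\<^esub>"] bexI[of _ w]) simp_all
    qed
    then show ?thesis using sq(1,2) by metis
  next
    case False
    then have le: "\<pi> y \<le> \<pi> x" by simp
    note sq = exact_square_if_bij[OF inf_le2 inf_le1 sup_ge2 sup_ge1 bij(2)[OF le, THEN conjunct1] bij(2)[OF le, THEN conjunct2]]
    have "\<exists>v\<in>carrier (obj E x). \<exists>w\<in>carrier (obj E y). d = arr E x (sup x y) v \<oplus>\<^bsub>obj E (sup x y)\<^esub> arr E y (sup x y) w"
      if d: "d \<in> carrier (obj E (sup x y))" for d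
    proof -
      obtain v where v: "v \<in> carrier (obj E x)" "d = arr E x (sup x y) v" using sq(3)[OF d] by metis
      then show ?thesis by (intro bexI[of _ "\<zero>\<^bsub>obj E y\<^esub>"] bexI[of _ v]) simp_all
    qed
    then show ?thesis using sq(1,2) by metis
  qed
  show "degree1 K E" "codegree1 K E"
    unfolding degree1_iff[OF E] codegree1_iff[OF E] middle_exact_iff[OF E] using * by simp_all
qed

definition subspace_vfunctor :: "('k, 'v) module \<Rightarrow> ('p \<Rightarrow> 'v set) \<Rightarrow> ('p, 'k, 'v) vfunctor" where
  "subspace_vfunctor M S = \<lparr>obj = (\<lambda>x. M\<lparr>carrier := S x\<rparr>), arr = (\<lambda>_ _ v. v)\<rparr>"

lemma subspace_vfunctor_simps [simp]:
  "carrier (obj (subspace_vfunctor M S) x) = S x"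
  "\<zero>\<^bsub>obj (subspace_vfunctor M S) x\<^esub> = \<zero>\<^bsub>M\<^esub>"
  "v \<oplus>\<^bsub>obj (subspace_vfunctor M S) x\<^esub> w = v \<oplus>\<^bsub>M\<^esub> w"
  "c \<odot>\<^bsub>obj (subspace_vfunctor M S) x\<^esub> v = c \<odot>\<^bsub>M\<^esub> v"
  "arr (subspace_vfunctor M S) x y v = v"
  by (simp_all add: subspace_vfunctor_def)

lemma is_vfunctor_subspace:
  assumes "vectorspace K M" "\<And>x. submodule K (S x) M" "\<And>x y. x \<le> y \<Longrightarrow> S x \<subseteq> S y"
  shows "is_vfunctor K (subspace_vfunctor M S)"
proof -
  have "vectorspace K (M\<lparr>carrier := S x\<rparr>)" for x
    using assms(1,2) by (rule vectorspace_subspace)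
  moreover have "(\<lambda>v. v) \<in> module_hom K (M\<lparr>carrier := S x\<rparr>) (M\<lparr>carrier := S y\<rparr>)" if "x \<le> y" for x y
    using assms(3)[OF that] by (auto simp: module_hom_def)
  ultimately show ?thesis by (simp add: is_vfunctor_def linear_map_iff subspace_vfunctor_def)
qed

lemma constant_along_subspace:
  assumes "\<And>x y. \<pi> x = \<pi> y \<Longrightarrow> S x = S y"
  shows "constant_along \<pi> (subspace_vfunctor M S)"
  unfolding constant_along_def
proof (intro allI impI)
  fix x y assume "\<pi> x = \<pi> y"
  then have "S x = S y" by (rule assms)
  then show "bij_betw (arr (subspace_vfunctor M S) x y) (carrier (obj (subspace_vfunctor M S) x))
      (carrier (obj (subspace_vfunctor M S) y))"
    by (simp add: bij_betw_def inj_on_def)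
qed

definition precompose :: "('q, 'k, 'v) vfunctor \<Rightarrow> ('p \<Rightarrow> 'q) \<Rightarrow> ('p, 'k, 'v) vfunctor" where
  "precompose F \<phi> = \<lparr>obj = (\<lambda>x. obj F (\<phi> x)), arr = (\<lambda>x y. arr F (\<phi> x) (\<phi> y))\<rparr>"

lemma precompose_simps [simp]:
  "obj (precompose F \<phi>) x = obj F (\<phi> x)" "arr (precompose F \<phi>) x y = arr F (\<phi> x) (\<phi> y)"
  by (simp_all add: precompose_def)

context vect_functor begin

lemma is_vfunctor_precompose:
  assumes "\<And>x y. x \<le> y \<Longrightarrow> \<phi> x \<le> \<phi> y"
  shows "is_vfunctor K (precompose F \<phi>)"
  using assms unfolding is_vfunctor_def by (simp add: arr_linear V.vectorspace_axioms)

lemma constant_along_precompose: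
  assumes "\<And>x y. \<pi> x = \<pi> y \<Longrightarrow> \<phi> x = \<phi> y"
  shows "constant_along \<pi> (precompose F \<phi>)"
proof -
  have "bij_betw (arr F x x) (carrier (obj F x)) (carrier (obj F x))" for x
    using bij_betw_id by (rule bij_betw_cong[THEN iffD1, rotated]) simp
  then show ?thesis
    unfolding constant_along_def precompose_simps using assms by metis
qed

end

section \<open>The resolving complex\<close>

lemma linear_mapI:
  assumes "vectorspace K V" "vectorspace K W" "\<And>v. v \<in> carrier V \<Longrightarrow> f v \<in> carrier W"
    and "\<And>v w. v \<in> carrier V \<Longrightarrow> w \<in> carrier V \<Longrightarrow> f (v \<oplus>\<^bsub>V\<^esub> w) = f v \<oplus>\<^bsub>W\<^esub> f w"
    and "\<And>c v. c \<in> carrier K \<Longrightarrow> v \<in> carrier V \<Longrightarrow> f (c \<odot>\<^bsub>V\<^esub> v) = c \<odot>\<^bsub>W\<^esub> f v"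
  shows "linear_map K V W f"
  using assms by (simp add: linear_map_iff module_hom_def Pi_iff)

context grid_functor begin

abbreviation origin :: "'a \<times> 'b" where
  "origin \<equiv> (Orderings.bot, Orderings.bot)"

text \<open>Depends on \<open>fst x\<close> alone and grows with it, hence is a functor of one
  variable; \<open>KerB\<close> is the counterpart in the second coordinate.\<close>

definition KerA :: "'a \<times> 'b \<Rightarrow> 'v set" where
  "KerA x = {u \<in> Ker origin. arr F origin (fst x, Orderings.bot) u = \<zero>\<^bsub>obj F (fst x, Orderings.bot)\<^esub>}"

definition KerB :: "'a \<times> 'b \<Rightarrow> 'v set" where
  "KerB x = {u \<in> Ker origin. arr F origin (Orderings.bot, snd x) u = \<zero>\<^bsub>obj F (Orderings.bot, snd x)\<^esub>}"

text \<open>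
  The resolving complex is \<open>KerA x \<oplus> KerB x \<rightarrow> Ker origin \<oplus> F (x1, \<infinity>) \<oplus> F (\<infinity>, x2) \<rightarrow> F (\<infinity>, \<infinity>)\<close> in
  degrees 1, 0, -1. It resolves \<open>Ker\<close> by functors of one variable, because
  \<open>Ker x = Ker origin / (KerA x + KerB x)\<close>, and \<open>F / Ker\<close> is the kernel of its last map.
\<close>

definition piece :: "int \<Rightarrow> nat \<Rightarrow> ('a \<times> 'b, 'k, 'v) vfunctor" where
  "piece n i =
    (if n = 1 \<and> i = 0 then subspace_vfunctor (obj F origin) KerA
     else if n = 1 \<and> i = 1 then subspace_vfunctor (obj F origin) KerB
     else if n = 0 \<and> i = 0 then subspace_vfunctor (obj F origin) (\<lambda>_. Ker origin)
     else if n = 0 \<and> i = 1 then precompose F (\<lambda>x. (fst x, Orderings.top))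
     else if n = 0 \<and> i = 2 then precompose F (\<lambda>x. (Orderings.top, snd x))
     else if n = -1 \<and> i = 0 then precompose F (\<lambda>_. (Orderings.top, Orderings.top))
     else subspace_vfunctor (obj F origin) (\<lambda>_. {\<zero>\<^bsub>obj F origin\<^esub>}))"

text \<open>The direct sum of two complexes: the addition map into \<open>Ker origin\<close>, and
  the difference map into the value at the far corner. In degree 0 the one ends in component 0 and
  the other starts from components 1 and 2, so their composite is zero. All other components are
  zeros of the target.\<close>

definition bd :: "int \<Rightarrow> 'a \<times> 'b \<Rightarrow> (nat \<Rightarrow> 'v) \<Rightarrow> nat \<Rightarrow> 'v" where
  "bd n x v i =
    (if n = 1 \<and> i = 0 then v 0 \<oplus>\<^bsub>obj F origin\<^esub> v 1
     else if n = 0 \<and> i = 0 then arr F (fst x, Orderings.top) (Orderings.top, Orderings.top) (v 1)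
       \<ominus>\<^bsub>obj F (Orderings.top, Orderings.top)\<^esub> arr F (Orderings.top, snd x) (Orderings.top, Orderings.top) (v 2)
     else \<zero>\<^bsub>obj (piece (n - 1) i) x\<^esub>)"

definition resolution :: "('a \<times> 'b, 'k, nat \<Rightarrow> 'v) cfunctor" where
  "resolution = cplx_cfunctor (\<lambda>n. pi_vfunctor (piece n)) bd"

section \<open>The kernel functor as a quotient of its value at the origin\<close>

lemma origin_le: "origin \<le> x" "(fst x, Orderings.bot) \<le> x" "(Orderings.bot, snd x) \<le> x"
  "origin \<le> (fst x, Orderings.bot)" "origin \<le> (Orderings.bot, snd x)"
  by (simp_all add: less_eq_prod_def)

lemma submodule_Ker: "submodule K (Ker x) (obj F x)"
  using subfunctor_Ker unfolding subfunctor_def by (rule conjunct1[THEN spec])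

lemma submodule_KerA: "submodule K (KerA x) (obj F origin)"
proof (intro submodule.intro V.module_axioms)
  note le = origin_le(4)[of x]
  show "KerA x \<subseteq> carrier (obj F origin)" by (rule subsetI) (simp add: KerA_def Ker_closed(1))
  show "v \<oplus>\<^bsub>obj F origin\<^esub> w \<in> KerA x" if "v \<in> KerA x" "w \<in> KerA x" for v w
    using that Ker_closed(1,2) le by (simp add: KerA_def)
  show "\<zero>\<^bsub>obj F origin\<^esub> \<in> KerA x" using Ker_closed(3) le by (simp add: KerA_def)
  show "c \<odot>\<^bsub>obj F origin\<^esub> v \<in> KerA x" if "c \<in> carrier K" "v \<in> KerA x" for c v
    using that Ker_closed(1,4) le by (simp add: KerA_def)
qed

lemma submodule_KerB: "submodule K (KerB x) (obj F origin)"
proof (intro submodule.intro V.module_axioms)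
  note le = origin_le(5)[of x]
  show "KerB x \<subseteq> carrier (obj F origin)" by (rule subsetI) (simp add: KerB_def Ker_closed(1))
  show "v \<oplus>\<^bsub>obj F origin\<^esub> w \<in> KerB x" if "v \<in> KerB x" "w \<in> KerB x" for v w
    using that Ker_closed(1,2) le by (simp add: KerB_def)
  show "\<zero>\<^bsub>obj F origin\<^esub> \<in> KerB x" using Ker_closed(3) le by (simp add: KerB_def)
  show "c \<odot>\<^bsub>obj F origin\<^esub> v \<in> KerB x" if "c \<in> carrier K" "v \<in> KerB x" for c v
    using that Ker_closed(1,4) le by (simp add: KerB_def)
qed

lemma submodule_zero: "submodule K {\<zero>\<^bsub>obj F x\<^esub>} (obj F x)"
  by (intro submodule.intro V.module_axioms) simp_all

lemma KerA_mono: "x \<le> y \<Longrightarrow> KerA x \<subseteq> KerA y"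
proof
  fix u assume "x \<le> y" and u: "u \<in> KerA x"
  then have "(fst x, Orderings.bot :: 'b) \<le> (fst y, Orderings.bot)" by (simp add: less_eq_prod_def)
  then show "u \<in> KerA y"
    using u arr_eq_zero_mono[OF origin_le(4) _ Ker_closed(1)] by (simp add: KerA_def)
qed

lemma KerB_mono: "x \<le> y \<Longrightarrow> KerB x \<subseteq> KerB y"
proof
  fix u assume "x \<le> y" and u: "u \<in> KerB x"
  then have "(Orderings.bot :: 'a, snd x) \<le> (Orderings.bot, snd y)" by (simp add: less_eq_prod_def)
  then show "u \<in> KerB y"
    using u arr_eq_zero_mono[OF origin_le(5) _ Ker_closed(1)] by (simp add: KerB_def)
qed

text \<open>In the rectangle from the origin to \<open>x\<close>, the vector \<open>b\<close> is
  glued from the image of \<open>u\<close> at \<open>(fst x, bot)\<close> and from zero at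
  \<open>(bot, snd x)\<close>; these agree at \<open>x\<close> because \<open>u\<close> dies there.
  Then \<open>b\<close> lies in \<open>KerB x\<close>, and \<open>u\<close> minus \<open>b\<close>
  in \<open>KerA x\<close>.\<close>

lemma KerA_KerB_sum:
  assumes u: "u \<in> Ker origin" and "arr F origin x u = \<zero>\<^bsub>obj F x\<^esub>"
  obtains a b where "a \<in> KerA x" "b \<in> KerB x" "u = a \<oplus>\<^bsub>obj F origin\<^esub> b"
proof -
  have x: "x = (fst x, snd x)" by simp
  have uc: "u \<in> carrier (obj F origin)" using Ker_closed(1)[OF u] .
  let ?u = "arr F origin (fst x, Orderings.bot) u"
  have w: "?u \<in> Ker (fst x, Orderings.bot)" using Ker_closed(7)[OF origin_le(4) u] .
  have eq: "arr F (Orderings.bot, snd x) (fst x, snd x) \<zero>\<^bsub>obj F (Orderings.bot, snd x)\<^esub> =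
      arr F (fst x, Orderings.bot) (fst x, snd x) ?u"
    using arr_comp[OF origin_le(4,2) uc] assms(2) origin_le(3)[of x] by simp
  obtain b where b: "b \<in> Ker origin"
    "arr F origin (Orderings.bot, snd x) b = \<zero>\<^bsub>obj F (Orderings.bot, snd x)\<^esub>"
    "arr F origin (fst x, Orderings.bot) b = ?u"
    by (rule Ker_rect[OF bot_least bot_least Ker_closed(3) w eq])
  have bc: "b \<in> carrier (obj F origin)" using Ker_closed(1)[OF b(1)] .
  have "u \<ominus>\<^bsub>obj F origin\<^esub> b \<in> KerA x"
    using Ker_closed(6)[OF u b(1)] b(3) uc bc origin_le(4)[of x]
    by (simp add: KerA_def V.M.minus_eq_zero_iff)
  moreover have "b \<in> KerB x" using b by (simp add: KerB_def)
  moreover have "u = (u \<ominus>\<^bsub>obj F origin\<^esub> b) \<oplus>\<^bsub>obj F origin\<^esub> b"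
    using uc bc by (simp add: V.M.minus_add_cancel)
  ultimately show ?thesis by (rule that)
qed

section \<open>The terms of the resolving complex\<close>

lemma is_vfunctor_piece: "is_vfunctor K (piece n i)"
proof -
  have sub: "is_vfunctor K (subspace_vfunctor (obj F origin) S)"
    if "\<And>x. submodule K (S x) (obj F origin)" "\<And>x y. x \<le> y \<Longrightarrow> S x \<subseteq> S y" for S :: "'a \<times> 'b \<Rightarrow> 'v set"
    using V.vectorspace_axioms that by (rule is_vfunctor_subspace)
  have "is_vfunctor K (subspace_vfunctor (obj F origin) KerA)"
    "is_vfunctor K (subspace_vfunctor (obj F origin) KerB)"
    by (intro sub submodule_KerA submodule_KerB KerA_mono KerB_mono; assumption)+
  moreover have "is_vfunctor K (subspace_vfunctor (obj F origin) (\<lambda>_ :: 'a \<times> 'b. Ker origin))"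
    "is_vfunctor K (subspace_vfunctor (obj F origin) (\<lambda>_ :: 'a \<times> 'b. {\<zero>\<^bsub>obj F origin\<^esub>}))"
    by (intro sub submodule_Ker submodule_zero order_refl)+
  moreover have "is_vfunctor K (precompose F (\<lambda>x :: 'a \<times> 'b. (fst x, Orderings.top)))"
    "is_vfunctor K (precompose F (\<lambda>x :: 'a \<times> 'b. (Orderings.top, snd x)))"
    "is_vfunctor K (precompose F (\<lambda>_ :: 'a \<times> 'b. (Orderings.top, Orderings.top)))"
    by (rule is_vfunctor_precompose; simp add: less_eq_prod_def)+
  ultimately show ?thesis unfolding piece_def by presburger
qed

text \<open>Constant functors could be filed under either coordinate; they are counted with the
  first.\<close>

lemma piece_constant_along: "constant_along fst (piece n i) \<or> constant_along snd (piece n i)"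
proof -
  have "constant_along fst (subspace_vfunctor (obj F origin) KerA)"
    by (rule constant_along_subspace) (simp add: KerA_def)
  moreover have "constant_along snd (subspace_vfunctor (obj F origin) KerB)"
    by (rule constant_along_subspace) (simp add: KerB_def)
  moreover have "constant_along fst (subspace_vfunctor (obj F origin) (\<lambda>_ :: 'a \<times> 'b. Ker origin))"
    "constant_along fst (subspace_vfunctor (obj F origin) (\<lambda>_ :: 'a \<times> 'b. {\<zero>\<^bsub>obj F origin\<^esub>}))"
    by (rule constant_along_subspace, rule refl)+
  moreover have "constant_along fst (precompose F (\<lambda>x :: 'a \<times> 'b. (fst x, Orderings.top)))"
    by (rule constant_along_precompose) simp
  moreover have "constant_along snd (precompose F (\<lambda>x :: 'a \<times> 'b. (Orderings.top, snd x)))"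
    by (rule constant_along_precompose) simp
  moreover have "constant_along fst (precompose F (\<lambda>_ :: 'a \<times> 'b. (Orderings.top, Orderings.top)))"
    by (rule constant_along_precompose) simp
  ultimately show ?thesis unfolding piece_def by presburger
qed

lemma degree1_codegree1_piece: "degree1 K (piece n i)" "codegree1 K (piece n i)"
proof -
  have "degree1 K (piece n i) \<and> codegree1 K (piece n i)"
    using piece_constant_along[of n i]
  proof
    assume "constant_along fst (piece n i)"
    from degree1_codegree1_constant_along[OF is_vfunctor_piece this]
    show ?thesis by (simp add: inf_min sup_max)
  next
    assume "constant_along snd (piece n i)"
    from degree1_codegree1_constant_along[OF is_vfunctor_piece this]
    show ?thesis by (simp add: inf_min sup_max)
  qed
  then show "degree1 K (piece n i)" "codegree1 K (piece n i)" by simp_all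
qed

section \<open>The differential of the resolving complex\<close>

lemma edge_le_top: "(fst x, Orderings.top :: 'b) \<le> (Orderings.top, Orderings.top)"
  "(Orderings.top :: 'a, snd x) \<le> (Orderings.top, Orderings.top)" for x :: "'a \<times> 'b"
  by (simp_all add: less_eq_prod_def)

lemma vectorspace_piece: "vectorspace K (obj (pi_vfunctor (piece n)) x)"
proof -
  have "vectorspace K (obj (piece n i) x)" for i
    using is_vfunctor_piece[of n i] unfolding is_vfunctor_def by (rule conjunct1[THEN spec])
  then show ?thesis unfolding pi_vfunctor_simps by (rule vectorspace_pi_module[OF V.field_axioms])
qed

lemma piece_zero_closed: "\<zero>\<^bsub>obj (piece n i) x\<^esub> \<in> carrier (obj (piece n i) x)"
proof -
  interpret P: vect_functor K "piece n i" by unfold_locales (rule is_vfunctor_piece)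
  show ?thesis by (rule P.V.M.zero_closed)
qed

lemma piece_zero_add: "\<zero>\<^bsub>obj (piece n i) x\<^esub> \<oplus>\<^bsub>obj (piece n i) x\<^esub> \<zero>\<^bsub>obj (piece n i) x\<^esub> = \<zero>\<^bsub>obj (piece n i) x\<^esub>"
  and piece_zero_smult: "c \<in> carrier K \<Longrightarrow> c \<odot>\<^bsub>obj (piece n i) x\<^esub> \<zero>\<^bsub>obj (piece n i) x\<^esub> = \<zero>\<^bsub>obj (piece n i) x\<^esub>"
proof -
  interpret P: vect_functor K "piece n i" by unfold_locales (rule is_vfunctor_piece)
  show "\<zero>\<^bsub>obj (piece n i) x\<^esub> \<oplus>\<^bsub>obj (piece n i) x\<^esub> \<zero>\<^bsub>obj (piece n i) x\<^esub> = \<zero>\<^bsub>obj (piece n i) x\<^esub>"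
    "c \<in> carrier K \<Longrightarrow> c \<odot>\<^bsub>obj (piece n i) x\<^esub> \<zero>\<^bsub>obj (piece n i) x\<^esub> = \<zero>\<^bsub>obj (piece n i) x\<^esub>"
    by simp_all
qed

lemma bd_linear_1: "linear_map K (obj (pi_vfunctor (piece 1)) x) (obj (pi_vfunctor (piece 0)) x) (bd 1 x)"
proof (rule linear_mapI[OF vectorspace_piece vectorspace_piece])
  note A = submodule_closed[OF submodule_KerA] and B = submodule_closed[OF submodule_KerB]
  have p: "v 0 \<in> KerA x" "v 1 \<in> KerB x" "v 0 \<in> Ker origin" "v 1 \<in> Ker origin"
    "v 0 \<in> carrier (obj F origin)" "v 1 \<in> carrier (obj F origin)"
    if "v \<in> carrier (obj (pi_vfunctor (piece 1)) x)" for v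
  proof -
    have "v i \<in> carrier (obj (piece 1 i) x)" for i using that by simp
    from this[of 0] this[of 1] show *: "v 0 \<in> KerA x" "v 1 \<in> KerB x" by (simp_all add: piece_def)
    then show "v 0 \<in> Ker origin" "v 1 \<in> Ker origin" by (simp_all add: KerA_def KerB_def)
    show "v 0 \<in> carrier (obj F origin)" "v 1 \<in> carrier (obj F origin)" using A(1) B(1) * by simp_all
  qed
  have p0: "obj (piece 0 0) x = obj (subspace_vfunctor (obj F origin) (\<lambda>_. Ker origin)) x"
    "obj (piece 1 0) x = obj (subspace_vfunctor (obj F origin) KerA) x"
    "obj (piece 1 (Suc 0)) x = obj (subspace_vfunctor (obj F origin) KerB) x"
    by (simp_all add: piece_def)
  show "bd 1 x v \<in> carrier (obj (pi_vfunctor (piece 0)) x)"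
    if v: "v \<in> carrier (obj (pi_vfunctor (piece 1)) x)" for v
    using Ker_closed(2)[OF p(3,4)[OF v]] piece_zero_closed[of 0] by (simp add: bd_def p0)
  show "bd 1 x (v \<oplus>\<^bsub>obj (pi_vfunctor (piece 1)) x\<^esub> w) = bd 1 x v \<oplus>\<^bsub>obj (pi_vfunctor (piece 0)) x\<^esub> bd 1 x w"
    if v: "v \<in> carrier (obj (pi_vfunctor (piece 1)) x)" and w: "w \<in> carrier (obj (pi_vfunctor (piece 1)) x)" for v w
    using p(5,6)[OF v] p(5,6)[OF w] piece_zero_add[of 0]
    by (simp add: bd_def p0 fun_eq_iff V.M.a_ac)
  show "bd 1 x (c \<odot>\<^bsub>obj (pi_vfunctor (piece 1)) x\<^esub> v) = c \<odot>\<^bsub>obj (pi_vfunctor (piece 0)) x\<^esub> bd 1 x v"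
    if c: "c \<in> carrier K" and v: "v \<in> carrier (obj (pi_vfunctor (piece 1)) x)" for c v
    using p(5,6)[OF v] c piece_zero_smult[OF c, of 0]
    by (simp add: bd_def p0 fun_eq_iff V.smult_r_distr)
qed

lemma bd_linear_0: "linear_map K (obj (pi_vfunctor (piece 0)) x) (obj (pi_vfunctor (piece (-1))) x) (bd 0 x)"
proof (rule linear_mapI[OF vectorspace_piece vectorspace_piece])
  have p: "v 1 \<in> carrier (obj F (fst x, Orderings.top))" "v 2 \<in> carrier (obj F (Orderings.top, snd x))"
    if "v \<in> carrier (obj (pi_vfunctor (piece 0)) x)" for v
  proof -
    have "v i \<in> carrier (obj (piece 0 i) x)" for i using that by simp
    from this[of 1] this[of 2]
    show "v 1 \<in> carrier (obj F (fst x, Orderings.top))" "v 2 \<in> carrier (obj F (Orderings.top, snd x))"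
      by (simp_all add: piece_def)
  qed
  have p0: "obj (piece (-1) 0) x = obj F (Orderings.top, Orderings.top)"
    "obj (piece 0 (Suc 0)) x = obj F (fst x, Orderings.top)"
    "obj (piece 0 2) x = obj F (Orderings.top, snd x)"
    by (simp_all add: piece_def)
  show "bd 0 x v \<in> carrier (obj (pi_vfunctor (piece (-1))) x)"
    if v: "v \<in> carrier (obj (pi_vfunctor (piece 0)) x)" for v
    using p[OF v] edge_le_top[of x] piece_zero_closed[of "-1"] by (simp add: bd_def p0)
  show "bd 0 x (v \<oplus>\<^bsub>obj (pi_vfunctor (piece 0)) x\<^esub> w) = bd 0 x v \<oplus>\<^bsub>obj (pi_vfunctor (piece (-1))) x\<^esub> bd 0 x w"
    if v: "v \<in> carrier (obj (pi_vfunctor (piece 0)) x)" and w: "w \<in> carrier (obj (pi_vfunctor (piece 0)) x)" for v w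
    using p[OF v] p[OF w] piece_zero_add[of "-1"] edge_le_top[of x]
    by (simp add: bd_def p0 fun_eq_iff V.M.a_ac V.M.minus_add a_minus_def)
  show "bd 0 x (c \<odot>\<^bsub>obj (pi_vfunctor (piece 0)) x\<^esub> v) = c \<odot>\<^bsub>obj (pi_vfunctor (piece (-1))) x\<^esub> bd 0 x v"
    if c: "c \<in> carrier K" and v: "v \<in> carrier (obj (pi_vfunctor (piece 0)) x)" for c v
    using p[OF v] c piece_zero_smult[OF c, of "-1"] edge_le_top[of x]
    by (simp add: bd_def p0 fun_eq_iff V.smult_r_distr V.smult_r_minus a_minus_def)
qed

lemma bd_linear:
  "linear_map K (obj (pi_vfunctor (piece n)) x) (obj (pi_vfunctor (piece (n - 1))) x) (bd n x)"
proof -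
  consider (one) "n = 1" | (zero) "n = 0" | (other) "n \<noteq> 1" "n \<noteq> 0" by blast
  then show ?thesis
  proof cases
    case one then show ?thesis using bd_linear_1 by simp
  next
    case zero then show ?thesis using bd_linear_0 by simp
  next
    case other
    then have bd: "bd n x v = \<zero>\<^bsub>obj (pi_vfunctor (piece (n - 1))) x\<^esub>" for v by (simp add: bd_def fun_eq_iff)
    interpret W: vectorspace K "obj (pi_vfunctor (piece (n - 1))) x" by (rule vectorspace_piece)
    show ?thesis
      by (rule linear_mapI[OF vectorspace_piece vectorspace_piece]; simp only: bd W.M.zero_closed W.M.r_zero W.rmult_0)
  qed
qed

lemma is_cfunctor_resolution: "is_cfunctor K resolution"
  unfolding resolution_def
proof (rule is_cfunctor_cplx_cfunctor)
  show "is_vfunctor K (pi_vfunctor (piece n))" for n by (rule is_vfunctor_pi[OF is_vfunctor_piece])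
  show "linear_map K (obj (pi_vfunctor (piece n)) x) (obj (pi_vfunctor (piece (n - 1))) x) (bd n x)" for n x
    by (rule bd_linear)
  interpret P: vect_functor K "piece n i" for n i by unfold_locales (rule is_vfunctor_piece)
  fix n and x :: "'a \<times> 'b" and v assume v: "v \<in> carrier (obj (pi_vfunctor (piece n)) x)"
  then have vi: "v i \<in> carrier (obj (piece n i) x)" for i by simp
  show "bd (n - 1) x (bd n x v) = \<zero>\<^bsub>obj (pi_vfunctor (piece (n - 1 - 1))) x\<^esub>"
  proof
    fix i
    \<comment> \<open>The components of \<open>bd n x v\<close> that \<open>bd (n - 1)\<close> reads
      are default zeros; naming the pieces identifies them as zeros of the spaces in which they are
      read.\<close>
    have "piece 0 1 = precompose F (\<lambda>x. (fst x, Orderings.top))" "piece 0 2 = precompose F (\<lambda>x. (Orderings.top, snd x))"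
      "piece (-1) 0 = precompose F (\<lambda>_. (Orderings.top, Orderings.top))"
      "piece 1 0 = subspace_vfunctor (obj F origin) KerA" "piece 1 1 = subspace_vfunctor (obj F origin) KerB"
      "piece 0 0 = subspace_vfunctor (obj F origin) (\<lambda>_. Ker origin)"
      by (simp_all add: piece_def)
    then show "bd (n - 1) x (bd n x v) i = \<zero>\<^bsub>obj (pi_vfunctor (piece (n - 1 - 1))) x\<^esub> i"
      using edge_le_top[of x] by (simp add: bd_def V.M.minus_eq_zero_iff)
  qed
  show "arr (pi_vfunctor (piece (n - 1))) x y (bd n x v) = bd n y (arr (pi_vfunctor (piece n)) x y v)"
    if xy: "x \<le> y" for y
  proof
    fix i :: nat
    consider (one) "n = 1" "i = 0" | (zero) "n = 0" "i = 0" | (other) "\<not> (n = 1 \<and> i = 0)" "\<not> (n = 0 \<and> i = 0)" by blast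
    then show "arr (pi_vfunctor (piece (n - 1))) x y (bd n x v) i = bd n y (arr (pi_vfunctor (piece n)) x y v) i"
    proof cases
      case one
      then show ?thesis by (simp add: bd_def piece_def)
    next
      case zero
      have le: "(fst x, Orderings.top :: 'b) \<le> (fst y, Orderings.top)" "(Orderings.top :: 'a, snd x) \<le> (Orderings.top, snd y)"
        using xy by (simp_all add: less_eq_prod_def)
      have vc: "v 1 \<in> carrier (obj F (fst x, Orderings.top))" "v 2 \<in> carrier (obj F (Orderings.top, snd x))"
        using vi[of 1] vi[of 2] by (simp_all add: zero piece_def)
      then show ?thesis
        using edge_le_top[of x] arr_comp[OF le(1) edge_le_top(1) vc(1)] arr_comp[OF le(2) edge_le_top(2) vc(2)]
        by (simp add: zero bd_def piece_def)
    next
      case other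
      then have "bd n x v i = \<zero>\<^bsub>obj (piece (n - 1) i) x\<^esub>" "bd n y w i = \<zero>\<^bsub>obj (piece (n - 1) i) y\<^esub>" for w
        unfolding bd_def by (simp_all only: if_False)
      then show ?thesis using xy by simp
    qed
  qed
qed

lemma homotopy_degree1_resolution: "homotopy_degree1 K resolution"
  unfolding resolution_def
  by (intro homotopy_degree1_cplx_cfunctor is_cfunctor_resolution[unfolded resolution_def]
      degree1_codegree1_pi is_vfunctor_pi is_vfunctor_piece degree1_codegree1_piece)

section \<open>Degree 0 homology of the resolving complex\<close>

lemma resolution_simps:
  "grade (cobj resolution x) n = obj (pi_vfunctor (piece n)) x"
  "bdry (cobj resolution x) n = bd n x"
  "carr resolution x y n = arr (pi_vfunctor (piece n)) x y"
  by (simp_all add: resolution_def cplx_cfunctor_def)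

lemma is_cplx_resolution: "is_cplx K (cobj resolution x)"
  using is_cfunctor_resolution unfolding is_cfunctor_def by (rule conjunct1[THEN spec])

lemma is_chain_map_resolution:
  "x \<le> y \<Longrightarrow> is_chain_map K (cobj resolution x) (cobj resolution y) (carr resolution x y)"
  using is_cfunctor_resolution unfolding is_cfunctor_def by (elim conjE) (drule spec, drule spec, erule mp)

lemma piece_0_simps:
  "obj (piece 0 0) x = obj (subspace_vfunctor (obj F origin) (\<lambda>_. Ker origin)) x"
  "obj (piece 0 (Suc 0)) x = obj F (fst x, Orderings.top)"
  "obj (piece 0 2) x = obj F (Orderings.top, snd x)"
  "i > 2 \<Longrightarrow> obj (piece 0 i) x = obj (subspace_vfunctor (obj F origin) (\<lambda>_. {\<zero>\<^bsub>obj F origin\<^esub>})) x"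
  by (simp_all add: piece_def)

lemma nat_cases_3:
  obtains "i = 0" | "i = Suc 0" | "i = 2" | "i > (2::nat)"
  by linarith

lemma mem_piece_0_iff:
  "w \<in> carrier (obj (pi_vfunctor (piece 0)) x) \<longleftrightarrow> w 0 \<in> Ker origin \<and>
    w (Suc 0) \<in> carrier (obj F (fst x, Orderings.top)) \<and> w 2 \<in> carrier (obj F (Orderings.top, snd x)) \<and>
    (\<forall>i>2. w i = \<zero>\<^bsub>obj F origin\<^esub>)"
proof -
  have "(\<forall>i. w i \<in> carrier (obj (piece 0 i) x)) \<longleftrightarrow> w 0 \<in> carrier (obj (piece 0 0) x) \<and>
      w (Suc 0) \<in> carrier (obj (piece 0 (Suc 0)) x) \<and> w 2 \<in> carrier (obj (piece 0 2) x) \<and>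
      (\<forall>i>2. w i \<in> carrier (obj (piece 0 i) x))"
    by (metis nat_cases_3)
  then show ?thesis by (simp add: piece_0_simps)
qed

text \<open>The component in \<open>Ker origin\<close> is free, while the other two form a point of
  the fibre product over the far corner.\<close>

lemma mem_cycles_0_iff:
  "w \<in> cycles (cobj resolution x) 0 \<longleftrightarrow> w \<in> carrier (obj (pi_vfunctor (piece 0)) x) \<and>
    arr F (fst x, Orderings.top) (Orderings.top, Orderings.top) (w (Suc 0)) =
    arr F (Orderings.top, snd x) (Orderings.top, Orderings.top) (w 2)"
proof -
  have "bd 0 x w = \<zero>\<^bsub>obj (pi_vfunctor (piece (-1))) x\<^esub> \<longleftrightarrow>
      arr F (fst x, Orderings.top) (Orderings.top, Orderings.top) (w (Suc 0)) \<ominus>\<^bsub>obj F (Orderings.top, Orderings.top)\<^esub>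
      arr F (Orderings.top, snd x) (Orderings.top, Orderings.top) (w 2) = \<zero>\<^bsub>obj F (Orderings.top, Orderings.top)\<^esub>"
    by (auto simp: fun_eq_iff bd_def piece_def)
  also have "\<dots> \<longleftrightarrow> arr F (fst x, Orderings.top) (Orderings.top, Orderings.top) (w (Suc 0)) =
      arr F (Orderings.top, snd x) (Orderings.top, Orderings.top) (w 2)"
    if "w \<in> carrier (obj (pi_vfunctor (piece 0)) x)"
    using that edge_le_top[of x] unfolding mem_piece_0_iff by (simp add: V.M.minus_eq_zero_iff)
  finally show ?thesis unfolding cycles_def resolution_simps by auto
qed

text \<open>Boundaries fill \<open>KerA x + KerB x\<close> in component 0 and vanish elsewhere, and
  by \<open>KerA_KerB_sum\<close> this is the kernel of \<open>Ker origin \<rightarrow> F x\<close>.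
  So the class of a cycle amounts to a vector of \<open>Ker x\<close> and a compatible pair on the
  far edges.\<close>

lemma coset_resolution_eq_iff:
  assumes z: "z \<in> carrier (obj (pi_vfunctor (piece 0)) x)" and w: "w \<in> carrier (obj (pi_vfunctor (piece 0)) x)"
  shows "boundaries (cobj resolution x) 0 +>\<^bsub>grade (cobj resolution x) 0\<^esub> z =
      boundaries (cobj resolution x) 0 +>\<^bsub>grade (cobj resolution x) 0\<^esub> w \<longleftrightarrow>
    arr F origin x (z 0) = arr F origin x (w 0) \<and> z (Suc 0) = w (Suc 0) \<and> z 2 = w 2"
proof -
  note z' = z[unfolded mem_piece_0_iff] and w' = w[unfolded mem_piece_0_iff]
  have zw0: "z 0 \<in> Ker origin" "w 0 \<in> Ker origin" "z 0 \<in> carrier (obj F origin)" "w 0 \<in> carrier (obj F origin)"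
    using z' w' Ker_closed(1) by simp_all
  have bd1: "(bd 1 x v \<oplus>\<^bsub>obj (pi_vfunctor (piece 0)) x\<^esub> w) i = (if i = 0 then (v 0 \<oplus>\<^bsub>obj F origin\<^esub> v 1) \<oplus>\<^bsub>obj F origin\<^esub> w 0 else w i)"
    for v i
    using w' by (cases i rule: nat_cases_3) (simp_all add: bd_def piece_0_simps)
  have "boundaries (cobj resolution x) 0 +>\<^bsub>grade (cobj resolution x) 0\<^esub> z =
      boundaries (cobj resolution x) 0 +>\<^bsub>grade (cobj resolution x) 0\<^esub> w \<longleftrightarrow>
    (\<exists>v\<in>carrier (obj (pi_vfunctor (piece 1)) x). z = bd 1 x v \<oplus>\<^bsub>obj (pi_vfunctor (piece 0)) x\<^esub> w)"
    using homology_coset_eq_iff[OF is_cplx_resolution, of z x 0 w] z w unfolding resolution_simps by simp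
  also have "\<dots> \<longleftrightarrow> (\<exists>a\<in>KerA x. \<exists>b\<in>KerB x. z 0 = (a \<oplus>\<^bsub>obj F origin\<^esub> b) \<oplus>\<^bsub>obj F origin\<^esub> w 0) \<and>
      z (Suc 0) = w (Suc 0) \<and> z 2 = w 2"
  proof (intro iffI conjI)
    assume "\<exists>v\<in>carrier (obj (pi_vfunctor (piece 1)) x). z = bd 1 x v \<oplus>\<^bsub>obj (pi_vfunctor (piece 0)) x\<^esub> w"
    then obtain v where v: "v \<in> carrier (obj (pi_vfunctor (piece 1)) x)"
      "z = bd 1 x v \<oplus>\<^bsub>obj (pi_vfunctor (piece 0)) x\<^esub> w" ..
    have vi: "v i \<in> carrier (obj (piece 1 i) x)" for i using v(1) by simp
    have "v 0 \<in> KerA x" "v 1 \<in> KerB x" using vi[of 0] vi[of 1] by (simp_all add: piece_def)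
    then show "\<exists>a\<in>KerA x. \<exists>b\<in>KerB x. z 0 = (a \<oplus>\<^bsub>obj F origin\<^esub> b) \<oplus>\<^bsub>obj F origin\<^esub> w 0"
      using bd1[of v 0] unfolding v(2) by (simp only: simp_thms if_True) metis
    show "z (Suc 0) = w (Suc 0)" "z 2 = w 2"
      unfolding v(2) bd1 by simp_all
  next
    assume "(\<exists>a\<in>KerA x. \<exists>b\<in>KerB x. z 0 = (a \<oplus>\<^bsub>obj F origin\<^esub> b) \<oplus>\<^bsub>obj F origin\<^esub> w 0) \<and>
      z (Suc 0) = w (Suc 0) \<and> z 2 = w 2"
    then obtain a b where ab: "a \<in> KerA x" "b \<in> KerB x" "z 0 = (a \<oplus>\<^bsub>obj F origin\<^esub> b) \<oplus>\<^bsub>obj F origin\<^esub> w 0"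
      and eq: "z (Suc 0) = w (Suc 0)" "z 2 = w 2" by meson
    define v where "v i = (if i = 0 then a else if i = Suc 0 then b else \<zero>\<^bsub>obj F origin\<^esub>)" for i
    have "v \<in> carrier (obj (pi_vfunctor (piece 1)) x)"
      using ab(1,2) by (simp add: v_def piece_def)
    moreover have "z = bd 1 x v \<oplus>\<^bsub>obj (pi_vfunctor (piece 0)) x\<^esub> w"
    proof
      fix i
      show "z i = (bd 1 x v \<oplus>\<^bsub>obj (pi_vfunctor (piece 0)) x\<^esub> w) i"
        unfolding bd1 using ab(3) eq z' w' by (cases i rule: nat_cases_3) (simp_all add: v_def)
    qed
    ultimately show "\<exists>v\<in>carrier (obj (pi_vfunctor (piece 1)) x). z = bd 1 x v \<oplus>\<^bsub>obj (pi_vfunctor (piece 0)) x\<^esub> w"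
      by (intro bexI[of _ v])
  qed
  also have "(\<exists>a\<in>KerA x. \<exists>b\<in>KerB x. z 0 = (a \<oplus>\<^bsub>obj F origin\<^esub> b) \<oplus>\<^bsub>obj F origin\<^esub> w 0) \<longleftrightarrow>
      arr F origin x (z 0) = arr F origin x (w 0)"
  proof
    assume "\<exists>a\<in>KerA x. \<exists>b\<in>KerB x. z 0 = (a \<oplus>\<^bsub>obj F origin\<^esub> b) \<oplus>\<^bsub>obj F origin\<^esub> w 0"
    then obtain a b where ab: "a \<in> KerA x" "b \<in> KerB x" "z 0 = (a \<oplus>\<^bsub>obj F origin\<^esub> b) \<oplus>\<^bsub>obj F origin\<^esub> w 0"
      by meson
    have c: "a \<in> carrier (obj F origin)" "b \<in> carrier (obj F origin)"
      using ab submodule_closed(1)[OF submodule_KerA] submodule_closed(1)[OF submodule_KerB] by simp_all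
    have "arr F origin x a = \<zero>\<^bsub>obj F x\<^esub>" "arr F origin x b = \<zero>\<^bsub>obj F x\<^esub>"
      using ab arr_eq_zero_mono[OF origin_le(4,2) c(1)] arr_eq_zero_mono[OF origin_le(5,3) c(2)]
      by (simp_all add: KerA_def KerB_def)
    then show "arr F origin x (z 0) = arr F origin x (w 0)"
      using c zw0 origin_le(1)[of x] unfolding ab(3) by simp
  next
    assume eq: "arr F origin x (z 0) = arr F origin x (w 0)"
    have "arr F origin x (z 0 \<ominus>\<^bsub>obj F origin\<^esub> w 0) = \<zero>\<^bsub>obj F x\<^esub>"
      using zw0 eq origin_le(1)[of x] by (simp add: V.M.minus_eq_zero_iff)
    from KerA_KerB_sum[OF Ker_closed(6)[OF zw0(1,2)] this]
    obtain a b where "a \<in> KerA x" "b \<in> KerB x" "z 0 \<ominus>\<^bsub>obj F origin\<^esub> w 0 = a \<oplus>\<^bsub>obj F origin\<^esub> b" .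
    moreover have "z 0 = (z 0 \<ominus>\<^bsub>obj F origin\<^esub> w 0) \<oplus>\<^bsub>obj F origin\<^esub> w 0"
      using zw0 by (simp add: V.M.minus_add_cancel)
    ultimately show "\<exists>a\<in>KerA x. \<exists>b\<in>KerB x. z 0 = (a \<oplus>\<^bsub>obj F origin\<^esub> b) \<oplus>\<^bsub>obj F origin\<^esub> w 0"
      by metis
  qed
  finally show ?thesis .
qed

text \<open>A vector is sent to its \<open>Ker\<close> component together with its images on both
  far edges. The edges determine it only modulo \<open>Ker\<close>, and the natural projection
  \<open>q\<close> supplied by the complement provides the missing component.\<close>

lemma homology_resolution_iso: "vfunctor_iso K F (homology_vfunctor 0 resolution)"
proof -
  obtain G where G: "complement G Ker" using Ker_complement ..
  note Gc = subfunctor_closed[OF complementD(1)[OF G]]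
  obtain p q where pq: "\<And>x v. v \<in> carrier (obj F x) \<Longrightarrow> p x v \<in> G x"
    "\<And>x v. v \<in> carrier (obj F x) \<Longrightarrow> q x v \<in> Ker x"
    "\<And>x v. v \<in> carrier (obj F x) \<Longrightarrow> v = p x v \<oplus>\<^bsub>obj F x\<^esub> q x v"
    "\<And>x v g s. g \<in> G x \<Longrightarrow> s \<in> Ker x \<Longrightarrow> v = g \<oplus>\<^bsub>obj F x\<^esub> s \<Longrightarrow> p x v = g \<and> q x v = s"
    using complement_projections[OF G] by metis
  have car: "p x v \<in> carrier (obj F x)" "q x v \<in> carrier (obj F x)" if "v \<in> carrier (obj F x)" for x v
    by (rule Gc(1)[OF pq(1)[OF that]], rule Ker_closed(1)[OF pq(2)[OF that]])
  have q_add: "q x (v \<oplus>\<^bsub>obj F x\<^esub> w) = q x v \<oplus>\<^bsub>obj F x\<^esub> q x w"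
    if vw: "v \<in> carrier (obj F x)" "w \<in> carrier (obj F x)" for x v w
  proof -
    have "v \<oplus>\<^bsub>obj F x\<^esub> w = (p x v \<oplus>\<^bsub>obj F x\<^esub> q x v) \<oplus>\<^bsub>obj F x\<^esub> (p x w \<oplus>\<^bsub>obj F x\<^esub> q x w)"
      using pq(3)[OF vw(1)] pq(3)[OF vw(2)] by simp
    also have "\<dots> = (p x v \<oplus>\<^bsub>obj F x\<^esub> p x w) \<oplus>\<^bsub>obj F x\<^esub> (q x v \<oplus>\<^bsub>obj F x\<^esub> q x w)"
      using car vw by (simp add: V.M.a_ac)
    finally show ?thesis
      by (rule pq(4)[OF Gc(2)[OF pq(1)[OF vw(1)] pq(1)[OF vw(2)]]
            Ker_closed(2)[OF pq(2)[OF vw(1)] pq(2)[OF vw(2)]], THEN conjunct2])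
  qed
  have q_smult: "q x (c \<odot>\<^bsub>obj F x\<^esub> v) = c \<odot>\<^bsub>obj F x\<^esub> q x v"
    if v: "v \<in> carrier (obj F x)" "c \<in> carrier K" for x v c
  proof -
    have "c \<odot>\<^bsub>obj F x\<^esub> v = c \<odot>\<^bsub>obj F x\<^esub> (p x v \<oplus>\<^bsub>obj F x\<^esub> q x v)"
      using pq(3)[OF v(1)] by simp
    also have "\<dots> = c \<odot>\<^bsub>obj F x\<^esub> p x v \<oplus>\<^bsub>obj F x\<^esub> c \<odot>\<^bsub>obj F x\<^esub> q x v"
      using car v by (simp add: V.smult_r_distr)
    finally show ?thesis
      by (rule pq(4)[OF Gc(4)[OF v(2) pq(1)[OF v(1)]] Ker_closed(4)[OF v(2) pq(2)[OF v(1)]], THEN conjunct2])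
  qed
  have q_arr: "q y (arr F x y v) = arr F x y (q x v)" if "x \<le> y" "v \<in> carrier (obj F x)" for x y v
  proof -
    have "arr F x y v = arr F x y (p x v) \<oplus>\<^bsub>obj F y\<^esub> arr F x y (q x v)"
      using arr_add[OF that(1) car[OF that(2)]] pq(3)[OF that(2)] by simp
    then show ?thesis
      using pq(4)[OF Gc(7)[OF that(1) pq(1)[OF that(2)]] Ker_closed(7)[OF that(1) pq(2)[OF that(2)]]] by simp
  qed
  have "\<exists>u. v \<in> carrier (obj F x) \<longrightarrow> u \<in> Ker origin \<and> arr F origin x u = q x v" for x v
  proof (cases "v \<in> carrier (obj F x)")
    case True
    obtain u where "u \<in> Ker origin" "arr F origin x u = q x v"
      by (rule Ker_surj[OF origin_le(1) pq(2)[OF True]])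
    then show ?thesis by metis
  qed simp
  then have "\<forall>x v. \<exists>u. v \<in> carrier (obj F x) \<longrightarrow> u \<in> Ker origin \<and> arr F origin x u = q x v" by (intro allI)
  \<comment> \<open>The chosen preimages \<open>l x v\<close> need be neither linear nor natural in
    \<open>v\<close>; classes see only their images in \<open>F x\<close>, which are the values of
    \<open>q\<close>.\<close>
  then obtain l where "\<forall>x v. v \<in> carrier (obj F x) \<longrightarrow> l x v \<in> Ker origin \<and> arr F origin x (l x v) = q x v"
    unfolding choice_iff by (rule exE)
  note l = this[rule_format]
  define s where "s x v i = (if i = 0 then l x v else if i = Suc 0 then arr F x (fst x, Orderings.top) v
    else if i = 2 then arr F x (Orderings.top, snd x) v else \<zero>\<^bsub>obj F origin\<^esub>)" for x v and i :: nat
  let ?H = "\<lambda>x. homology (cobj resolution x) 0"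
  let ?c = "\<lambda>x z. boundaries (cobj resolution x) 0 +>\<^bsub>grade (cobj resolution x) 0\<^esub> z"
  have s_car: "s x v \<in> carrier (obj (pi_vfunctor (piece 0)) x)" if "v \<in> carrier (obj F x)" for x v
    using that l le_edge[of x] unfolding mem_piece_0_iff by (simp add: s_def)
  have s_cyc: "s x v \<in> cycles (cobj resolution x) 0" if v: "v \<in> carrier (obj F x)" for x v
    using s_car[OF v] arr_comp[OF le_edge(1) edge_le_top(1) v] arr_comp[OF le_edge(2) edge_le_top(2) v]
    unfolding mem_cycles_0_iff by (simp add: s_def)
  define \<eta> where "\<eta> x v = ?c x (s x v)" for x v
  \<comment> \<open>Linearity, injectivity, surjectivity and naturality of \<open>\<eta>\<close> all
    reduce to comparing these three vectors.\<close>
  have \<eta>_eq: "\<eta> x v = ?c x w \<longleftrightarrow> q x v = arr F origin x (w 0) \<and>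
      arr F x (fst x, Orderings.top) v = w (Suc 0) \<and> arr F x (Orderings.top, snd x) v = w 2"
    if v: "v \<in> carrier (obj F x)" and w: "w \<in> carrier (obj (pi_vfunctor (piece 0)) x)" for x v w
    unfolding \<eta>_def coset_resolution_eq_iff[OF s_car[OF v] w] using l[OF v] by (simp add: s_def)
  interpret P: vectorspace K "obj (pi_vfunctor (piece 0)) x" for x by (rule vectorspace_piece)
  have lin: "linear_map K (obj F x) (?H x) (\<eta> x)" for x
  proof (rule linear_mapI[OF V.vectorspace_axioms vectorspace_homology[OF is_cplx_resolution]])
    show "\<eta> x v \<in> carrier (?H x)" if "v \<in> carrier (obj F x)" for v
      unfolding \<eta>_def carrier_homology using s_cyc[OF that] by (rule imageI)
    show "\<eta> x (v \<oplus>\<^bsub>obj F x\<^esub> w) = \<eta> x v \<oplus>\<^bsub>?H x\<^esub> \<eta> x w"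
      if v: "v \<in> carrier (obj F x)" and w: "w \<in> carrier (obj F x)" for v w
    proof -
      have "\<eta> x v \<oplus>\<^bsub>?H x\<^esub> \<eta> x w = ?c x (s x v \<oplus>\<^bsub>obj (pi_vfunctor (piece 0)) x\<^esub> s x w)"
        using add_homology[OF is_cplx_resolution s_cyc[OF v] s_cyc[OF w]] unfolding \<eta>_def resolution_simps .
      moreover have "\<eta> x (v \<oplus>\<^bsub>obj F x\<^esub> w) = ?c x (s x v \<oplus>\<^bsub>obj (pi_vfunctor (piece 0)) x\<^esub> s x w)"
        unfolding \<eta>_eq[OF V.M.a_closed[OF v w] P.M.a_closed[OF s_car[OF v] s_car[OF w]]]
        using v w l[OF v] l[OF w] q_add[OF v w] le_edge[of x] origin_le(1)[of x] Ker_closed(1)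
        by (simp add: s_def piece_0_simps)
      ultimately show ?thesis by (rule trans[OF _ sym, rotated])
    qed
    show "\<eta> x (c \<odot>\<^bsub>obj F x\<^esub> v) = c \<odot>\<^bsub>?H x\<^esub> \<eta> x v" if c: "c \<in> carrier K" and v: "v \<in> carrier (obj F x)" for c v
    proof -
      have "c \<odot>\<^bsub>?H x\<^esub> \<eta> x v = ?c x (c \<odot>\<^bsub>obj (pi_vfunctor (piece 0)) x\<^esub> s x v)"
        using smult_homology[OF is_cplx_resolution c s_cyc[OF v]] unfolding \<eta>_def resolution_simps .
      moreover have "\<eta> x (c \<odot>\<^bsub>obj F x\<^esub> v) = ?c x (c \<odot>\<^bsub>obj (pi_vfunctor (piece 0)) x\<^esub> s x v)"
        unfolding \<eta>_eq[OF V.smult_closed[OF c v] P.smult_closed[OF c s_car[OF v]]]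
        using v c l[OF v] q_smult[OF v c] le_edge[of x] origin_le(1)[of x] Ker_closed(1)
        by (simp add: s_def piece_0_simps)
      ultimately show ?thesis by (rule trans[OF _ sym, rotated])
    qed
  qed
  have inj: "inj_on (\<eta> x) (carrier (obj F x))" for x
  proof (rule inj_onI)
    fix v w assume v: "v \<in> carrier (obj F x)" and w: "w \<in> carrier (obj F x)" and eq: "\<eta> x v = \<eta> x w"
    have "q x v = q x w" and edge: "arr F x (fst x, Orderings.top) v = arr F x (fst x, Orderings.top) w"
      "arr F x (Orderings.top, snd x) v = arr F x (Orderings.top, snd x) w"
      using eq \<eta>_eq[OF v s_car[OF w]] l[OF w] unfolding \<eta>_def[of x w] by (simp_all add: s_def)
    \<comment> \<open>Equal edges put the difference into \<open>Ker\<close>, where \<open>q\<close>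
      is the identity; equal values of \<open>q\<close> then force it to be zero.\<close>
    have k: "v \<ominus>\<^bsub>obj F x\<^esub> w \<in> Ker x"
      using v w edge le_edge[of x] by (simp add: Ker_def V.M.minus_eq_zero_iff)
    have "v = (v \<ominus>\<^bsub>obj F x\<^esub> w) \<oplus>\<^bsub>obj F x\<^esub> w" using V.M.minus_add_cancel[OF v w] by simp
    then have "q x v = q x ((v \<ominus>\<^bsub>obj F x\<^esub> w) \<oplus>\<^bsub>obj F x\<^esub> w)" by (rule arg_cong)
    also have "\<dots> = q x (v \<ominus>\<^bsub>obj F x\<^esub> w) \<oplus>\<^bsub>obj F x\<^esub> q x w" by (rule q_add[OF V.M.minus_closed[OF v w] w])
    also have "q x (v \<ominus>\<^bsub>obj F x\<^esub> w) = v \<ominus>\<^bsub>obj F x\<^esub> w"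
      using pq(4)[OF Gc(3) k] Ker_closed(1)[OF k] by simp
    finally have "(v \<ominus>\<^bsub>obj F x\<^esub> w) \<oplus>\<^bsub>obj F x\<^esub> q x w = q x w" using \<open>q x v = q x w\<close> by simp
    then have "v \<ominus>\<^bsub>obj F x\<^esub> w = \<zero>\<^bsub>obj F x\<^esub>"
      using V.M.add_minus_cancel[OF V.M.minus_closed[OF v w] car(2)[OF w]] car(2)[OF w]
        V.M.minus_eq_zero_iff[OF car(2)[OF w] car(2)[OF w]] by simp
    then show "v = w" using V.M.minus_eq_zero_iff[OF v w] by simp
  qed
  have surj: "carrier (?H x) \<subseteq> \<eta> x ` carrier (obj F x)" for x
  proof
    fix X assume "X \<in> carrier (?H x)"
    then obtain w where w: "w \<in> cycles (cobj resolution x) 0" "X = ?c x w"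
      unfolding carrier_homology by (rule imageE)
    note w1 = w(1)[unfolded mem_cycles_0_iff, THEN conjunct1]
    note w2 = w1[unfolded mem_piece_0_iff] and w3 = w(1)[unfolded mem_cycles_0_iff, THEN conjunct2]
    have x: "(fst x, snd x) = x" by simp
    \<comment> \<open>Middle exactness of the square from \<open>x\<close> to the far corner gives a
      vector with the prescribed edges. Its \<open>Ker\<close> component is then exchanged for the
      prescribed one \<open>k\<close>, which leaves the edges unchanged.\<close>
    obtain t where t: "t \<in> carrier (obj F x)" "arr F x (fst x, Orderings.top) t = w (Suc 0)"
      "arr F x (Orderings.top, snd x) t = w 2"
      using middle_exact_rect[of "fst x" Orderings.top "snd x" Orderings.top "w (Suc 0)" "w 2"] w2 w3
      unfolding x by (metis top_greatest)
    define k where "k = arr F origin x (w 0)"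
    have k: "k \<in> Ker x" unfolding k_def using w2 Ker_closed(7)[OF origin_le(1)] by simp
    note pt = pq(1)[OF t(1)] and qt = pq(2)[OF t(1)]
    note c = Gc(1)[OF pt] Ker_closed(1)[OF qt] Ker_closed(1)[OF k]
    define v where "v = p x t \<oplus>\<^bsub>obj F x\<^esub> k"
    have v: "v \<in> carrier (obj F x)" using c by (simp add: v_def)
    have "arr F x e (p x t \<oplus>\<^bsub>obj F x\<^esub> k) = arr F x e t"
      if le: "x \<le> e" and e: "\<And>u. u \<in> Ker x \<Longrightarrow> arr F x e u = \<zero>\<^bsub>obj F e\<^esub>" for e
    proof -
      have "arr F x e t = arr F x e (p x t \<oplus>\<^bsub>obj F x\<^esub> q x t)" using pq(3)[OF t(1)] by simp
      then show ?thesis using le c e[OF k] e[OF qt] by simp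
    qed
    from this[OF le_edge(1)] this[OF le_edge(2)]
    have "arr F x (fst x, Orderings.top) v = w (Suc 0)" "arr F x (Orderings.top, snd x) v = w 2"
      using t(2,3) by (simp_all add: v_def Ker_def)
    moreover have "q x v = k" using pq(4)[OF pt k] by (simp add: v_def)
    ultimately have "\<eta> x v = X" unfolding w(2) \<eta>_eq[OF v w1] by (simp add: k_def)
    then show "X \<in> \<eta> x ` carrier (obj F x)" using v by (metis imageI)
  qed
  have bij: "bij_betw (\<eta> x) (carrier (obj F x)) (carrier (?H x))" for x
  proof -
    have "\<eta> x ` carrier (obj F x) \<subseteq> carrier (?H x)"
      using lin[of x] by (simp add: linear_map_iff module_hom_def image_subset_iff_funcset)
    then show ?thesis unfolding bij_betw_def using inj surj by (intro conjI equalityI)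
  qed
  have nat: "\<eta> y (arr F x y v) = homology_map (cobj resolution y) (carr resolution x y) 0 (\<eta> x v)"
    if xy: "x \<le> y" and v: "v \<in> carrier (obj F x)" for x y v
  proof -
    have le: "(fst x, Orderings.top :: 'b) \<le> (fst y, Orderings.top)" "(Orderings.top :: 'a, snd x) \<le> (Orderings.top, snd y)"
      using xy by (simp_all add: less_eq_prod_def)
    note av = arr_closed[OF xy v]
    have sg: "s x v \<in> carrier (grade (cobj resolution x) 0)" unfolding resolution_simps by (rule s_car[OF v])
    have "homology_map (cobj resolution y) (carr resolution x y) 0 (\<eta> x v) = ?c y (arr (pi_vfunctor (piece 0)) x y (s x v))"
      using homology_map_coset[OF is_chain_map_resolution[OF xy] sg] unfolding \<eta>_def resolution_simps .
    moreover have "arr (pi_vfunctor (piece 0)) x y (s x v) \<in> carrier (obj (pi_vfunctor (piece 0)) y)"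
      using is_chain_mapD(4)[OF is_chain_map_resolution[OF xy] sg] unfolding resolution_simps .
    note eq = \<eta>_eq[OF av this]
    have "arr F x y (q x v) = arr F origin y (l x v)"
      using arr_comp[OF origin_le(1) xy Ker_closed(1)[OF l[OF v, THEN conjunct1]]] l[OF v] by simp
    then have "\<eta> y (arr F x y v) = ?c y (arr (pi_vfunctor (piece 0)) x y (s x v))"
      using eq q_arr[OF xy v] arr_comp[OF le_edge(1) le(1) v] arr_comp[OF le_edge(2) le(2) v]
        arr_comp[OF xy le_edge(1) v] arr_comp[OF xy le_edge(2) v]
      by (simp add: s_def piece_def)
    ultimately show ?thesis by (rule trans[OF _ sym, rotated])
  qed
  show ?thesis
    unfolding vfunctor_iso_def homology_vfunctor_def using lin bij nat by (intro exI[of _ \<eta>]) simp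
qed

lemma homotopy_degree1_resolution_exists:
  "\<exists>\<Phi> :: ('a \<times> 'b, 'k, nat \<Rightarrow> 'v) cfunctor.
    is_cfunctor K \<Phi> \<and> homotopy_degree1 K \<Phi> \<and> vfunctor_iso K F (homology_vfunctor 0 \<Phi>)"
  using is_cfunctor_resolution homotopy_degree1_resolution homology_resolution_iso by metis

end

section \<open>Middle exactness as the link between the three conditions\<close>

lemma middle_exact_if_homotopy_degree1:
  fixes F :: "('p::distrib_lattice, 'k, 'v) vfunctor" and \<Phi> :: "('p, 'k, 'w) cfunctor"
  assumes "is_vfunctor K F" "is_cfunctor K \<Phi>" "homotopy_degree1 K \<Phi>" "vfunctor_iso K F (homology_vfunctor n \<Phi>)"
  shows "middle_exact F"
  using middle_exact_iso[OF assms(1) is_vfunctor_homology_vfunctor[OF assms(2)] assms(4)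
      middle_exact_homology[OF assms(2,3)]] .

text \<open>The witnesses built from \<open>F\<close> have carriers \<open>'v\<close> and
  \<open>nat \<Rightarrow> 'v\<close>. For the way back the carriers \<open>'g\<close>,
  \<open>'h\<close> and \<open>'c\<close> are free, so a decomposition or a lift of any size forces
  middle exactness.\<close>

theorem theorem6p9:
  fixes K :: "('k, 'm) ring_scheme"
    and F :: "(ennreal \<times> ennreal, 'k, 'v) vfunctor"
  assumes "field K"
    and "is_vfunctor K F"
    and "pointwise_fin_dim K F"
  shows
    "(middle_exact F \<longleftrightarrow>
        (\<exists>(G :: (ennreal \<times> ennreal, 'k, 'v) vfunctor) (H :: (ennreal \<times> ennreal, 'k, 'v) vfunctor).
          is_vfunctor K G \<and> degree1 K G \<and> is_vfunctor K H \<and> codegree1 K H \<and>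
          vfunctor_iso K F (direct_sum_vfunctor G H))) \<and>
     (middle_exact F \<longleftrightarrow>
        (\<exists>\<Phi> :: (ennreal \<times> ennreal, 'k, nat \<Rightarrow> 'v) cfunctor.
          is_cfunctor K \<Phi> \<and> homotopy_degree1 K \<Phi> \<and>
          vfunctor_iso K F (homology_vfunctor 0 \<Phi>))) \<and>
     ((\<exists>(G :: (ennreal \<times> ennreal, 'k, 'g) vfunctor) (H :: (ennreal \<times> ennreal, 'k, 'h) vfunctor).
          is_vfunctor K G \<and> degree1 K G \<and> is_vfunctor K H \<and> codegree1 K H \<and>
          vfunctor_iso K F (direct_sum_vfunctor G H)) \<longrightarrow> middle_exact F) \<and>
     ((\<exists>\<Phi> :: (ennreal \<times> ennreal, 'k, 'c) cfunctor.
          is_cfunctor K \<Phi> \<and> homotopy_degree1 K \<Phi> \<and>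
          vfunctor_iso K F (homology_vfunctor 0 \<Phi>)) \<longrightarrow> middle_exact F)"
proof (intro conjI iffI impI)
  have grid: "grid_functor K F" if "middle_exact F"
    using assms(2,3) that by (simp add: grid_functor_def grid_functor_axioms_def vect_functor_def)
  show "\<exists>(G :: (ennreal \<times> ennreal, 'k, 'v) vfunctor) (H :: (ennreal \<times> ennreal, 'k, 'v) vfunctor).
      is_vfunctor K G \<and> degree1 K G \<and> is_vfunctor K H \<and> codegree1 K H \<and>
      vfunctor_iso K F (direct_sum_vfunctor G H)" if "middle_exact F"
    using grid[OF that] by (rule grid_functor.degree1_codegree1_decomposition)
  show "\<exists>\<Phi> :: (ennreal \<times> ennreal, 'k, nat \<Rightarrow> 'v) cfunctor.
      is_cfunctor K \<Phi> \<and> homotopy_degree1 K \<Phi> \<and> vfunctor_iso K F (homology_vfunctor 0 \<Phi>)"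
    if "middle_exact F"
    using grid[OF that] by (rule grid_functor.homotopy_degree1_resolution_exists)
qed (blast intro: middle_exact_if_degree1_codegree1[OF assms(2)]
    middle_exact_if_homotopy_degree1[OF assms(2)])+

end
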